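(* Let $p=p(n)$, $q=q(n)\in[0,1]$ with $p+q>0$, let $d=(n-1)\frac{p}{p+q}$, and suppose that as $n\to\infty$, $d=\Omega(\log n)$, $p=O(\log n/n^2)$ and $q=O(\log n/(dn))$. For each $n$ let $G_0=(V,E_0)$ be a starting graph on $V=\{1,\dots,n\}$, and suppose that for large enough constants $c_1,c_2,c_3>0$ the following hold: (1) $\deg_0(x)=\Theta(d)$ for every $x\in V$; (2) $|E_0(S,V\setminus S)|\ge c_2\,(\log n)\,|S|$ for every $S\subset V$ with $|S|\le c_1\log n$; (3) $\Phi_{G_0}\ge c_3\log d/d$. Let $\mathscr G=(G_t)_{t\in\mathbb{N}}\sim\mathcal{G}(n,p,q)$ be the edge-Markovian sequence started from $G_0$. Then $t_{\mathrm{mix}}(\mathcal{G}(n,p,q))=O(\log n/\Phi_{G_0}^2)$; that is, there exist $t(n)=O(\log n/\Phi_{G_0}^2)$ and sequences $\epsilon_n\to0$, $\delta_n\to0$ such that $\mathbb{P}[\,t_{\mathrm{mix}}(\mathscr G;\epsilon_n)\le t(n)\,]\ge1-\delta_n$ for all sufficiently large $n$. (Here "large enough constants" means: there is a constant $C_0$, depending only on the implied constants in the asymptotic hypotheses, such that the conclusion holds whenever (1)–(3) hold with some constants $c_1,c_2,c_3\ge C_0$.)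
   Context: Edge-Markovian model $\mathcal{G}(n,p,q)$: given a starting graph $G_0$ on $V=\{1,\dots,n\}$, it is the random sequence of graphs $G_t=(V,E_t)$ in which, independently over all pairs $\{u,v\}$ of distinct vertices, $\mathbb{P}[\{u,v\}\in E_{t+1}\mid G_t]$ equals $1-q$ if $\{u,v\}\in E_t$ and $p$ if $\{u,v\}\notin E_t$. $\deg_t(x)$ is the degree of $x$ in $G_t$. $E_0(S,V\setminus S)$ is the set of edges of $G_0$ with one endpoint in $S$ and the other in $V\setminus S$. For a graph $G=(V,E)$ and $S\subseteq V$, $\mathrm{vol}(S)=\sum_{x\in S}\deg(x)$, and the conductance of $G$ is $$\Phi_G=\min_{S\subset V:\ 1\le\mathrm{vol}(S)\le\mathrm{vol}(V)/2}\frac{|E(S,V\setminus S)|}{\mathrm{vol}(S)}.$$ Random walk: $P_t$ is the lazy random walk transition matrix on $G_t$: $P_t(u,u)=1/2$, $P_t(u,v)=1/(2\deg_t(u))$ if $\{u,v\}\in E_t$, and $P_t(u,v)=0$ otherwise; if $\deg_t(u)=0$ the walk stays at $u$, i.e. $P_t(u,u)=1$. For $x\in V$, $\mu_0^x$ is the point mass at $x$ and $\mu_t^x=\mu_0^xP_1P_2\cdots P_t$. $\pi_t(x)=\deg_t(x)/(2|E_t|)$; if $E_t=\emptyset$, $\pi_t$ is undefined and closeness to $\pi_t$ is regarded as failing. $\|f-g\|_{TV}=\frac12\sum_{x\in V}|f(x)-g(x)|$. Mixing time: for a graph sequence $\mathscr G$ on $n$ vertices and $\epsilon>0$, $$t_{\mathrm{mix}}(\mathscr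 G;\epsilon)=\min\{t\in\mathbb{N}:\ \|\mu_s^x-\pi_s\|_{TV}\le\epsilon\ \text{ for all } x\in V\text{ and all integers } t\le s\le t+\sqrt n\}.$$ Probabilities are over the random graph sequence. *)

theory Defs
  imports "HOL-Probability.Probability" "HOL-Probability.Product_PMF"
    "HOL-Library.Extended_Nat" "HOL-Library.Landau_Symbols"
begin

section \<open>Graphs on \<open>{1..n}\<close>\<close>

text \<open>A simple graph on \<open>{1..n}\<close> is given by its edge set, a subset of \<open>vpairs n\<close>.\<close>

type_synonym graph = "nat set set"

definition vpairs :: "nat \<Rightarrow> nat set set" where
  "vpairs n = {{u, v} | u v. u \<in> {1..n} \<and> v \<in> {1..n} \<and> u \<noteq> v}"

definition deg :: "graph \<Rightarrow> nat \<Rightarrow> nat" where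
  "deg E x = card {e \<in> E. x \<in> e}"

definition vol :: "graph \<Rightarrow> nat set \<Rightarrow> nat" where
  "vol E S = (\<Sum>x\<in>S. deg E x)"

definition edge_cut :: "nat \<Rightarrow> graph \<Rightarrow> nat set \<Rightarrow> nat set set" where
  "edge_cut n E S = {e \<in> E. \<exists>u\<in>S. \<exists>v\<in>{1..n} - S. e = {u, v}}"

text \<open>The minimum ranges over a nonempty set as soon as \<open>E\<close> has an edge (take a singleton of
  positive degree). For an edgeless graph it is unspecified.\<close>

definition conductance :: "nat \<Rightarrow> graph \<Rightarrow> real" where
  "conductance n E =
     Min ((\<lambda>S. real (card (edge_cut n E S)) / real (vol E S)) `
       {S. S \<subseteq> {1..n} \<and> 1 \<le> vol E S \<and> real (vol E S) \<le> real (vol E {1..n}) / 2})"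


section \<open>The edge-Markovian model\<close>

definition em_step :: "nat \<Rightarrow> real \<Rightarrow> real \<Rightarrow> graph \<Rightarrow> graph pmf" where
  "em_step n p q E =
     map_pmf (\<lambda>b. {e \<in> vpairs n. b e})
       (Pi_pmf (vpairs n) False (\<lambda>e. bernoulli_pmf (if e \<in> E then 1 - q else p)))"

text \<open>The conditional law of the \<open>i\<close>-th graph given the graphs \<open>G 0, \<dots>, G (i - 1)\<close>, as a measure
  on the finite set of graphs on \<open>{1..n}\<close>.\<close>

definition em_kernel :: "nat \<Rightarrow> real \<Rightarrow> real \<Rightarrow> graph \<Rightarrow> nat \<Rightarrow> (nat \<Rightarrow> graph) \<Rightarrow> graph measure" where
  "em_kernel n p q E0 i G =
     restrict_space
       (measure_pmf (case i of 0 \<Rightarrow> return_pmf E0 | Suc j \<Rightarrow> em_step n p q (G j)))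
       (Pow (vpairs n))"

text \<open>The law of the sequence \<open>(G 0, G 1, \<dots>)\<close> on path space, assembled from the kernels by the
  Ionescu-Tulcea theorem. It is characterised by \<open>edge_markovian_initial\<close> and
  \<open>edge_markovian_Markov\<close> below.\<close>

definition edge_markovian :: "nat \<Rightarrow> real \<Rightarrow> real \<Rightarrow> graph \<Rightarrow> (nat \<Rightarrow> graph) measure" where
  "edge_markovian n p q E0 =
     projective_family.lim UNIV
       (Ionescu_Tulcea.CI (em_kernel n p q E0) (\<lambda>_. count_space (Pow (vpairs n))))
       (\<lambda>_. count_space (Pow (vpairs n)))"

lemma finite_vpairs: "finite (vpairs n)"
proof -
  have "vpairs n \<subseteq> Pow {1..n}"
    by (auto simp: vpairs_def)
  then show ?thesis
    by (rule finite_subset) simp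
qed

lemma set_pmf_em_step: "set_pmf (em_step n p q E) \<subseteq> Pow (vpairs n)"
  by (auto simp: em_step_def)

lemma sets_em_kernel: "sets (em_kernel n p q E0 i G) = sets (count_space (Pow (vpairs n)))"
  by (auto simp: em_kernel_def sets_restrict_space)

lemma prob_space_em_kernel:
  assumes "E0 \<subseteq> vpairs n"
  shows "prob_space (em_kernel n p q E0 i G)"
proof -
  let ?K = "case i of 0 \<Rightarrow> return_pmf E0 | Suc j \<Rightarrow> em_step n p q (G j)"
  have "set_pmf ?K \<subseteq> Pow (vpairs n)"
    using assms set_pmf_em_step by (auto split: nat.splits)
  then have "emeasure (measure_pmf ?K) (Pow (vpairs n)) = 1"
    by (intro measure_pmf.emeasure_eq_1_AE) (auto simp: AE_measure_pmf_iff)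
  then show ?thesis
    unfolding em_kernel_def by (intro prob_space_restrict_space) auto
qed

lemma measurable_em_kernel:
  assumes "E0 \<subseteq> vpairs n"
  shows "em_kernel n p q E0 i
    \<in> measurable (PiM {0..<i} (\<lambda>_. count_space (Pow (vpairs n))))
        (subprob_algebra (count_space (Pow (vpairs n))))"
proof (cases i)
  case 0
  have "em_kernel n p q E0 0 (\<lambda>_. {}) \<in> space (subprob_algebra (count_space (Pow (vpairs n))))"
    using prob_space_em_kernel[OF assms, THEN prob_space_imp_subprob_space] sets_em_kernel
    by (auto simp: space_subprob_algebra)
  moreover have "em_kernel n p q E0 0 = (\<lambda>_. em_kernel n p q E0 0 (\<lambda>_. {}))"
    by (auto simp: em_kernel_def)
  ultimately show ?thesis
    using 0 by (metis measurable_const)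
next
  case (Suc j)
  have 1: "(\<lambda>E. em_kernel n p q E0 i (\<lambda>_. E))
      \<in> measurable (count_space (Pow (vpairs n))) (subprob_algebra (count_space (Pow (vpairs n))))"
    using prob_space_em_kernel[OF assms, THEN prob_space_imp_subprob_space] sets_em_kernel
    by (auto simp: space_subprob_algebra)
  have 2: "(\<lambda>G. G j) \<in> measurable (PiM {0..<i} (\<lambda>_. count_space (Pow (vpairs n))))
      (count_space (Pow (vpairs n)))"
    using Suc by (intro measurable_component_singleton) auto
  have 3: "em_kernel n p q E0 i = (\<lambda>E. em_kernel n p q E0 i (\<lambda>_. E)) \<circ> (\<lambda>G. G j)"
    using Suc by (auto simp: em_kernel_def)
  show ?thesis
    by (subst 3) (rule measurable_comp[OF 2 1])
qed

lemma Ionescu_Tulcea_em: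
  assumes "E0 \<subseteq> vpairs n"
  shows "Ionescu_Tulcea (em_kernel n p q E0) (\<lambda>_. count_space (Pow (vpairs n)))"
  by (rule Ionescu_Tulcea.intro)
    (rule measurable_em_kernel[OF assms], rule prob_space_em_kernel[OF assms])

lemma sets_edge_markovian:
  assumes "E0 \<subseteq> vpairs n"
  shows "sets (edge_markovian n p q E0) = sets (PiM UNIV (\<lambda>_. count_space (Pow (vpairs n))))"
proof -
  interpret Ionescu_Tulcea "em_kernel n p q E0" "\<lambda>_. count_space (Pow (vpairs n))"
    by (rule Ionescu_Tulcea_em[OF assms])
  show ?thesis
    unfolding edge_markovian_def by (rule PF.sets_lim)
qed

lemma space_edge_markovian:
  assumes "E0 \<subseteq> vpairs n"
  shows "space (edge_markovian n p q E0) = {G. \<forall>t. G t \<subseteq> vpairs n}"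
  using sets_eq_imp_space_eq[OF sets_edge_markovian[OF assms, of p q]]
  by (auto simp: space_PiM PiE_iff)

lemma edge_markovian_cylinder:
  assumes "E0 \<subseteq> vpairs n" and "\<And>s. s < m \<Longrightarrow> h s \<subseteq> vpairs n"
  shows "emeasure (edge_markovian n p q E0) {G \<in> space (edge_markovian n p q E0). \<forall>s<m. G s = h s}
    = (\<Prod>s<m. emeasure (em_kernel n p q E0 s h) {h s})"
proof -
  let ?M = "\<lambda>_::nat. count_space (Pow (vpairs n))"
  interpret Ionescu_Tulcea "em_kernel n p q E0" ?M
    by (rule Ionescu_Tulcea_em[OF assms(1)])
  have sing: "{restrict h {0..<k}} \<in> sets (PiM {0..<k} ?M)" if "k \<le> m" for k
  proof -
    have "{restrict h {0..<k}} = (\<Pi>\<^sub>E s\<in>{0..<k}. {h s})"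
      using PiE_singleton[of "restrict h {0..<k}" "{0..<k}"]
        PiE_cong[of "{0..<k}" "\<lambda>s. {restrict h {0..<k} s}" "\<lambda>s. {h s}"] by simp
    then show ?thesis
      using assms(2) that by (auto intro!: sets_PiM_I_finite)
  qed
  have C: "emeasure (C 0 k (\<lambda>_. undefined)) {restrict h {0..<k}}
      = (\<Prod>s<k. emeasure (em_kernel n p q E0 s h) {h s})" if "k \<le> m" for k
    using that
  proof (induction k)
    case 0
    show ?case
      using sing[of 0] by (simp add: restrict_def)
  next
    case (Suc k)
    have und: "(\<lambda>_. undefined) \<in> space (PiM {0..<0} ?M)"
      by (simp add: space_PiM)
    let ?x = "restrict h {0..<k}"
    have x: "?x \<in> space (PiM {0..<k} ?M)"
      using assms(2) Suc.prems by (auto simp: space_PiM)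
    have "emeasure (C 0 (Suc k) (\<lambda>_. undefined)) {restrict h {0..<Suc k}}
      = (\<integral>\<^sup>+G. emeasure (eP k G) {restrict h {0..<Suc k}} \<partial>C 0 k (\<lambda>_. undefined))"
      using sing[OF Suc.prems] space_C[OF und, of k] x
      by (auto intro!: emeasure_bind[where N="PiM {0..<Suc k} ?M"]
          simp: measurable_cong_sets[OF sets_C[OF und]])
    also have "\<dots> = (\<integral>\<^sup>+G. emeasure (em_kernel n p q E0 k h) {h k} * indicator {?x} G
        \<partial>C 0 k (\<lambda>_. undefined))"
    proof (intro nn_integral_cong)
      fix G assume "G \<in> space (C 0 k (\<lambda>_. undefined))"
      then have G: "G \<in> space (PiM {0..<k} ?M)"
        using space_C[OF und] by auto
      have G': "G \<in> extensional {0..<k}"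
        using G by (auto simp: space_PiM PiE_iff)
      have eq: "G(k := y) = restrict h {0..<Suc k} \<longleftrightarrow> G = ?x \<and> y = h k" for y
      proof
        assume *: "G(k := y) = restrict h {0..<Suc k}"
        have "G s = ?x s" for s
          using fun_cong[OF *, of s] G' by (cases "s = k") (auto simp: extensional_def)
        then show "G = ?x \<and> y = h k"
          using fun_cong[OF *, of k] by auto
      qed (auto simp: fun_eq_iff)
      have ker: "em_kernel n p q E0 k ?x = em_kernel n p q E0 k h"
        by (auto simp: em_kernel_def split: nat.splits)
      have "emeasure (eP k G) {restrict h {0..<Suc k}}
        = emeasure (em_kernel n p q E0 k G)
            ((\<lambda>y. G(k := y)) -` {restrict h {0..<Suc k}} \<inter> space (?M k))"
        using emeasure_eP[OF G sing[OF Suc.prems]] by simp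
      also have "(\<lambda>y. G(k := y)) -` {restrict h {0..<Suc k}} \<inter> space (?M k)
        = (if G = ?x then {h k} else {})"
      proof -
        have "(\<lambda>y. G(k := y)) -` {restrict h {0..<Suc k}} = {y. G = ?x \<and> y = h k}"
          by (simp only: vimage_def singleton_iff eq)
        then show ?thesis
          using assms(2)[of k] Suc.prems by auto
      qed
      finally show "emeasure (eP k G) {restrict h {0..<Suc k}}
        = emeasure (em_kernel n p q E0 k h) {h k} * indicator {?x} G"
        using ker by (cases "G = ?x") (simp_all only: if_True if_False indicator_simps
          singleton_iff simp_thms emeasure_empty mult_1_right mult_zero_right indicator_def of_bool_eq)
    qed
    also have "\<dots> = emeasure (em_kernel n p q E0 k h) {h k}
        * emeasure (C 0 k (\<lambda>_. undefined)) {?x}"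
      using sing[of k] Suc.prems sets_C[OF und, of k]
      by (intro nn_integral_cmult_indicator) auto
    also have "emeasure (C 0 k (\<lambda>_. undefined)) {?x}
        = (\<Prod>s<k. emeasure (em_kernel n p q E0 s h) {h s})"
      by (rule Suc.IH[OF Suc_leD[OF Suc.prems]])
    finally show ?case
      by (simp only: prod.lessThan_Suc mult.commute)
  qed
  have iff: "restrict G {0..<m} = restrict h {0..<m} \<longleftrightarrow> (\<forall>s<m. G s = h s)" for G
  proof
    assume *: "restrict G {0..<m} = restrict h {0..<m}"
    show "\<forall>s<m. G s = h s"
    proof (intro allI impI)
      fix s assume "s < m"
      then show "G s = h s"
        using fun_cong[OF *, of s] by simp
    qed
  qed (auto simp: fun_eq_iff)
  have "{G \<in> space (edge_markovian n p q E0). \<forall>s<m. G s = h s}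
      = PF.emb UNIV {0..<m} {restrict h {0..<m}}"
    using space_edge_markovian[OF assms(1), of p q]
    by (auto simp: prod_emb_def iff PiE_iff simp del: restrict_apply)
  then have "emeasure (edge_markovian n p q E0)
        {G \<in> space (edge_markovian n p q E0). \<forall>s<m. G s = h s}
      = emeasure (CI {0..<m}) {restrict h {0..<m}}"
    using lim[of "{0..<m}", OF _ sing[OF order.refl]] by (simp add: edge_markovian_def)
  also have "\<dots> = emeasure (C 0 m (\<lambda>_. undefined)) {restrict h {0..<m}}"
  proof -
    have "PF.emb {0..<m} {0..<m} {restrict h {0..<m}} = {restrict h {0..<m}}"
      using sets.sets_into_space[OF sing[OF order.refl]]
      by (intro prod_emb_id) (auto simp: space_PiM)
    then show ?thesis
      using emeasure_CI[of "{0..<m}" m, OF order.refl sing[OF order.refl]] by simp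
  qed
  finally show ?thesis
    using C[of m] by simp
qed

lemma prob_space_edge_markovian:
  assumes "E0 \<subseteq> vpairs n"
  shows "prob_space (edge_markovian n p q E0)"
  using edge_markovian_cylinder[OF assms, of 0] by (auto intro!: prob_spaceI)

lemma edge_markovian_initial:
  assumes "E0 \<subseteq> vpairs n"
  shows "measure (edge_markovian n p q E0) {G \<in> space (edge_markovian n p q E0). G 0 = E0} = 1"
proof -
  have "emeasure (em_kernel n p q E0 0 (\<lambda>_. E0)) {E0} = 1"
    using assms by (auto simp: em_kernel_def emeasure_restrict_space)
  then show ?thesis
    using edge_markovian_cylinder[OF assms, of 1 "\<lambda>_. E0" p q] assms by (simp add: measure_def)
qed

lemma edge_markovian_Markov:
  fixes p q :: real
  assumes "E0 \<subseteq> vpairs n"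
  defines "M \<equiv> edge_markovian n p q E0"
  shows "measure M {G \<in> space M. \<forall>s\<le>Suc t. G s = h s}
    = measure M {G \<in> space M. \<forall>s\<le>t. G s = h s} * pmf (em_step n p q (h t)) (h (Suc t))"
proof (cases "\<forall>s\<le>Suc t. h s \<subseteq> vpairs n")
  case True
  then have "emeasure (em_kernel n p q E0 (Suc t) h) {h (Suc t)}
      = emeasure (measure_pmf (em_step n p q (h t))) {h (Suc t)}"
    by (auto simp: em_kernel_def emeasure_restrict_space)
  then show ?thesis
    using edge_markovian_cylinder[OF assms(1), of "Suc (Suc t)" h p q]
      edge_markovian_cylinder[OF assms(1), of "Suc t" h p q] True
    unfolding M_def by (simp add: measure_def less_Suc_eq_le enn2real_mult pmf.rep_eq)
next
  case False
  then obtain s where s: "s \<le> Suc t" "\<not> h s \<subseteq> vpairs n"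
    by auto
  have sp: "space M = {G. \<forall>t. G t \<subseteq> vpairs n}"
    unfolding M_def by (rule space_edge_markovian[OF assms(1)])
  have L: "{G \<in> space M. \<forall>s\<le>Suc t. G s = h s} = {}"
    using s by (auto simp: sp)
  show ?thesis
  proof (cases "s = Suc t")
    case True
    then have "pmf (em_step n p q (h t)) (h (Suc t)) = 0"
      using s set_pmf_em_step[of n p q "h t"] by (auto simp: pmf_eq_0_set_pmf)
    then show ?thesis
      by (simp only: L) simp
  next
    case False
    then have "s \<le> t"
      using s(1) by simp
    then have "{G \<in> space M. \<forall>s\<le>t. G s = h s} = {}"
      using s(2) by (auto simp: sp)
    then show ?thesis
      by (simp only: L) simp
  qed
qed


section \<open>Lazy random walk and mixing time\<close>

definition lazy_walk :: "graph \<Rightarrow> nat \<Rightarrow> nat \<Rightarrow> real" where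
  "lazy_walk E u v =
     (if u = v then (if deg E u = 0 then 1 else 1 / 2)
      else if {u, v} \<in> E then 1 / (2 * real (deg E u)) else 0)"

text \<open>The step from time \<open>t\<close> to time \<open>t + 1\<close> uses the graph at time \<open>t + 1\<close>.\<close>

primrec walk_dist :: "nat \<Rightarrow> (nat \<Rightarrow> graph) \<Rightarrow> nat \<Rightarrow> nat \<Rightarrow> nat \<Rightarrow> real" where
  "walk_dist n G x 0 = (\<lambda>y. if y = x then 1 else 0)"
| "walk_dist n G x (Suc t) = (\<lambda>y. \<Sum>z\<in>{1..n}. walk_dist n G x t z * lazy_walk (G (Suc t)) z y)"

definition stationary :: "graph \<Rightarrow> nat \<Rightarrow> real" where
  "stationary E x = real (deg E x) / (2 * real (card E))"

definition tv_dist :: "nat \<Rightarrow> (nat \<Rightarrow> real) \<Rightarrow> (nat \<Rightarrow> real) \<Rightarrow> real" where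
  "tv_dist n f g = 1 / 2 * (\<Sum>x\<in>{1..n}. \<bar>f x - g x\<bar>)"

text \<open>The infimum in \<^typ>\<open>enat\<close> is the minimum of the set, and \<open>\<infinity>\<close> if no such time exists.\<close>

definition mixing_time :: "nat \<Rightarrow> (nat \<Rightarrow> graph) \<Rightarrow> real \<Rightarrow> enat" where
  "mixing_time n G \<epsilon> = Inf (enat ` {t.
     \<forall>x\<in>{1..n}. \<forall>s. t \<le> s \<and> real s \<le> real t + sqrt (real n) \<longrightarrow>
       G s \<noteq> {} \<and> tv_dist n (walk_dist n G x s) (stationary (G s)) \<le> \<epsilon>})"

definition mean_degree :: "nat \<Rightarrow> real \<Rightarrow> real \<Rightarrow> real" where
  "mean_degree n p q = (real n - 1) * (p / (p + q))"

end

theory Submission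
  imports Defs "HOL-Real_Asymp.Real_Asymp"
begin

text \<open>Write \<open>\<ell>\<close> for \<open>ln n\<close> and \<open>\<chi>(t) = \<Sum>\<^sub>x (\<mu>\<^sub>t(x) - \<pi>\<^sub>t(x))\<^sup>2 / \<pi>\<^sub>t(x)\<close>.

  Up to the times of interest, of order \<open>\<ell> / \<Phi>\<^sup>2\<close>, with high probability every cut of \<open>G\<^sub>0\<close> permanently
  keeps half of its edges and no vertex ever gains more than \<open>O(d)\<close> edges. Since dead edges and newly
  born edges are counted cumulatively, this needs exponential moments and a union bound over cuts,
  but no union bound over times, and it shows that all \<open>G\<^sub>t\<close> have degrees of order \<open>d\<close> and
  conductance of order \<open>\<Phi>\<close>. By Cheeger's inequality one lazy step contracts \<open>\<chi>\<close> by a factor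
  \<open>1 - \<lambda>\<close> with \<open>\<lambda>\<close> of order \<open>\<Phi>\<^sup>2\<close>.

  Passing from \<open>\<pi>\<^sub>t\<close> to \<open>\<pi>\<^sub>t\<^sub>+\<^sub>1\<close> multiplies the term of \<open>\<chi>\<close> at \<open>x\<close> by at most \<open>exp (O(N\<^sub>x / d))\<close>,
  where \<open>N\<^sub>x\<close> edges change at \<open>x\<close>, up to an additive error of order \<open>\<ell> / (n d)\<close>. In the worst case
  this would outweigh the contraction, but \<open>N\<^sub>x\<close> has mean of order \<open>\<ell> / n\<close> and is independent of the
  position of the walk. By Jensen's inequality for the weights \<open>(\<mu>\<^sub>t(x) - \<pi>\<^sub>t(x))\<^sup>2 / \<pi>\<^sub>t(x)\<close>, the norm of
  \<open>\<chi>\<close> in \<open>L\<^sup>k\<close> with \<open>k \<approx> \<ell>\<close> therefore grows only by the factor \<open>1 + O(\<ell> / (n d))\<close>. As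
  \<open>\<ell> / (n d \<lambda>) = O(1 / \<ell>)\<close>, this norm becomes \<open>O(1 / \<ell>)\<close>, and Markov's inequality for the \<open>k\<close>-th moment
  is strong enough for a union bound over all starting vertices and all times in the window.\<close>

section \<open>Cheeger's inequality and contraction of the lazy walk\<close>

text \<open>The delicate point is that half of every cut survives. In the order of (ln n) / \<Phi>^2
  steps, with q = O(ln n / (d n)) and \<Phi> >= c3 ln d / d, a given edge dies with probability at
  most of order d (ln n)^2 / (n (ln d)^2 c3^2). For d <= sqrt n this is a negative power of n up to
  logarithms, and a constant number of cut edges per vertex already beats the union bound. For d >
  sqrt n it is only a constant, small because c3 is large, but then ln d >= (ln n) / 2 and the
  conductance supplies order ln n cut edges per vertex. The same ratio controls the additive noise
  relative to the contraction.

  The moment order is pinned from both sides: it must be at least ln n to pay for n starting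
  vertices and up to n window times, while exponentials of k / d must stay bounded, which is what d
  >= a ln n provides.

  Every event looks at finitely many graphs, so it is moved from path space to the finitely
  supported laws \<open>traj\<close>. Moments are truncated to histories that have been good so far,
  since the contraction is only available there.\<close>

lemma coarea_inequality:
  fixes A :: "'a \<Rightarrow> 'a \<Rightarrow> real" and w :: "'a \<Rightarrow> real"
  assumes fin: "finite V" and sym: "\<And>u v. A u v = A v u"
    and w: "\<And>x. x \<in> V \<Longrightarrow> 0 \<le> w x"
    and cut: "\<And>S. S \<subseteq> {x\<in>V. 0 < w x} \<Longrightarrow> S \<noteq> {} \<Longrightarrow>
      h * real (card S) \<le> (\<Sum>u\<in>S. \<Sum>v\<in>V-S. A u v)"
  shows "2 * h * (\<Sum>x\<in>V. w x) \<le> (\<Sum>u\<in>V. \<Sum>v\<in>V. A u v * \<bar>w u - w v\<bar>)"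
  using w cut
proof (induction "card {x\<in>V. 0 < w x}" arbitrary: w rule: less_induct)
  case less
  define S where "S = {x\<in>V. 0 < w x}"
  have finS: "finite S" and SV: "S \<subseteq> V" using fin by (auto simp: S_def)
  show ?case
  proof (cases "S = {}")
    case True
    then have "w x = 0" if "x \<in> V" for x
      using less.prems(1)[OF that] that by (force simp: S_def)
    then show ?thesis by simp
  next
    case False
    define m where "m = Min (w ` S)"
    have m_in: "m \<in> w ` S" unfolding m_def using finS False by (intro Min_in) auto
    have m_le: "m \<le> w x" if "x \<in> S" for x unfolding m_def using finS that by auto
    have m0: "0 < m" using m_in by (auto simp: S_def)
    \<comment> \<open>\<open>m\<close> is the least positive value, so \<open>w'\<close> is the part
      of \<open>w\<close> above the lowest layer: still nonnegative, with strictly smaller support.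
      A pair with exactly one end in \<open>S\<close> loses exactly \<open>m\<close>, and both of
      its orientations occur in the sum, whence the factor 2.\<close>
    define w' where "w' = (\<lambda>x. w x - m * indicator S x)"
    have wout: "w x = 0" if "x \<in> V" "x \<notin> S" for x
      using less.prems(1)[OF that(1)] that by (force simp: S_def)
    have sub: "{x\<in>V. 0 < w' x} \<subseteq> S"
      using wout by (auto simp: w'_def indicator_def split: if_splits) (fastforce)
    obtain x0 where x0: "x0 \<in> S" "w x0 = m" using m_in by auto
    have "x0 \<notin> {x\<in>V. 0 < w' x}" using x0 by (simp add: w'_def)
    then have psub: "{x\<in>V. 0 < w' x} \<subset> S" using sub x0(1) by blast
    have w'0: "0 \<le> w' x" if "x \<in> V" for x
      using m_le[of x] less.prems(1)[OF that] by (auto simp: w'_def indicator_def)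
    have IH: "2 * h * (\<Sum>x\<in>V. w' x) \<le> (\<Sum>u\<in>V. \<Sum>v\<in>V. A u v * \<bar>w' u - w' v\<bar>)"
    proof (rule less.hyps)
      show "card {x\<in>V. 0 < w' x} < card {x\<in>V. 0 < w x}"
        using psubset_card_mono[OF finS psub] by (simp add: S_def)
      show "h * real (card R) \<le> (\<Sum>u\<in>R. \<Sum>v\<in>V-R. A u v)" if "R \<subseteq> {x\<in>V. 0 < w' x}" "R \<noteq> {}" for R
        using less.prems(2)[of R] that sub by (auto simp: S_def)
    qed (rule w'0)
    have cutS: "h * real (card S) \<le> (\<Sum>u\<in>S. \<Sum>v\<in>V-S. A u v)"
      using less.prems(2)[of S] False by (auto simp: S_def)
    have abs_split: "\<bar>w u - w v\<bar> = \<bar>w' u - w' v\<bar> + m * (indicator S u * indicator (V-S) v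
        + indicator S v * indicator (V-S) u)" if "u \<in> V" "v \<in> V" for u v
      using that wout m_le[of u] m_le[of v] m0 by (auto simp: w'_def indicator_def)
    have c1: "(\<Sum>u\<in>V. \<Sum>v\<in>V. A u v * (indicator S u * indicator (V-S) v)) = (\<Sum>u\<in>S. \<Sum>v\<in>V-S. A u v)"
    proof -
      have "(\<Sum>v\<in>V. A u v * (indicator S u * indicator (V-S) v)) = indicator S u * (\<Sum>v\<in>V-S. A u v)" for u
        using fin by (subst sum_distrib_left, intro sum.mono_neutral_cong_right) auto
      then have "(\<Sum>u\<in>V. \<Sum>v\<in>V. A u v * (indicator S u * indicator (V-S) v))
        = (\<Sum>u\<in>V. indicator S u * (\<Sum>v\<in>V-S. A u v))" by simp
      also have "\<dots> = (\<Sum>u\<in>S. \<Sum>v\<in>V-S. A u v)"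
        using fin SV by (intro sum.mono_neutral_cong_right) auto
      finally show ?thesis .
    qed
    have c2: "(\<Sum>u\<in>V. \<Sum>v\<in>V. A u v * (indicator S v * indicator (V-S) u)) = (\<Sum>u\<in>S. \<Sum>v\<in>V-S. A u v)"
      by (subst sum.swap) (simp add: c1 sym[of _ "_"] flip: c1 cong: sum.cong)
    have "(\<Sum>u\<in>V. \<Sum>v\<in>V. A u v * \<bar>w u - w v\<bar>) = (\<Sum>u\<in>V. \<Sum>v\<in>V. A u v * \<bar>w' u - w' v\<bar>
        + m * (A u v * (indicator S u * indicator (V-S) v))
        + m * (A u v * (indicator S v * indicator (V-S) u)))"
      by (intro sum.cong refl) (simp only: abs_split, simp add: algebra_simps)
    also have "\<dots> = (\<Sum>u\<in>V. \<Sum>v\<in>V. A u v * \<bar>w' u - w' v\<bar>) + m * (2 * (\<Sum>u\<in>S. \<Sum>v\<in>V-S. A u v))"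
      by (simp only: sum.distrib sum_distrib_left[symmetric] c1 c2)
    also have "\<dots> \<ge> 2 * h * (\<Sum>x\<in>V. w' x) + m * (2 * (h * card S))"
      using IH cutS m0 by (intro add_mono mult_left_mono) auto
    finally have "2 * h * (\<Sum>x\<in>V. w' x) + m * (2 * (h * card S)) \<le> (\<Sum>u\<in>V. \<Sum>v\<in>V. A u v * \<bar>w u - w v\<bar>)" .
    moreover have "(\<Sum>x\<in>V. w' x) = (\<Sum>x\<in>V. w x) - m * card S"
      using fin SV by (simp add: w'_def sum_subtractf sum_distrib_left[symmetric] indicator_def
        sum.If_cases Int_absorb1)
    ultimately show ?thesis by (simp add: algebra_simps)
  qed
qed

text \<open>The coarea bound is applied to the square of \<open>g\<close>, factored as a difference
  times a sum and split by Cauchy-Schwarz. The sum part is at most \<open>4 * D\<close> times the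
  squared norm, and this 4 cancels against that from squaring \<open>2 * h\<close>.\<close>

lemma Cheeger_nonneg:
  fixes A :: "'a \<Rightarrow> 'a \<Rightarrow> real" and g :: "'a \<Rightarrow> real"
  assumes fin: "finite V" and sym: "\<And>u v. A u v = A v u" and A0: "\<And>u v. 0 \<le> A u v"
    and deg: "\<And>u. u \<in> V \<Longrightarrow> (\<Sum>v\<in>V. A u v) \<le> D" and h: "0 \<le> h"
    and g: "\<And>x. x \<in> V \<Longrightarrow> 0 \<le> g x"
    and cut: "\<And>S. S \<subseteq> {x\<in>V. 0 < g x} \<Longrightarrow> S \<noteq> {} \<Longrightarrow>
      h * real (card S) \<le> (\<Sum>u\<in>S. \<Sum>v\<in>V-S. A u v)"
  shows "h\<^sup>2 * (\<Sum>x\<in>V. (g x)\<^sup>2) \<le> D * (\<Sum>u\<in>V. \<Sum>v\<in>V. A u v * (g u - g v)\<^sup>2)"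
proof -
  define S2 where "S2 = (\<Sum>x\<in>V. (g x)\<^sup>2)"
  define Eo where "Eo = (\<Sum>u\<in>V. \<Sum>v\<in>V. A u v * (g u - g v)\<^sup>2)"
  define Ep where "Ep = (\<Sum>u\<in>V. \<Sum>v\<in>V. A u v * (g u + g v)\<^sup>2)"
  have S20: "0 \<le> S2" unfolding S2_def by (intro sum_nonneg) auto
  have Eo0: "0 \<le> Eo" unfolding Eo_def by (intro sum_nonneg mult_nonneg_nonneg A0) auto
  have "2 * h * (\<Sum>x\<in>V. (g x)\<^sup>2) \<le> (\<Sum>u\<in>V. \<Sum>v\<in>V. A u v * \<bar>(g u)\<^sup>2 - (g v)\<^sup>2\<bar>)"
  proof (rule coarea_inequality[OF fin sym])
    fix S assume "S \<subseteq> {x\<in>V. 0 < (g x)\<^sup>2}" "S \<noteq> {}"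
    moreover have "{x\<in>V. 0 < (g x)\<^sup>2} \<subseteq> {x\<in>V. 0 < g x}" using g by force
    ultimately show "h * real (card S) \<le> (\<Sum>u\<in>S. \<Sum>v\<in>V-S. A u v)" by (intro cut) auto
  qed auto
  also have "\<dots> = (\<Sum>z\<in>V\<times>V. (sqrt (A (fst z) (snd z)) * \<bar>g (fst z) - g (snd z)\<bar>) *
      (sqrt (A (fst z) (snd z)) * (g (fst z) + g (snd z))))"
    unfolding sum.cartesian_product
  proof (intro sum.cong refl, clarify)
    fix u v assume uv: "u \<in> V" "v \<in> V"
    have "\<bar>(g u)\<^sup>2 - (g v)\<^sup>2\<bar> = \<bar>g u - g v\<bar> * (g u + g v)"
      using g[OF uv(1)] g[OF uv(2)] by (simp add: power2_eq_square square_diff_square_factored abs_mult)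
    moreover have "A u v = sqrt (A u v) * sqrt (A u v)" using A0 by simp
    ultimately show "A u v * \<bar>(g u)\<^sup>2 - (g v)\<^sup>2\<bar> =
      sqrt (A (fst (u, v)) (snd (u, v))) * \<bar>g (fst (u, v)) - g (snd (u, v))\<bar> *
      (sqrt (A (fst (u, v)) (snd (u, v))) * (g (fst (u, v)) + g (snd (u, v))))"
      by (metis (no_types) fst_conv snd_conv mult.assoc mult.left_commute)
  qed
  finally have 1: "2 * h * S2 \<le> \<dots>" unfolding S2_def .
  have "(2 * h * S2)\<^sup>2 \<le> (\<Sum>z\<in>V\<times>V. (sqrt (A (fst z) (snd z)) * \<bar>g (fst z) - g (snd z)\<bar>) *
      (sqrt (A (fst z) (snd z)) * (g (fst z) + g (snd z))))\<^sup>2"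
    using h S20 by (intro power_mono 1) auto
  also have "\<dots> \<le> (\<Sum>z\<in>V\<times>V. (sqrt (A (fst z) (snd z)) * \<bar>g (fst z) - g (snd z)\<bar>)\<^sup>2) *
      (\<Sum>z\<in>V\<times>V. (sqrt (A (fst z) (snd z)) * (g (fst z) + g (snd z)))\<^sup>2)"
    by (rule Cauchy_Schwarz_ineq_sum)
  also have "\<dots> = Eo * Ep"
    unfolding Eo_def Ep_def sum.cartesian_product
    by (intro arg_cong2[where f="(*)"] sum.cong refl) (auto simp: power_mult_distrib A0)
  also have "Ep \<le> (\<Sum>u\<in>V. \<Sum>v\<in>V. 2 * (A u v * (g u)\<^sup>2) + 2 * (A v u * (g v)\<^sup>2))"
    unfolding Ep_def
  proof (intro sum_mono)
    fix u v
    have "(g u + g v)\<^sup>2 \<le> 2 * (g u)\<^sup>2 + 2 * (g v)\<^sup>2"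
      using zero_le_power2[of "g u - g v"] by (simp add: power2_eq_square algebra_simps)
    from mult_left_mono[OF this A0[of u v]] sym[of u v]
    show "A u v * (g u + g v)\<^sup>2 \<le> 2 * (A u v * (g u)\<^sup>2) + 2 * (A v u * (g v)\<^sup>2)"
      by (simp add: algebra_simps)
  qed
  also have "\<dots> = 4 * (\<Sum>u\<in>V. (g u)\<^sup>2 * (\<Sum>v\<in>V. A u v))"
  proof -
    have "(\<Sum>u\<in>V. \<Sum>v\<in>V. A v u * (g v)\<^sup>2) = (\<Sum>u\<in>V. \<Sum>v\<in>V. A u v * (g u)\<^sup>2)"
      by (rule sum.swap)
    then show ?thesis
      by (simp add: sum.distrib sum_distrib_left[symmetric] sum_distrib_right[symmetric] mult.commute)
  qed
  also have "\<dots> \<le> 4 * (\<Sum>u\<in>V. (g u)\<^sup>2 * D)"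
    by (intro mult_left_mono sum_mono deg) auto
  also have "\<dots> = 4 * D * S2" by (simp add: S2_def sum_distrib_right[symmetric])
  finally have "(2 * h * S2)\<^sup>2 \<le> Eo * (4 * D * S2)" using Eo0 by (simp add: mult_left_mono)
  then have "S2 * (h\<^sup>2 * S2) \<le> S2 * (D * Eo)" by (simp add: power2_eq_square algebra_simps)
  moreover have "0 \<le> D * Eo"
  proof (cases "V = {}")
    case False
    then obtain u where "u \<in> V" by auto
    then have "0 \<le> D" using deg[of u] sum_nonneg[of V "A u"] A0 by force
    then show ?thesis using Eo0 by simp
  qed (simp add: Eo_def)
  ultimately have "h\<^sup>2 * S2 \<le> D * Eo"
    using S20 by (cases "S2 = 0") auto
  then show ?thesis by (simp add: S2_def Eo_def)
qed

text \<open>\<open>c\<close> is the least value of \<open>f\<close> exceeded by at most half of the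
  points. If \<open>y\<close> is the largest value below \<open>c\<close>, minimality says that more
  than half of the points exceed \<open>y\<close>, and these are exactly the points not below
  \<open>c\<close>.\<close>

lemma median_exists:
  fixes f :: "'a \<Rightarrow> real"
  assumes fin: "finite V" and ne: "V \<noteq> {}"
  obtains c where "2 * card {x\<in>V. c < f x} \<le> card V" "2 * card {x\<in>V. f x < c} \<le> card V"
proof -
  define Y where "Y = {y \<in> f ` V. 2 * card {x\<in>V. y < f x} \<le> card V}"
  have finY: "finite Y" using fin by (auto simp: Y_def)
  have "Max (f ` V) \<in> Y"
  proof -
    have "{x\<in>V. Max (f ` V) < f x} = {}" using fin by (auto simp: not_less)
    then have "2 * card {x\<in>V. Max (f ` V) < f x} \<le> card V" by (simp only: card.empty)
    moreover have "Max (f ` V) \<in> f ` V" using fin ne by (intro Max_in) auto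
    ultimately show ?thesis unfolding Y_def by (intro CollectI conjI)
  qed
  then have Yne: "Y \<noteq> {}" by auto
  define c where "c = Min Y"
  have cY: "c \<in> Y" unfolding c_def using finY Yne by (rule Min_in)
  have 2: "2 * card {x\<in>V. f x < c} \<le> card V"
  proof (cases "{x\<in>V. f x < c} = {}")
    case False
    define y where "y = Max (f ` {x\<in>V. f x < c})"
    have "y \<in> f ` {x\<in>V. f x < c}" unfolding y_def using fin False by (intro Max_in) auto
    then have y: "y < c" "y \<in> f ` V" by auto
    then have "y \<notin> Y" using Min_le[OF finY, of y] by (auto simp: c_def)
    then have "card V < 2 * card {x\<in>V. y < f x}" using y by (auto simp: Y_def)
    moreover have "{x\<in>V. y < f x} = V - {x\<in>V. f x < c}"
    proof -
      have "f x \<le> y" if "x \<in> V" "f x < c" for x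
        unfolding y_def using fin that by (intro Max_ge) auto
      then show ?thesis using y by force
    qed
    ultimately show ?thesis using fin by (simp add: card_Diff_subset)
  qed (metis card.empty mult_0_right le0)
  show ?thesis using that[of c] cY 2 by (auto simp: Y_def)
qed

text \<open>Cutting at a median makes the supports of the positive and the negative part of
  \<open>f - c\<close> small enough for the half-size expansion hypothesis. Their energies add up to
  at most that of \<open>f\<close>: along a pair crossing the median the two increments add, and x^2
  + y^2 <= (x + y)^2.\<close>

lemma Cheeger_inequality:
  fixes A :: "'a \<Rightarrow> 'a \<Rightarrow> real" and f :: "'a \<Rightarrow> real"
  assumes fin: "finite V" and ne: "V \<noteq> {}" and sym: "\<And>u v. A u v = A v u"
    and A0: "\<And>u v. 0 \<le> A u v"
    and deg: "\<And>u. u \<in> V \<Longrightarrow> (\<Sum>v\<in>V. A u v) \<le> D" and h: "0 \<le> h"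
    and cut: "\<And>S. S \<subseteq> V \<Longrightarrow> S \<noteq> {} \<Longrightarrow> 2 * card S \<le> card V \<Longrightarrow>
      h * real (card S) \<le> (\<Sum>u\<in>S. \<Sum>v\<in>V-S. A u v)"
  obtains c where "h\<^sup>2 * (\<Sum>x\<in>V. (f x - c)\<^sup>2) \<le> D * (\<Sum>u\<in>V. \<Sum>v\<in>V. A u v * (f u - f v)\<^sup>2)"
proof -
  obtain c where c: "2 * card {x\<in>V. c < f x} \<le> card V" "2 * card {x\<in>V. f x < c} \<le> card V"
    using median_exists[OF fin ne] by blast
  define g1 where "g1 = (\<lambda>x. max (f x - c) 0)"
  define g2 where "g2 = (\<lambda>x. max (c - f x) 0)"
  have small: "2 * card S \<le> card V" if "S \<subseteq> X" "X \<subseteq> V" "2 * card X \<le> card V" for S X :: "'a set"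
    using card_mono[OF finite_subset[OF that(2) fin] that(1)] that(3) by linarith
  have D0: "0 \<le> D"
  proof -
    obtain u where "u \<in> V" using ne by auto
    then show ?thesis using deg[of u] sum_nonneg[of V "A u"] A0 by force
  qed
  have 1: "h\<^sup>2 * (\<Sum>x\<in>V. (g1 x)\<^sup>2) \<le> D * (\<Sum>u\<in>V. \<Sum>v\<in>V. A u v * (g1 u - g1 v)\<^sup>2)"
  proof (rule Cheeger_nonneg[OF fin sym A0 deg h])
    fix S assume S: "S \<subseteq> {x\<in>V. 0 < g1 x}" "S \<noteq> {}"
    then have "S \<subseteq> {x\<in>V. c < f x}" by (auto simp: g1_def less_max_iff_disj)
    with small[OF this _ c(1)] S show "h * real (card S) \<le> (\<Sum>u\<in>S. \<Sum>v\<in>V-S. A u v)"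
      by (intro cut) auto
  qed (auto simp: g1_def)
  have 2: "h\<^sup>2 * (\<Sum>x\<in>V. (g2 x)\<^sup>2) \<le> D * (\<Sum>u\<in>V. \<Sum>v\<in>V. A u v * (g2 u - g2 v)\<^sup>2)"
  proof (rule Cheeger_nonneg[OF fin sym A0 deg h])
    fix S assume S: "S \<subseteq> {x\<in>V. 0 < g2 x}" "S \<noteq> {}"
    then have "S \<subseteq> {x\<in>V. f x < c}" by (auto simp: g2_def less_max_iff_disj)
    with small[OF this _ c(2)] S show "h * real (card S) \<le> (\<Sum>u\<in>S. \<Sum>v\<in>V-S. A u v)"
      by (intro cut) auto
  qed (auto simp: g2_def)
  have "h\<^sup>2 * (\<Sum>x\<in>V. (f x - c)\<^sup>2) = h\<^sup>2 * (\<Sum>x\<in>V. (g1 x)\<^sup>2) + h\<^sup>2 * (\<Sum>x\<in>V. (g2 x)\<^sup>2)"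
    unfolding distrib_left[symmetric] sum.distrib[symmetric]
    by (intro arg_cong2[where f="(*)"] sum.cong refl)
      (auto simp: g1_def g2_def max_def power2_eq_square algebra_simps)
  also have "\<dots> \<le> D * (\<Sum>u\<in>V. \<Sum>v\<in>V. A u v * (g1 u - g1 v)\<^sup>2)
      + D * (\<Sum>u\<in>V. \<Sum>v\<in>V. A u v * (g2 u - g2 v)\<^sup>2)"
    by (rule add_mono[OF 1 2])
  also have "\<dots> = D * (\<Sum>u\<in>V. \<Sum>v\<in>V. A u v * ((g1 u - g1 v)\<^sup>2 + (g2 u - g2 v)\<^sup>2))"
    by (simp add: distrib_left sum.distrib)
  also have "\<dots> \<le> D * (\<Sum>u\<in>V. \<Sum>v\<in>V. A u v * (f u - f v)\<^sup>2)"
  proof (intro mult_left_mono sum_mono A0 D0)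
    fix u v
    have aux: "x\<^sup>2 + y\<^sup>2 \<le> (x + y)\<^sup>2" if "0 \<le> x" "0 \<le> y" for x y :: real
      using that by (simp add: power2_sum)
    show "(g1 u - g1 v)\<^sup>2 + (g2 u - g2 v)\<^sup>2 \<le> (f u - f v)\<^sup>2"
      using aux[of "f u - c" "c - f v"] aux[of "f v - c" "c - f u"]
      by (auto simp: g1_def g2_def max_def power2_commute)
  qed
  finally show ?thesis by (rule that)
qed

text \<open>With Q the averaging operator, N the squared norm of f and X = <f, Qf>, the new squared
  norm is (N + 2 X + |Qf|^2) / 4. Thanks to laziness, |Qf|^2 <= N alone bounds it by N - Eo / 4,
  where Eo = 2 N - 2 X is the energy; negative eigenvalues need no attention. Cheeger bounds Eo
  below by (h / D)^2 N, and the mean-zero condition lets the unknown centre \<open>c\<close> be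
  dropped.\<close>

lemma lazy_contraction:
  fixes A :: "'a \<Rightarrow> 'a \<Rightarrow> real" and f :: "'a \<Rightarrow> real"
  assumes fin: "finite V" and ne: "V \<noteq> {}" and sym: "\<And>u v. A u v = A v u"
    and A0: "\<And>u v. 0 \<le> A u v"
    and g: "\<And>u. g u = (\<Sum>v\<in>V. A u v)"
    and gpos: "\<And>u. u \<in> V \<Longrightarrow> 0 < g u"
    and deg: "\<And>u. u \<in> V \<Longrightarrow> g u \<le> D" and h: "0 \<le> h"
    and cut: "\<And>S. S \<subseteq> V \<Longrightarrow> S \<noteq> {} \<Longrightarrow> 2 * card S \<le> card V \<Longrightarrow>
      h * real (card S) \<le> (\<Sum>u\<in>S. \<Sum>v\<in>V-S. A u v)"
    and mean: "(\<Sum>u\<in>V. g u * f u) = 0"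
  shows "(\<Sum>v\<in>V. g v * ((f v + (\<Sum>u\<in>V. A v u * f u) / g v) / 2)\<^sup>2)
    \<le> (1 - h\<^sup>2 / (4 * D\<^sup>2)) * (\<Sum>v\<in>V. g v * (f v)\<^sup>2)"
proof -
  define Q where "Q = (\<lambda>v. (\<Sum>u\<in>V. A v u * f u) / g v)"
  define N where "N = (\<Sum>v\<in>V. g v * (f v)\<^sup>2)"
  define X where "X = (\<Sum>v\<in>V. g v * (f v * Q v))"
  define Eo where "Eo = (\<Sum>u\<in>V. \<Sum>v\<in>V. A u v * (f u - f v)\<^sup>2)"
  have Dpos: "0 < D" using ne gpos deg by (meson all_not_in_conv less_le_trans)
  have swapN: "(\<Sum>v\<in>V. \<Sum>u\<in>V. A v u * (f u)\<^sup>2) = N"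
  proof -
    have "(\<Sum>v\<in>V. \<Sum>u\<in>V. A v u * (f u)\<^sup>2) = (\<Sum>u\<in>V. \<Sum>v\<in>V. A u v * (f u)\<^sup>2)"
      by (subst sum.swap) (simp add: sym)
    then show ?thesis by (simp add: N_def g sum_distrib_right)
  qed
  have N2: "(\<Sum>v\<in>V. g v * (Q v)\<^sup>2) \<le> N"
  proof -
    have "g v * (Q v)\<^sup>2 \<le> (\<Sum>u\<in>V. A v u * (f u)\<^sup>2)" if v: "v \<in> V" for v
    proof -
      have "(\<Sum>u\<in>V. A v u * f u)\<^sup>2 = (\<Sum>u\<in>V. sqrt (A v u) * (sqrt (A v u) * f u))\<^sup>2"
        by (simp add: A0 mult.assoc[symmetric])
      also have "\<dots> \<le> (\<Sum>u\<in>V. (sqrt (A v u))\<^sup>2) * (\<Sum>u\<in>V. (sqrt (A v u) * f u)\<^sup>2)"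
        by (rule Cauchy_Schwarz_ineq_sum)
      also have "\<dots> = g v * (\<Sum>u\<in>V. A v u * (f u)\<^sup>2)"
        by (simp add: A0 power_mult_distrib g)
      finally show ?thesis using gpos[OF v]
        by (simp add: Q_def power_divide power2_eq_square field_simps)
    qed
    then have "(\<Sum>v\<in>V. g v * (Q v)\<^sup>2) \<le> (\<Sum>v\<in>V. \<Sum>u\<in>V. A v u * (f u)\<^sup>2)" by (rule sum_mono)
    then show ?thesis by (simp add: swapN)
  qed
  have X: "X = (\<Sum>u\<in>V. \<Sum>v\<in>V. A u v * (f u * f v))"
    unfolding X_def Q_def
  proof (rule sum.cong[OF refl])
    fix v assume "v \<in> V"
    then have "g v \<noteq> 0" using gpos by force
    then have "g v * (f v * ((\<Sum>u\<in>V. A v u * f u) / g v)) = f v * (\<Sum>u\<in>V. A v u * f u)" by simp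
    then show "g v * (f v * ((\<Sum>u\<in>V. A v u * f u) / g v)) = (\<Sum>va\<in>V. A v va * (f v * f va))"
      by (simp add: sum_distrib_left mult.left_commute)
  qed
  have Eo: "Eo = 2 * N - 2 * X"
  proof -
    have "Eo = (\<Sum>u\<in>V. \<Sum>v\<in>V. A u v * (f u)\<^sup>2 + A u v * (f v)\<^sup>2 - 2 * (A u v * (f u * f v)))"
      unfolding Eo_def by (intro sum.cong refl) (simp add: power2_eq_square algebra_simps)
    also have "\<dots> = (\<Sum>u\<in>V. \<Sum>v\<in>V. A u v * (f u)\<^sup>2) + N - 2 * X"
      by (simp add: sum.distrib sum_subtractf swapN X sum_distrib_left)
    also have "(\<Sum>u\<in>V. \<Sum>v\<in>V. A u v * (f u)\<^sup>2) = N" by (simp add: N_def g sum_distrib_right)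
    finally show ?thesis by simp
  qed
  have lhs: "(\<Sum>v\<in>V. g v * ((f v + Q v) / 2)\<^sup>2) = (N + 2 * X + (\<Sum>v\<in>V. g v * (Q v)\<^sup>2)) / 4"
  proof -
    have "(\<Sum>v\<in>V. g v * ((f v + Q v) / 2)\<^sup>2)
      = (\<Sum>v\<in>V. (g v * (f v)\<^sup>2 + 2 * (g v * (f v * Q v)) + g v * (Q v)\<^sup>2) / 4)"
      by (intro sum.cong refl) (simp add: power2_eq_square field_simps)
    then show ?thesis
      by (simp only: N_def X_def sum_divide_distrib[symmetric] sum.distrib sum_distrib_left[symmetric])
  qed
  obtain c where c: "h\<^sup>2 * (\<Sum>x\<in>V. (f x - c)\<^sup>2) \<le> D * Eo"
    unfolding Eo_def
  proof (rule Cheeger_inequality[OF fin ne sym A0 _ h cut])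
    show "(\<Sum>v\<in>V. A u v) \<le> D" if "u \<in> V" for u using deg[OF that] g by simp
  qed auto
  have "N \<le> (\<Sum>v\<in>V. g v * (f v - c)\<^sup>2)"
  proof -
    have "(\<Sum>v\<in>V. g v * (f v - c)\<^sup>2) = (\<Sum>v\<in>V. g v * (f v)\<^sup>2 - 2 * c * (g v * f v) + c\<^sup>2 * g v)"
      by (intro sum.cong refl) (simp add: power2_eq_square algebra_simps)
    also have "\<dots> = N + c\<^sup>2 * (\<Sum>v\<in>V. g v)"
      by (simp add: N_def sum.distrib sum_subtractf sum_distrib_left[symmetric] mean)
    also have "\<dots> \<ge> N" using gpos by (simp add: sum_nonneg less_imp_le)
    finally show ?thesis by simp
  qed
  also have "\<dots> \<le> (\<Sum>v\<in>V. D * (f v - c)\<^sup>2)"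
    by (intro sum_mono mult_right_mono deg) auto
  finally have "N \<le> D * (\<Sum>x\<in>V. (f x - c)\<^sup>2)" by (simp add: sum_distrib_left)
  then have "h\<^sup>2 * N \<le> D * (h\<^sup>2 * (\<Sum>x\<in>V. (f x - c)\<^sup>2))"
    by (metis mult.left_commute mult_left_mono zero_le_power2)
  also have "\<dots> \<le> D * (D * Eo)" using c Dpos by (intro mult_left_mono) auto
  finally have "h\<^sup>2 / (4 * D\<^sup>2) * N \<le> Eo / 4"
    using Dpos by (simp add: field_simps power2_eq_square)
  then have "(\<Sum>v\<in>V. g v * ((f v + Q v) / 2)\<^sup>2) \<le> N - h\<^sup>2 / (4 * D\<^sup>2) * N"
    using lhs N2 Eo by argo
  then show ?thesis by (simp add: Q_def N_def left_diff_distrib)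
qed


section \<open>The chi-square distance on a changing graph\<close>

definition adj :: "graph \<Rightarrow> nat \<Rightarrow> nat \<Rightarrow> real" where
  "adj E u v = of_bool ({u, v} \<in> E)"

lemma adj_commute: "adj E u v = adj E v u"
  by (simp add: adj_def insert_commute)

lemma adj_nonneg: "0 \<le> adj E u v"
  by (simp add: adj_def)

lemma finite_graph: "E \<subseteq> vpairs n \<Longrightarrow> finite E"
  using finite_vpairs finite_subset by blast

lemma vpairs_iff: "{u, v} \<in> vpairs n \<longleftrightarrow> u \<in> {1..n} \<and> v \<in> {1..n} \<and> u \<noteq> v"
  by (auto simp: vpairs_def doubleton_eq_iff)

lemma deg_eq_sum_adj:
  assumes "E \<subseteq> vpairs n"
  shows "real (deg E x) = (\<Sum>v\<in>{1..n}. adj E x v)"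
proof -
  have "{e \<in> E. x \<in> e} = (\<lambda>v. {x, v}) ` {v\<in>{1..n}. {x, v} \<in> E}"
  proof (intro equalityI subsetI)
    fix e assume e: "e \<in> {e \<in> E. x \<in> e}"
    then obtain u v where uv: "e = {u, v}" "u \<in> {1..n}" "v \<in> {1..n}" "u \<noteq> v"
      using assms by (auto simp: vpairs_def)
    then show "e \<in> (\<lambda>v. {x, v}) ` {v\<in>{1..n}. {x, v} \<in> E}"
      using e by (cases "x = u") (auto simp: insert_commute)
  qed auto
  moreover have "inj_on (\<lambda>v. {x, v}) {v\<in>{1..n}. {x, v} \<in> E}"
    by (auto simp: inj_on_def doubleton_eq_iff)
  ultimately have "deg E x = card {v\<in>{1..n}. {x, v} \<in> E}"
    by (simp add: deg_def card_image)
  then show ?thesis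
    by (simp add: adj_def of_bool_def sum.If_cases Int_def)
qed

lemma card_edge_cut_eq_sum_adj:
  assumes S: "S \<subseteq> {1..n}"
  shows "real (card (edge_cut n E S)) = (\<Sum>u\<in>S. \<Sum>v\<in>{1..n}-S. adj E u v)"
proof -
  have fin: "finite S" using S finite_subset by blast
  have "edge_cut n E S = (\<lambda>(u, v). {u, v}) ` {z\<in>S\<times>({1..n}-S). {fst z, snd z} \<in> E}"
    by (auto simp: edge_cut_def image_iff)
  moreover have "inj_on (\<lambda>(u, v). {u, v}) {z\<in>S\<times>({1..n}-S). {fst z, snd z} \<in> E}"
    by (auto simp: inj_on_def doubleton_eq_iff)
  ultimately have "card (edge_cut n E S) = card {z\<in>S\<times>({1..n}-S). {fst z, snd z} \<in> E}"
    by (simp add: card_image)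
  also have "real \<dots> = (\<Sum>z\<in>S\<times>({1..n}-S). adj E (fst z) (snd z))"
    using fin by (simp add: adj_def of_bool_def sum.If_cases Int_def)
  finally show ?thesis by (simp add: sum.cartesian_product case_prod_beta)
qed

lemma handshake:
  assumes E: "E \<subseteq> vpairs n"
  shows "(\<Sum>x\<in>{1..n}. deg E x) = 2 * card E"
proof -
  have fin: "finite E" using finite_graph[OF E] .
  have "(\<Sum>x\<in>{1..n}. deg E x) = (\<Sum>x\<in>{1..n}. \<Sum>e | e \<in> E \<and> x \<in> e. 1)"
    by (simp add: deg_def)
  also have "\<dots> = (\<Sum>e\<in>E. \<Sum>x | x \<in> {1..n} \<and> x \<in> e. 1)"
    using fin by (intro sum.swap_restrict) auto
  also have "\<dots> = (\<Sum>e\<in>E. 2)"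
  proof (rule sum.cong[OF refl])
    fix e assume "e \<in> E"
    then obtain u v where "e = {u, v}" "u \<in> {1..n}" "v \<in> {1..n}" "u \<noteq> v"
      using E by (auto simp: vpairs_def)
    then have "{x. x \<in> {1..n} \<and> x \<in> e} = {u, v}" "card {u, v} = 2" by auto
    then show "(\<Sum>x | x \<in> {1..n} \<and> x \<in> e. 1) = (2::nat)" by simp
  qed
  finally show ?thesis by simp
qed

lemma handshake_real:
  assumes "E \<subseteq> vpairs n"
  shows "(\<Sum>x\<in>{1..n}. real (deg E x)) = 2 * real (card E)"
  using handshake[OF assms] by (metis of_nat_mult of_nat_numeral of_nat_sum)

abbreviation edge_diff :: "graph \<Rightarrow> graph \<Rightarrow> graph" where
  "edge_diff E E' \<equiv> (E - E') \<union> (E' - E)"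

lemma card_diff_le_edge_diff:
  assumes "finite E" "finite E'"
  shows "\<bar>real (card E) - real (card E')\<bar> \<le> real (card (edge_diff E E'))"
proof -
  have "real (card A) \<le> real (card B) + real (card (edge_diff E E'))"
    if "A \<subseteq> B \<union> edge_diff E E'" "finite B" for A B
    using card_mono[OF _ that(1)] card_Un_le[of B "edge_diff E E'"] assms that(2) by simp
  from this[of E E'] this[of E' E] have "real (card E) \<le> real (card E') + real (card (edge_diff E E'))"
    "real (card E') \<le> real (card E) + real (card (edge_diff E E'))"
    using assms by blast+
  then show ?thesis by linarith
qed

lemma deg_diff_le_edge_diff:
  assumes "finite E" "finite E'"
  shows "\<bar>real (deg E x) - real (deg E' x)\<bar> \<le> real (deg (edge_diff E E') x)"
proof -
  have "edge_diff {e\<in>E. x \<in> e} {e\<in>E'. x \<in> e} = {e\<in>edge_diff E E'. x \<in> e}" by auto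
  then show ?thesis
    using card_diff_le_edge_diff[of "{e\<in>E. x \<in> e}" "{e\<in>E'. x \<in> e}"] assms
    by (simp add: deg_def)
qed

text \<open>Expansion is per vertex, not per unit of volume: it then only asks that enough edges of
  each cut survive, and new edges, which enlarge volumes, cannot spoil it. With degrees at most
  \<open>\<Delta>\<close> it plays the role of a conductance of order
  \<open>h / \<Delta>\<close>.\<close>

definition nice_graph :: "nat \<Rightarrow> real \<Rightarrow> real \<Rightarrow> real \<Rightarrow> graph \<Rightarrow> bool" where
  "nice_graph n \<kappa> \<Delta> h E \<longleftrightarrow> E \<subseteq> vpairs n \<and>
    (\<forall>x\<in>{1..n}. \<kappa> \<le> real (deg E x) \<and> real (deg E x) \<le> \<Delta>) \<and>
    (\<forall>S\<subseteq>{1..n}. S \<noteq> {} \<longrightarrow> 2 * card S \<le> n \<longrightarrow> h * real (card S) \<le> real (card (edge_cut n E S)))"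

definition chi_sq :: "nat \<Rightarrow> (nat \<Rightarrow> real) \<Rightarrow> graph \<Rightarrow> real" where
  "chi_sq n \<mu> E = (\<Sum>x\<in>{1..n}. (\<mu> x - stationary E x)\<^sup>2 / stationary E x)"

lemma stationary_nonneg: "0 \<le> stationary E x"
  by (simp add: stationary_def)

lemma chi_sq_nonneg: "0 \<le> chi_sq n \<mu> E"
  unfolding chi_sq_def by (intro sum_nonneg divide_nonneg_nonneg stationary_nonneg) auto

context
  fixes n :: nat and \<kappa> \<Delta> h :: real and E :: graph
  assumes nice: "nice_graph n \<kappa> \<Delta> h E" and \<kappa>: "0 < \<kappa>" and n: "1 \<le> n"
begin

lemma nice_subset: "E \<subseteq> vpairs n"
  using nice by (simp add: nice_graph_def)

lemma nice_deg: "x \<in> {1..n} \<Longrightarrow> \<kappa> \<le> real (deg E x)" "x \<in> {1..n} \<Longrightarrow> real (deg E x) \<le> \<Delta>"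
  using nice by (auto simp: nice_graph_def)

lemma nice_cut: "S \<subseteq> {1..n} \<Longrightarrow> S \<noteq> {} \<Longrightarrow> 2 * card S \<le> n \<Longrightarrow>
    h * real (card S) \<le> real (card (edge_cut n E S))"
  using nice by (simp add: nice_graph_def)

lemma nice_card: "real n * \<kappa> \<le> 2 * real (card E)" "2 * real (card E) \<le> real n * \<Delta>"
proof -
  have "(\<Sum>x\<in>{1..n}. \<kappa>) \<le> (\<Sum>x\<in>{1..n}. real (deg E x))" by (intro sum_mono nice_deg)
  then show "real n * \<kappa> \<le> 2 * real (card E)" unfolding handshake_real[OF nice_subset] by simp
  have "(\<Sum>x\<in>{1..n}. real (deg E x)) \<le> (\<Sum>x\<in>{1..n}. \<Delta>)" by (intro sum_mono nice_deg)
  then show "2 * real (card E) \<le> real n * \<Delta>" unfolding handshake_real[OF nice_subset] by simp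
qed

lemma nice_card_pos: "0 < real (card E)"
proof -
  have "0 < real n * \<kappa>" using n \<kappa> by simp
  then show ?thesis using nice_card(1) by linarith
qed

lemma nice_stationary_pos: "x \<in> {1..n} \<Longrightarrow> 0 < stationary E x"
  using nice_deg(1)[of x] nice_card_pos \<kappa> by (auto simp: stationary_def intro!: divide_pos_pos)

lemma nice_stationary_sum: "(\<Sum>x\<in>{1..n}. stationary E x) = 1"
  using nice_card_pos handshake_real[OF nice_subset]
  by (simp add: stationary_def sum_divide_distrib[symmetric])

lemma sum_square_shift:
  assumes "(\<Sum>x\<in>{1..n}. \<mu> x) = 1"
  shows "(\<Sum>x\<in>{1..n}. (\<mu> x - c * stationary E x)\<^sup>2 / stationary E x)
    = (\<Sum>x\<in>{1..n}. (\<mu> x)\<^sup>2 / stationary E x) - 2 * c + c\<^sup>2"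
proof -
  have "(\<Sum>x\<in>{1..n}. (\<mu> x - c * stationary E x)\<^sup>2 / stationary E x)
    = (\<Sum>x\<in>{1..n}. (\<mu> x)\<^sup>2 / stationary E x - 2 * c * \<mu> x + c\<^sup>2 * stationary E x)"
  proof (rule sum.cong[OF refl])
    fix x assume "x \<in> {1..n}"
    then have "stationary E x \<noteq> 0" using nice_stationary_pos by force
    then show "(\<mu> x - c * stationary E x)\<^sup>2 / stationary E x
      = (\<mu> x)\<^sup>2 / stationary E x - 2 * c * \<mu> x + c\<^sup>2 * stationary E x"
      by (simp add: power2_eq_square field_simps)
  qed
  also have "\<dots> = (\<Sum>x\<in>{1..n}. (\<mu> x)\<^sup>2 / stationary E x) - 2 * c * 1 + c\<^sup>2 * 1"
    by (simp only: sum.distrib sum_subtractf sum_distrib_left[symmetric] assms nice_stationary_sum)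
  finally show ?thesis by simp
qed

text \<open>By \<open>sum_square_shift\<close> the right-hand side is a constant plus c^2 - 2 c,
  minimal at c = 1. Moving the centre is thus free in this direction;
  \<open>chi_sq_change_graph\<close> uses it to absorb a change in the total number of
  edges.\<close>

lemma chi_sq_le_shift:
  assumes "(\<Sum>x\<in>{1..n}. \<mu> x) = 1"
  shows "chi_sq n \<mu> E \<le> (\<Sum>x\<in>{1..n}. (\<mu> x - c * stationary E x)\<^sup>2 / stationary E x)"
proof -
  have "0 \<le> (c - 1)\<^sup>2" by simp
  then have "- 1 \<le> - 2 * c + c\<^sup>2" by (simp add: power2_eq_square algebra_simps)
  then show ?thesis
    using sum_square_shift[OF assms, of 1] sum_square_shift[OF assms, of c]
    by (simp add: chi_sq_def)
qed

lemma chi_sq_point_mass: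
  assumes x: "x \<in> {1..n}"
  shows "chi_sq n (\<lambda>y. if y = x then 1 else 0) E \<le> real n * \<Delta> / \<kappa>"
proof -
  have "(\<Sum>y\<in>{1..n}. (if y = x then 1 else 0 :: real)) = 1" using x by simp
  from sum_square_shift[OF this, of 1]
  have "chi_sq n (\<lambda>y. if y = x then 1 else 0) E
    = (\<Sum>y\<in>{1..n}. (if y = x then 1 else 0)\<^sup>2 / stationary E y) - 1"
    by (simp add: chi_sq_def)
  also have "(\<Sum>y\<in>{1..n}. (if y = x then 1 else 0)\<^sup>2 / stationary E y)
    = (\<Sum>y\<in>{1..n}. if y = x then 1 / stationary E y else 0)"
    by (intro sum.cong refl) auto
  also have "\<dots> = 1 / stationary E x" using x by simp
  also have "\<dots> = 2 * real (card E) / real (deg E x)" by (simp add: stationary_def)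
  also have "\<dots> \<le> real n * \<Delta> / \<kappa>"
    using nice_card(2) nice_deg[OF x] \<kappa> by (intro frac_le) auto
  finally show ?thesis by simp
qed

lemma tv_dist_le_chi_sq: "tv_dist n \<mu> (stationary E) \<le> sqrt (chi_sq n \<mu> E)"
proof -
  have "(\<Sum>x\<in>{1..n}. \<bar>\<mu> x - stationary E x\<bar>)\<^sup>2
    = (\<Sum>x\<in>{1..n}. (\<bar>\<mu> x - stationary E x\<bar> / sqrt (stationary E x)) * sqrt (stationary E x))\<^sup>2"
  proof -
    have "\<bar>\<mu> x - stationary E x\<bar>
      = (\<bar>\<mu> x - stationary E x\<bar> / sqrt (stationary E x)) * sqrt (stationary E x)"
      if "x \<in> {1..n}" for x
      using nice_stationary_pos[OF that] by simp
    then show ?thesis by (intro arg_cong[where f="\<lambda>x. x\<^sup>2"] sum.cong refl)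
  qed
  also have "\<dots> \<le> (\<Sum>x\<in>{1..n}. (\<bar>\<mu> x - stationary E x\<bar> / sqrt (stationary E x))\<^sup>2)
      * (\<Sum>x\<in>{1..n}. (sqrt (stationary E x))\<^sup>2)"
    by (rule Cauchy_Schwarz_ineq_sum)
  also have "\<dots> = chi_sq n \<mu> E"
  proof -
    have "(\<Sum>x\<in>{1..n}. (sqrt (stationary E x))\<^sup>2) = 1"
      using nice_stationary_sum by (simp add: stationary_nonneg)
    then show ?thesis
      by (simp only: chi_sq_def power_divide real_sqrt_pow2[OF stationary_nonneg] power2_abs mult_1_right)
  qed
  finally have "(\<Sum>x\<in>{1..n}. \<bar>\<mu> x - stationary E x\<bar>) \<le> sqrt (chi_sq n \<mu> E)"
    by (intro real_le_rsqrt)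
  moreover have "0 \<le> sqrt (chi_sq n \<mu> E)" by (simp add: chi_sq_nonneg)
  ultimately show ?thesis unfolding tv_dist_def by linarith
qed

text \<open>In the density \<open>f u = \<mu> u / g u - 1 / m2\<close>, with \<open>g\<close> the
  degree, chi-square is \<open>m2\<close> times a degree-weighted squared norm. By reversibility a
  step replaces \<open>f v\<close> by the average of \<open>f v\<close> and the mean of
  \<open>f\<close> over the neighbours of \<open>v\<close>, which is the operator of
  \<open>lazy_contraction\<close>; the mean-zero condition there is total mass 1.\<close>

lemma chi_sq_lazy_step:
  assumes sum1: "(\<Sum>x\<in>{1..n}. \<mu> x) = 1" and h: "0 \<le> h"
  shows "chi_sq n (\<lambda>y. \<Sum>z\<in>{1..n}. \<mu> z * lazy_walk E z y) E
    \<le> (1 - h\<^sup>2 / (4 * \<Delta>\<^sup>2)) * chi_sq n \<mu> E"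
proof -
  define V where "V = {1..n}"
  define m2 where "m2 = 2 * real (card E)"
  define g where "g = (\<lambda>u. \<Sum>v\<in>V. adj E u v)"
  define f where "f = (\<lambda>u. \<mu> u / g u - 1 / m2)"
  define \<mu>' where "\<mu>' = (\<lambda>y. \<Sum>z\<in>V. \<mu> z * lazy_walk E z y)"
  have m2: "0 < m2" using nice_card_pos by (simp add: m2_def)
  have gdeg: "real (deg E u) = g u" for u
    by (simp add: g_def V_def deg_eq_sum_adj[OF nice_subset])
  have gpos: "0 < g u" if "u \<in> V" for u
    using nice_deg(1)[of u] that \<kappa> by (simp add: gdeg V_def)
  have chi: "chi_sq n \<nu> E = m2 * (\<Sum>v\<in>V. g v * (\<nu> v / g v - 1 / m2)\<^sup>2)" for \<nu>
    unfolding chi_sq_def sum_distrib_left V_def[symmetric]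
  proof (rule sum.cong[OF refl])
    fix v assume "v \<in> V"
    then have "0 < g v" by (rule gpos)
    moreover have "stationary E v = g v / m2" by (simp only: stationary_def gdeg m2_def)
    moreover have "(a - b / c)\<^sup>2 / (b / c) = c * (b * (a / b - 1 / c)\<^sup>2)" if "0 < b" "0 < c" for a b c :: real
      using that by (simp add: power2_eq_square field_simps)
    ultimately show "(\<nu> v - stationary E v)\<^sup>2 / stationary E v = m2 * (g v * (\<nu> v / g v - 1 / m2)\<^sup>2)"
      using m2 by simp
  qed
  have step: "\<mu>' v / g v - 1 / m2 = (f v + (\<Sum>u\<in>V. adj E v u * f u) / g v) / 2" if v: "v \<in> V" for v
  proof -
    have selfadj: "adj E v v = 0"
      using subsetD[OF nice_subset, of "{v, v}"] vpairs_iff[of v v n] unfolding adj_def by fastforce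
    have "\<mu>' v = (\<Sum>z\<in>V. (if z = v then \<mu> v / 2 else 0) + adj E v z * (\<mu> z / g z) / 2)"
      unfolding \<mu>'_def
    proof (rule sum.cong[OF refl])
      fix z assume z: "z \<in> V"
      show "\<mu> z * lazy_walk E z v = (if z = v then \<mu> v / 2 else 0) + adj E v z * (\<mu> z / g z) / 2"
      proof (cases "z = v")
        case True
        then show ?thesis using gpos[OF v] selfadj gdeg[of v] by (auto simp: lazy_walk_def)
      next
        case False
        then show ?thesis
          by (simp add: lazy_walk_def gdeg adj_def insert_commute)
      qed
    qed
    also have "\<dots> = \<mu> v / 2 + (\<Sum>z\<in>V. adj E v z * (\<mu> z / g z)) / 2"
      using v by (simp add: sum.distrib sum_divide_distrib V_def)
    also have "(\<Sum>z\<in>V. adj E v z * (\<mu> z / g z)) = (\<Sum>z\<in>V. adj E v z * f z) + g v / m2"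
      by (simp add: f_def right_diff_distrib sum_subtractf g_def sum_divide_distrib)
    finally show ?thesis
      using gpos[OF v] m2 by (simp add: f_def field_simps)
  qed
  have "chi_sq n \<mu>' E = m2 * (\<Sum>v\<in>V. g v * ((f v + (\<Sum>u\<in>V. adj E v u * f u) / g v) / 2)\<^sup>2)"
    by (simp add: chi step)
  also have "\<dots> \<le> m2 * ((1 - h\<^sup>2 / (4 * \<Delta>\<^sup>2)) * (\<Sum>v\<in>V. g v * (f v)\<^sup>2))"
  proof (rule mult_left_mono[OF lazy_contraction[where A="adj E"]])
    show "h * real (card S) \<le> (\<Sum>u\<in>S. \<Sum>v\<in>V - S. adj E u v)"
      if "S \<subseteq> V" "S \<noteq> {}" "2 * card S \<le> card V" for S
    proof -
      have S: "S \<subseteq> {1..n}" "2 * card S \<le> n" using that by (simp_all add: V_def)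
      show ?thesis
        using nice_cut[OF S(1) that(2) S(2)] unfolding card_edge_cut_eq_sum_adj[OF S(1)] V_def .
    qed
    have "(\<Sum>u\<in>V. g u * f u) = (\<Sum>u\<in>V. \<mu> u - g u / m2)"
    proof (rule sum.cong[OF refl])
      fix u assume "u \<in> V"
      then show "g u * f u = \<mu> u - g u / m2"
        using gpos[of u] by (simp add: f_def field_simps)
    qed
    also have "\<dots> = 1 - (\<Sum>u\<in>V. g u) / m2"
      using sum1 by (simp add: sum_subtractf V_def sum_divide_distrib)
    also have "(\<Sum>u\<in>V. g u) = m2"
      using handshake_real[OF nice_subset] by (simp add: gdeg V_def m2_def)
    finally show "(\<Sum>u\<in>V. g u * f u) = 0" using m2 by simp
    show "g u \<le> \<Delta>" if "u \<in> V" for u using nice_deg(2)[of u] that by (simp add: gdeg V_def)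
    show "V \<noteq> {}" using n by (simp add: V_def)
    show "finite V" by (simp add: V_def)
    show "0 \<le> m2" using m2 by simp
    show "g u = (\<Sum>v\<in>V. adj E u v)" for u by (simp add: g_def)
  qed (rule adj_commute adj_nonneg gpos h; assumption?)+
  also have "\<dots> = (1 - h\<^sup>2 / (4 * \<Delta>\<^sup>2)) * chi_sq n \<mu> E"
    by (simp add: chi f_def)
  finally show ?thesis by (simp add: \<mu>'_def V_def)
qed

end

lemma square_add_le:
  fixes x y \<theta> :: real
  assumes "0 < \<theta>"
  shows "(x + y)\<^sup>2 \<le> (1 + \<theta>) * x\<^sup>2 + (1 + 1 / \<theta>) * y\<^sup>2"
proof -
  have "0 \<le> (\<theta> * x - y)\<^sup>2 / \<theta>" using assms by simp
  also have "\<dots> = \<theta> * x\<^sup>2 - 2 * x * y + y\<^sup>2 / \<theta>"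
    using assms by (simp add: power2_eq_square field_simps)
  finally show ?thesis by (simp add: power2_eq_square algebra_simps)
qed

text \<open>Centring at \<open>(m' / m) * stationary E' x\<close>, which equals
  \<open>deg E' x / (2 * m)\<close>, removes the global effect of a new edge count from the
  pointwise comparison: a vertex without changed edges has no error, and \<open>m' / m\<close>
  survives only as a prefactor bounded by \<open>exp \<eta>\<close>. The remaining errors are linear
  in the number of changed edges at \<open>x\<close>, so the handshake identity sums them.\<close>

lemma chi_sq_change_graph:
  assumes nE: "nice_graph n \<kappa> \<Delta> h E" and nE': "nice_graph n \<kappa> \<Delta> h E'" and \<kappa>: "0 < \<kappa>" and n: "1 \<le> n"
    and sum1: "(\<Sum>x\<in>{1..n}. \<mu> x) = 1"
    and L: "real (card (edge_diff E E')) \<le> L" and M: "L \<le> M * \<kappa>"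
  defines "\<eta> \<equiv> 2 * L / (real n * \<kappa>)"
  shows "chi_sq n \<mu> E' \<le> exp \<eta> * ((\<Sum>x\<in>{1..n}. (\<mu> x - stationary E x)\<^sup>2 / stationary E x *
      exp (2 / \<kappa> * real (deg (edge_diff E E') x))) + (M + 1) * \<eta>)"
proof -
  define m where "m = real (card E)"
  define m' where "m' = real (card E')"
  define F where "F = edge_diff E E'"
  have F: "F \<subseteq> vpairs n" using nE nE' by (auto simp: F_def nice_graph_def)
  have finF: "finite F" using F finite_graph by blast
  have finE: "finite E" "finite E'" using nE nE' finite_graph by (auto simp: nice_graph_def)
  have m: "0 < m" "0 < m'"
    using nice_card_pos[OF nE \<kappa> n] nice_card_pos[OF nE' \<kappa> n] by (auto simp: m_def m'_def)
  have mlow: "real n * \<kappa> / 2 \<le> m" using nice_card(1)[OF nE \<kappa> n] by (simp add: m_def)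
  have nk: "0 < real n * \<kappa>" using n \<kappa> by simp
  have L0: "0 \<le> L" using L by linarith
  have M0: "0 \<le> M" using L0 M \<kappa> by (metis mult_neg_pos not_less order_trans)
  have degF: "real (deg F x) \<le> L" for x
  proof -
    have "deg F x \<le> card F" unfolding deg_def using finF by (intro card_mono) auto
    then show ?thesis using L by (simp add: F_def)
  qed
  have \<eta>0: "0 \<le> \<eta>" using L0 nk by (simp add: \<eta>_def)
  have Lm: "L / m \<le> \<eta>"
  proof -
    have "L / m \<le> L / (real n * \<kappa> / 2)" using mlow nk m L0 by (intro divide_left_mono) auto
    then show ?thesis by (simp add: \<eta>_def mult_ac)
  qed
  have m'm: "m' / m \<le> exp \<eta>"
  proof -
    have "m' \<le> m + L"
      using card_diff_le_edge_diff[OF finE] L by (auto simp: m_def m'_def abs_le_iff)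
    then have "m' / m \<le> 1 + L / m" using m by (simp add: field_simps)
    also have "\<dots> \<le> exp \<eta>" using Lm exp_ge_add_one_self[of \<eta>] by linarith
    finally show ?thesis .
  qed
  let ?u = "\<lambda>x. (\<mu> x - stationary E x)\<^sup>2 / stationary E x"
  have point: "(\<mu> x - (m' / m) * stationary E' x)\<^sup>2 / stationary E' x
    \<le> (m' / m) * (?u x * exp (2 / \<kappa> * real (deg F x)) + (M + 1) / (2 * m) * real (deg F x))"
    if x: "x \<in> {1..n}" for x
  proof -
    define d where "d = real (deg E x)"
    define d' where "d' = real (deg E' x)"
    define N where "N = real (deg F x)"
    have d: "\<kappa> \<le> d" "\<kappa> \<le> d'" using nice_deg(1)[OF nE \<kappa> n x] nice_deg(1)[OF nE' \<kappa> n x]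
      by (auto simp: d_def d'_def)
    have dd: "\<bar>d - d'\<bar> \<le> N" using deg_diff_le_edge_diff[OF finE, of x] by (simp add: d_def d'_def N_def F_def)
    have st: "stationary E x = d / (2 * m)" "stationary E' x = d' / (2 * m')"
      by (simp_all add: stationary_def d_def d'_def m_def m'_def)
    define X where "X = \<mu> x - d / (2 * m)"
    define e where "e = (d - d') / (2 * m)"
    have lhs: "(\<mu> x - (m' / m) * stationary E' x)\<^sup>2 / stationary E' x = (m' / m) * ((X + e)\<^sup>2 * (2 * m / d'))"
    proof -
      have "X + e = \<mu> x - d' / (2 * m)" by (simp add: X_def e_def diff_divide_distrib)
      moreover have "(m' / m) * stationary E' x = d' / (2 * m)" using m by (simp add: st)
      moreover have "Y / (d' / (2 * m')) = (m' / m) * (Y * (2 * m / d'))" for Y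
        using m d \<kappa> by simp
      ultimately show ?thesis unfolding st by presburger
    qed
    have u: "?u x = X\<^sup>2 * (2 * m / d)" using m d \<kappa> by (simp add: st X_def)
    have N0: "0 \<le> N" by (simp add: N_def)
    have "(X + e)\<^sup>2 * (2 * m / d') \<le> ?u x * exp (2 / \<kappa> * N) + (M + 1) / (2 * m) * N"
    proof (cases "N = 0")
      case True
      then have "d' = d" "e = 0" using dd by (auto simp: e_def)
      then show ?thesis using True u by simp
    next
      case False
      then have N: "0 < N" using N0 by simp
      \<comment> \<open>This weight makes \<open>1 + \<theta>\<close> equal to the bound for the
        degree ratio \<open>d / d'\<close>, so the two together fit into
        \<open>exp (2 / \<kappa> * N)\<close>. In the term with \<open>1 / \<theta>\<close> it
        cancels one power of \<open>N\<close>; what stays quadratic is linearised by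
        \<open>N / \<kappa> \<le> M\<close>.\<close>
      define \<theta> where "\<theta> = N / \<kappa>"
      have \<theta>: "0 < \<theta>" using N \<kappa> by (simp add: \<theta>_def)
      have dq: "d / d' \<le> 1 + \<theta>"
      proof -
        have "d / d' \<le> (d' + N) / d'" using dd d \<kappa> by (intro divide_right_mono) auto
        also have "\<dots> = 1 + N / d'" using d \<kappa> by (simp add: field_simps)
        also have "N / d' \<le> N / \<kappa>" using d \<kappa> N by (intro divide_left_mono) auto
        finally show ?thesis by (simp add: \<theta>_def)
      qed
      have e2: "e\<^sup>2 \<le> N\<^sup>2 / (4 * m\<^sup>2)"
      proof -
        have "(d - d')\<^sup>2 \<le> N\<^sup>2" using dd N0 by (simp add: abs_le_square_iff[symmetric])
        then show ?thesis using m by (simp add: e_def power_divide power_mult_distrib divide_right_mono)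
      qed
      have exp2: "(1 + \<theta>) * (1 + \<theta>) \<le> exp (2 / \<kappa> * N)"
      proof -
        have "(1 + \<theta>) * (1 + \<theta>) \<le> exp \<theta> * exp \<theta>" using \<theta> by (intro mult_mono exp_ge_add_one_self) auto
        also have "\<dots> = exp (2 / \<kappa> * N)" by (simp add: exp_add[symmetric] \<theta>_def)
        finally show ?thesis .
      qed
      have "(1 + 1 / \<theta>) * (2 * m / \<kappa>) * (N\<^sup>2 / (4 * m\<^sup>2)) = (N / \<kappa> + 1) / (2 * m) * N"
        using N m \<kappa> by (simp add: \<theta>_def power2_eq_square field_simps)
      also have "\<dots> \<le> (M + 1) / (2 * m) * N"
      proof -
        have "N / \<kappa> \<le> M" using degF[of x] M \<kappa> by (simp add: N_def field_simps)
        then show ?thesis using N m by (intro mult_right_mono divide_right_mono) auto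
      qed
      finally have err: "(1 + 1 / \<theta>) * (2 * m / \<kappa>) * (N\<^sup>2 / (4 * m\<^sup>2)) \<le> (M + 1) / (2 * m) * N" .
      have "(X + e)\<^sup>2 * (2 * m / d') \<le> ((1 + \<theta>) * X\<^sup>2 + (1 + 1 / \<theta>) * e\<^sup>2) * (2 * m / d')"
        using square_add_le[OF \<theta>] m d \<kappa> by (intro mult_right_mono) auto
      also have "\<dots> = ?u x * ((1 + \<theta>) * (d / d')) + (1 + 1 / \<theta>) * (2 * m / d') * e\<^sup>2"
        unfolding u using d \<kappa> by (simp add: field_simps)
      also have "\<dots> \<le> ?u x * ((1 + \<theta>) * (1 + \<theta>)) + (1 + 1 / \<theta>) * (2 * m / \<kappa>) * (N\<^sup>2 / (4 * m\<^sup>2))"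
        using dq e2 d \<kappa> m \<theta>
        by (intro add_mono mult_left_mono mult_mono divide_left_mono) (auto simp: st)
      also have "\<dots> \<le> ?u x * exp (2 / \<kappa> * N) + (M + 1) / (2 * m) * N"
        using divide_nonneg_nonneg[OF zero_le_power2 stationary_nonneg]
        by (intro add_mono[OF mult_left_mono[OF exp2] err])
      finally show ?thesis .
    qed
    then show ?thesis unfolding lhs N_def using m by (intro mult_left_mono) auto
  qed
  have "chi_sq n \<mu> E' \<le> (\<Sum>x\<in>{1..n}. (\<mu> x - (m' / m) * stationary E' x)\<^sup>2 / stationary E' x)"
    by (rule chi_sq_le_shift[OF nE' \<kappa> n sum1])
  also have "\<dots> \<le> (\<Sum>x\<in>{1..n}. (m' / m) * (?u x * exp (2 / \<kappa> * real (deg F x)) + (M + 1) / (2 * m) * real (deg F x)))"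
    by (intro sum_mono point)
  also have "\<dots> = (m' / m) * ((\<Sum>x\<in>{1..n}. ?u x * exp (2 / \<kappa> * real (deg F x))) + (M + 1) / (2 * m) * (2 * real (card F)))"
    unfolding handshake_real[OF F, symmetric]
    by (subst sum_distrib_left[symmetric]) (simp only: sum_distrib_left sum.distrib)
  also have "\<dots> \<le> exp \<eta> * ((\<Sum>x\<in>{1..n}. ?u x * exp (2 / \<kappa> * real (deg F x))) + (M + 1) * \<eta>)"
  proof (rule mult_mono[OF m'm add_left_mono])
    have "real (card F) / m \<le> \<eta>" using divide_right_mono[OF L, of m] Lm m by (simp add: F_def)
    then have "(M + 1) * (real (card F) / m) \<le> (M + 1) * \<eta>" using M0 by (intro mult_left_mono) auto
    then show "(M + 1) / (2 * m) * (2 * real (card F)) \<le> (M + 1) * \<eta>" using m by (simp add: field_simps)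
    show "0 \<le> (\<Sum>x\<in>{1..n}. ?u x * exp (2 / \<kappa> * real (deg F x))) + (M + 1) / (2 * m) * (2 * real (card F))"
      using m M0 by (intro add_nonneg_nonneg sum_nonneg mult_nonneg_nonneg divide_nonneg_nonneg
        stationary_nonneg) simp_all
  qed auto
  finally show ?thesis by (simp add: F_def)
qed


section \<open>Exponential moments along the edge-Markovian sequence\<close>

lemma expectation_mono_finite:
  fixes f g :: "'a \<Rightarrow> real"
  assumes "finite (set_pmf p)" "\<And>x. x \<in> set_pmf p \<Longrightarrow> f x \<le> g x"
  shows "measure_pmf.expectation p f \<le> measure_pmf.expectation p g"
  using assms by (intro integral_mono_AE) (auto simp: AE_measure_pmf_iff integrable_measure_pmf_finite)

lemma prob_le_expectation:
  fixes f :: "'a \<Rightarrow> real"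
  assumes "finite (set_pmf p)" "\<And>x. x \<in> set_pmf p \<Longrightarrow> 0 \<le> f x"
    "\<And>x. x \<in> set_pmf p \<Longrightarrow> P x \<Longrightarrow> 1 \<le> f x"
  shows "measure_pmf.prob p {x. P x} \<le> measure_pmf.expectation p f"
proof -
  have "measure_pmf.prob p {x. P x} = measure_pmf.expectation p (indicator {x. P x})" by simp
  also have "\<dots> \<le> measure_pmf.expectation p f"
    using assms by (intro expectation_mono_finite) (auto simp: indicator_def)
  finally show ?thesis .
qed

lemma finite_set_pmf_em_step: "finite (set_pmf (em_step n p q E))"
  using set_pmf_em_step finite_vpairs by (metis finite_Pow_iff finite_subset)

lemma em_step_exp_moment:
  assumes A: "A \<subseteq> vpairs n" and c: "0 \<le> c" and p: "0 \<le> p" "p \<le> 1" and q: "0 \<le> q" "q \<le> 1"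
  shows "measure_pmf.expectation (em_step n p q E) (\<lambda>E'. c ^ card (A \<inter> edge_diff E E'))
    = (\<Prod>e\<in>A. 1 + (c - 1) * (if e \<in> E then q else p))"
proof -
  define g where "g = (\<lambda>e b. if e \<in> A \<and> b \<noteq> (e \<in> E) then c else 1 :: real)"
  have finA: "finite A" using A finite_graph by blast
  have "c ^ card (A \<inter> edge_diff E {e \<in> vpairs n. b e}) = (\<Prod>e\<in>vpairs n. g e (b e))" for b
  proof -
    have "A \<inter> edge_diff E {e \<in> vpairs n. b e} = {e\<in>vpairs n. e \<in> A \<and> b e \<noteq> (e \<in> E)}"
      using A by auto
    then show ?thesis by (simp add: g_def prod.If_cases[OF finite_vpairs] Int_def)
  qed
  then have "measure_pmf.expectation (em_step n p q E) (\<lambda>E'. c ^ card (A \<inter> edge_diff E E'))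
    = measure_pmf.expectation (Pi_pmf (vpairs n) False (\<lambda>e. bernoulli_pmf (if e \<in> E then 1 - q else p)))
        (\<lambda>b. \<Prod>e\<in>vpairs n. g e (b e))"
    by (simp add: em_step_def)
  also have "\<dots> = (\<Prod>e\<in>vpairs n. measure_pmf.expectation
      (bernoulli_pmf (if e \<in> E then 1 - q else p)) (g e))"
    using c by (intro expectation_prod_Pi_pmf finite_vpairs integrable_measure_pmf_finite)
      (simp_all add: g_def)
  also have "\<dots> = (\<Prod>e\<in>vpairs n. if e \<in> A then 1 + (c - 1) * (if e \<in> E then q else p) else 1)"
    using p q by (intro prod.cong refl) (auto simp: g_def algebra_simps)
  also have "\<dots> = (\<Prod>e\<in>A. 1 + (c - 1) * (if e \<in> E then q else p))"
    using A finite_vpairs by (simp add: prod.If_cases Int_absorb1)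
  finally show ?thesis .
qed

text \<open>The Poisson bound: independence over pairs gives a product of factors 1 + x, each at
  most exp x, and \<open>r\<close> dominates the mean number of changed pairs in
  \<open>A\<close>.\<close>

lemma em_step_exp_moment_le:
  assumes A: "A \<subseteq> vpairs n" and \<theta>: "0 \<le> \<theta>" and p: "0 \<le> p" "p \<le> 1" and q: "0 \<le> q" "q \<le> 1"
    and r: "q * real (card (A \<inter> E)) + p * real (card (A - E)) \<le> r"
  shows "measure_pmf.expectation (em_step n p q E) (\<lambda>E'. exp (\<theta> * real (card (A \<inter> edge_diff E E'))))
    \<le> exp ((exp \<theta> - 1) * r)"
proof -
  have finA: "finite A" using A finite_graph by blast
  have e1: "0 \<le> exp \<theta> - 1" using \<theta> by simp
  have "measure_pmf.expectation (em_step n p q E) (\<lambda>E'. exp (\<theta> * real (card (A \<inter> edge_diff E E'))))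
    = measure_pmf.expectation (em_step n p q E) (\<lambda>E'. exp \<theta> ^ card (A \<inter> edge_diff E E'))"
    by (simp add: exp_of_nat2_mult)
  also have "\<dots> = (\<Prod>e\<in>A. 1 + (exp \<theta> - 1) * (if e \<in> E then q else p))"
    by (rule em_step_exp_moment[OF A _ p q]) simp
  also have "\<dots> \<le> (\<Prod>e\<in>A. exp ((exp \<theta> - 1) * (if e \<in> E then q else p)))"
    using e1 p q by (intro prod_mono conjI add_nonneg_nonneg exp_ge_add_one_self) auto
  also have "\<dots> = exp (\<Sum>e\<in>A. (exp \<theta> - 1) * (if e \<in> E then q else p))"
    by (rule exp_sum[OF finA, symmetric])
  also have "(\<Sum>e\<in>A. (exp \<theta> - 1) * (if e \<in> E then q else p))
    = (exp \<theta> - 1) * (q * real (card (A \<inter> E)) + p * real (card (A - E)))"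
    using finA by (simp add: sum_distrib_left[symmetric] sum.If_cases Diff_eq mult.commute)
  also have "exp \<dots> \<le> exp ((exp \<theta> - 1) * r)"
    using mult_left_mono[OF r e1] by simp
  finally show ?thesis .
qed

text \<open>The process up to time \<open>t\<close>, continued by the constant \<open>E0\<close> so
  that a finite history is a single function and the support is finite. Expectations become finite
  sums, without measurability or integrability conditions.\<close>

primrec traj :: "nat \<Rightarrow> real \<Rightarrow> real \<Rightarrow> graph \<Rightarrow> nat \<Rightarrow> (nat \<Rightarrow> graph) pmf" where
  "traj n p q E0 0 = return_pmf (\<lambda>_. E0)"
| "traj n p q E0 (Suc t) =
     bind_pmf (traj n p q E0 t) (\<lambda>G. map_pmf (\<lambda>E. G(Suc t := E)) (em_step n p q (G t)))"

lemma finite_set_pmf_traj: "finite (set_pmf (traj n p q E0 t))"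
  by (induction t) (auto simp: finite_set_pmf_em_step)

lemma set_pmf_traj:
  assumes "E0 \<subseteq> vpairs n" "G \<in> set_pmf (traj n p q E0 t)"
  shows "G 0 = E0" "G s \<subseteq> vpairs n" "t < s \<Longrightarrow> G s = E0"
proof -
  have "G 0 = E0 \<and> (\<forall>s. G s \<subseteq> vpairs n) \<and> (\<forall>s>t. G s = E0)"
    using assms(2)
  proof (induction t arbitrary: G)
    case 0
    then show ?case using assms(1) by simp
  next
    case (Suc t)
    then obtain G' E where *: "G' \<in> set_pmf (traj n p q E0 t)" "E \<in> set_pmf (em_step n p q (G' t))"
      "G = G'(Suc t := E)" by auto
    then have "E \<subseteq> vpairs n" using set_pmf_em_step by blast
    then show ?case using Suc.IH[OF *(1)] *(3) by simp
  qed
  then show "G 0 = E0" "G s \<subseteq> vpairs n" "t < s \<Longrightarrow> G s = E0" by auto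
qed

lemma expectation_traj_Suc:
  fixes f :: "(nat \<Rightarrow> graph) \<Rightarrow> real"
  shows "measure_pmf.expectation (traj n p q E0 (Suc t)) f = measure_pmf.expectation (traj n p q E0 t)
    (\<lambda>G. measure_pmf.expectation (em_step n p q (G t)) (\<lambda>E. f (G(Suc t := E))))"
proof -
  let ?A = "set_pmf (traj n p q E0 t)"
  have "measure_pmf.expectation (traj n p q E0 (Suc t)) f
    = (\<Sum>G\<in>?A. pmf (traj n p q E0 t) G *\<^sub>R
        measure_pmf.expectation (map_pmf (\<lambda>E. G(Suc t := E)) (em_step n p q (G t))) f)"
    unfolding traj.simps
    by (rule pmf_expectation_bind) (simp_all add: finite_set_pmf_traj finite_set_pmf_em_step)
  also have "\<dots> = (\<Sum>G\<in>?A. pmf (traj n p q E0 t) G *\<^sub>R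
        measure_pmf.expectation (em_step n p q (G t)) (\<lambda>E. f (G(Suc t := E))))"
    by (simp only: integral_map_pmf)
  also have "\<dots> = measure_pmf.expectation (traj n p q E0 t)
    (\<lambda>G. measure_pmf.expectation (em_step n p q (G t)) (\<lambda>E. f (G(Suc t := E))))"
    by (rule integral_measure_pmf[symmetric]) (auto simp: finite_set_pmf_traj)
  finally show ?thesis .
qed

text \<open>Resetting the entry at \<open>Suc t\<close> to the default \<open>E0\<close> recovers
  the only history up to time \<open>t\<close> from which \<open>G\<close> can arise.\<close>

lemma pmf_traj_Suc:
  assumes E0: "E0 \<subseteq> vpairs n" and G: "\<And>s. Suc t < s \<Longrightarrow> G s = E0"
  shows "pmf (traj n p q E0 (Suc t)) G
    = pmf (traj n p q E0 t) (G(Suc t := E0)) * pmf (em_step n p q (G t)) (G (Suc t))"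
proof -
  let ?G = "G(Suc t := E0)"
  have ind: "pmf (map_pmf (\<lambda>E. G'(Suc t := E)) (em_step n p q (G' t))) G
    = indicator {?G} G' * pmf (em_step n p q (G t)) (G (Suc t))"
    if G': "G' \<in> set_pmf (traj n p q E0 t)" for G'
  proof (cases "G' = ?G")
    case True
    have "pmf (map_pmf (\<lambda>E. G'(Suc t := E)) (em_step n p q (G' t))) ((\<lambda>E. G'(Suc t := E)) (G (Suc t)))
      = pmf (em_step n p q (G' t)) (G (Suc t))"
      by (intro pmf_map_inj') (auto simp: inj_def fun_eq_iff split: if_splits)
    then show ?thesis using True by (simp add: fun_upd_idem)
  next
    case False
    have "G \<noteq> G'(Suc t := E)" for E
    proof
      assume eq: "G = G'(Suc t := E)"
      have "G' s = ?G s" for s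
        using set_pmf_traj(3)[OF E0 G', of s] by (cases "s = Suc t") (auto simp: eq)
      then show False using False by auto
    qed
    then have "G \<notin> set_pmf (map_pmf (\<lambda>E. G'(Suc t := E)) (em_step n p q (G' t)))" by auto
    then show ?thesis using False by (simp add: pmf_eq_0_set_pmf)
  qed
  have "pmf (traj n p q E0 (Suc t)) G
    = measure_pmf.expectation (traj n p q E0 t)
        (\<lambda>G'. pmf (map_pmf (\<lambda>E. G'(Suc t := E)) (em_step n p q (G' t))) G)"
    by (simp add: pmf_bind)
  also have "\<dots> = measure_pmf.expectation (traj n p q E0 t)
      (\<lambda>G'. indicator {?G} G' * pmf (em_step n p q (G t)) (G (Suc t)))"
    using ind by (intro integral_cong_AE) (auto simp: AE_measure_pmf_iff)
  also have "\<dots> = pmf (traj n p q E0 t) ?G * pmf (em_step n p q (G t)) (G (Suc t))"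
    by (simp add: measure_pmf_single)
  finally show ?thesis .
qed

section \<open>Events on path space as events of finite trajectories\<close>

lemma cylinder_in_sets:
  fixes p q :: real
  assumes "E0 \<subseteq> vpairs n"
  defines "M \<equiv> edge_markovian n p q E0"
  shows "{G \<in> space M. \<forall>s\<le>(t::nat). G s = h s} \<in> sets M"
proof -
  have sp: "space M = {G. \<forall>t. G t \<subseteq> vpairs n}"
    unfolding M_def by (rule space_edge_markovian[OF assms(1)])
  have comp: "(\<lambda>G. G s) \<in> measurable M (count_space (Pow (vpairs n)))" for s
  proof -
    have "(\<lambda>G. G s) \<in> measurable (PiM UNIV (\<lambda>_. count_space (Pow (vpairs n)))) (count_space (Pow (vpairs n)))"
      by (rule measurable_component_singleton) simp
    then show ?thesis
      by (simp add: M_def measurable_cong_sets[OF sets_edge_markovian[OF assms(1)] refl])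
  qed
  have one: "{G \<in> space M. G s = h s} \<in> sets M" for s
  proof (cases "h s \<subseteq> vpairs n")
    case True
    then have "(\<lambda>G. G s) -` {h s} \<inter> space M \<in> sets M"
      by (intro measurable_sets[OF comp]) auto
    moreover have "(\<lambda>G. G s) -` {h s} \<inter> space M = {G \<in> space M. G s = h s}" by auto
    ultimately show ?thesis by simp
  next
    case False
    then have "{G \<in> space M. G s = h s} = {}" by (auto simp: sp)
    then show ?thesis by (simp only: sets.empty_sets)
  qed
  have "(\<Inter>s\<in>{..t}. {G \<in> space M. G s = h s}) \<in> sets M"
    by (rule sets.finite_INT) (simp_all add: one)
  moreover have "(\<Inter>s\<in>{..t}. {G \<in> space M. G s = h s}) = {G \<in> space M. \<forall>s\<le>t. G s = h s}"
    by auto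
  ultimately show ?thesis by (simp only:)
qed

text \<open>Both sides obey the same recursion, \<open>edge_markovian_Markov\<close> on path space
  and \<open>pmf_traj_Suc\<close> for trajectories. At time 0 an initial graph other than
  \<open>E0\<close> has probability 0, being disjoint from an event of probability 1.\<close>

lemma measure_cylinder:
  fixes p q :: real
  assumes E0: "E0 \<subseteq> vpairs n"
  defines "M \<equiv> edge_markovian n p q E0"
  shows "measure M {G \<in> space M. \<forall>s\<le>t. G s = h s} = pmf (traj n p q E0 t) (\<lambda>s. if s \<le> t then h s else E0)"
proof (induction t)
  case 0
  interpret M: prob_space M unfolding M_def by (rule prob_space_edge_markovian[OF E0])
  have full: "measure M {G \<in> space M. G 0 = E0} = 1"
    unfolding M_def by (rule edge_markovian_initial[OF E0])
  show ?case
  proof (cases "h 0 = E0")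
    case True
    then have "(\<lambda>s. if s = 0 then h s else E0) = (\<lambda>_. E0)" by (auto simp: fun_eq_iff)
    then show ?thesis using True full by simp
  next
    case False
    have s: "{G \<in> space M. G 0 = E0} \<in> sets M" "{G \<in> space M. G 0 = h 0} \<in> sets M"
      using cylinder_in_sets[OF E0, of p q 0 "\<lambda>_. E0"] cylinder_in_sets[OF E0, of p q 0 h]
      by (auto simp: M_def)
    have "measure M ({G \<in> space M. G 0 = E0} \<union> {G \<in> space M. G 0 = h 0})
      = measure M {G \<in> space M. G 0 = E0} + measure M {G \<in> space M. G 0 = h 0}"
      using False s by (intro M.finite_measure_Union) auto
    then have "measure M {G \<in> space M. G 0 = h 0} = 0"
      using M.prob_le_1[of "{G \<in> space M. G 0 = E0} \<union> {G \<in> space M. G 0 = h 0}"] full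
        measure_nonneg[of M "{G \<in> space M. G 0 = h 0}"] by linarith
    moreover have "(\<lambda>s. if s = 0 then h s else E0) \<noteq> (\<lambda>_. E0)"
      using False by (auto simp: fun_eq_iff)
    ultimately show ?thesis by (simp add: indicator_def)
  qed
next
  case (Suc t)
  have "(\<lambda>s. if s \<le> Suc t then h s else E0)(Suc t := E0) = (\<lambda>s. if s \<le> t then h s else E0)"
    by (auto simp: fun_eq_iff)
  then show ?case
    using Suc edge_markovian_Markov[OF E0, of p q t h]
      pmf_traj_Suc[OF E0, of t "\<lambda>s. if s \<le> Suc t then h s else E0" p q]
    by (simp add: M_def)
qed

text \<open>An event determined by the graphs up to time \<open>t\<close> is a finite disjoint union
  of cylinders, one for each history in \<open>H\<close>; \<open>cut\<close> brings a path into the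
  normal form used by \<open>traj\<close>. Measurability comes along with the probability.\<close>

lemma edge_markovian_eq_traj:
  fixes p q :: real
  assumes E0: "E0 \<subseteq> vpairs n"
    and dep: "\<And>G G'. (\<And>s. s \<le> t \<Longrightarrow> G s = G' s) \<Longrightarrow> P G = P G'"
  defines "M \<equiv> edge_markovian n p q E0"
  shows "{G \<in> space M. P G} \<in> sets M"
    and "measure M {G \<in> space M. P G} = measure_pmf.prob (traj n p q E0 t) {G. P G}"
proof -
  interpret M: prob_space M unfolding M_def by (rule prob_space_edge_markovian[OF E0])
  have sp: "space M = {G. \<forall>t. G t \<subseteq> vpairs n}"
    unfolding M_def by (rule space_edge_markovian[OF E0])
  define cut where "cut = (\<lambda>G s. if s \<le> t then G s else E0)"
  define H where "H = {h. (\<forall>s. h s \<subseteq> vpairs n) \<and> cut h = h \<and> P h}"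
  define C where "C = (\<lambda>h. {G \<in> space M. \<forall>s\<le>t. G s = h s})"
  have "H \<subseteq> cut ` (\<Pi>\<^sub>E s\<in>{..t}. Pow (vpairs n))"
  proof
    fix h assume h: "h \<in> H"
    have "cut (restrict h {..t}) = cut h" by (rule ext) (simp add: cut_def)
    also have "\<dots> = h" using h by (simp add: H_def)
    finally have "h = cut (restrict h {..t})" by (rule sym)
    moreover have "restrict h {..t} \<in> (\<Pi>\<^sub>E s\<in>{..t}. Pow (vpairs n))" using h by (auto simp: H_def)
    ultimately show "h \<in> cut ` (\<Pi>\<^sub>E s\<in>{..t}. Pow (vpairs n))" by blast
  qed
  then have finH: "finite H"
    by (rule finite_subset) (auto intro!: finite_imageI finite_PiE simp: finite_vpairs)
  have Pcut: "P (cut G) = P G" for G by (rule dep) (simp add: cut_def)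
  have eqU: "{G \<in> space M. P G} = (\<Union>h\<in>H. C h)"
  proof (intro equalityI subsetI)
    fix G assume G: "G \<in> {G \<in> space M. P G}"
    have "cut (cut G) = cut G" "cut G s \<subseteq> vpairs n" for s
      using E0 G by (auto simp: cut_def sp fun_eq_iff)
    then have "cut G \<in> H" using G by (simp add: H_def Pcut)
    moreover have "G \<in> C (cut G)" using G by (auto simp: C_def cut_def)
    ultimately show "G \<in> (\<Union>h\<in>H. C h)" by blast
  next
    fix G assume "G \<in> (\<Union>h\<in>H. C h)"
    then obtain h where "h \<in> H" "G \<in> C h" by blast
    then show "G \<in> {G \<in> space M. P G}" using dep[of G h] by (auto simp: C_def H_def)
  qed
  have setsC: "C h \<in> sets M" for h unfolding C_def M_def by (rule cylinder_in_sets[OF E0])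
  show "{G \<in> space M. P G} \<in> sets M" unfolding eqU using finH setsC by auto
  have disj: "disjoint_family_on C H"
  proof (unfold disjoint_family_on_def, intro ballI impI)
    fix h h' assume hh: "h \<in> H" "h' \<in> H" "h \<noteq> h'"
    show "C h \<inter> C h' = {}"
    proof (rule ccontr)
      assume "C h \<inter> C h' \<noteq> {}"
      then have "\<forall>s\<le>t. h s = h' s" by (auto simp: C_def)
      then have "cut h = cut h'" by (auto simp: cut_def fun_eq_iff)
      then show False using hh by (auto simp: H_def)
    qed
  qed
  have "measure M {G \<in> space M. P G} = (\<Sum>h\<in>H. measure M (C h))"
    unfolding eqU using finH setsC disj by (intro M.finite_measure_finite_Union) auto
  also have "\<dots> = (\<Sum>h\<in>H. pmf (traj n p q E0 t) h)"
  proof (rule sum.cong[OF refl])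
    fix h assume "h \<in> H"
    then have "(\<lambda>s. if s \<le> t then h s else E0) = h" by (simp add: H_def cut_def)
    then show "measure M (C h) = pmf (traj n p q E0 t) h"
      using measure_cylinder[OF E0, of p q t h] by (simp add: C_def M_def)
  qed
  also have "\<dots> = measure_pmf.prob (traj n p q E0 t) H"
    by (rule measure_measure_pmf_finite[OF finH, symmetric])
  also have "\<dots> = measure_pmf.prob (traj n p q E0 t) {G. P G}"
  proof (rule measure_pmf.finite_measure_eq_AE)
    show "AE G in traj n p q E0 t. (G \<in> H) = (G \<in> {G. P G})"
    proof (unfold AE_measure_pmf_iff, intro ballI)
      fix G assume "G \<in> set_pmf (traj n p q E0 t)"
      from set_pmf_traj[OF E0 this] show "(G \<in> H) = (G \<in> {G. P G})"
        by (auto simp: H_def cut_def fun_eq_iff not_le)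
    qed
  qed auto
  finally show "measure M {G \<in> space M. P G} = measure_pmf.prob (traj n p q E0 t) {G. P G}" .
qed

text \<open>A count \<open>N\<close> whose increments are dominated by the changes within a history-dependent watched
  set \<open>R\<close> of pairs has the exponential moments of a sum of independent indicators.\<close>

lemma traj_exp_moment:
  fixes N :: "nat \<Rightarrow> (nat \<Rightarrow> graph) \<Rightarrow> nat"
  assumes E0: "E0 \<subseteq> vpairs n" and \<theta>: "0 \<le> \<theta>" and p: "0 \<le> p" "p \<le> 1" and q: "0 \<le> q" "q \<le> 1"
    and N0: "N 0 (\<lambda>_. E0) = 0"
    and NS: "\<And>t G E. N (Suc t) (G(Suc t := E)) \<le> N t G + card (R t G \<inter> edge_diff (G t) E)"
    and R: "\<And>t G. R t G \<subseteq> vpairs n"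
    and r: "\<And>t G. q * real (card (R t G \<inter> G t)) + p * real (card (R t G - G t)) \<le> r"
  shows "measure_pmf.expectation (traj n p q E0 t) (\<lambda>G. exp (\<theta> * real (N t G)))
    \<le> exp ((exp \<theta> - 1) * r * real t)"
proof (induction t)
  case 0
  show ?case by (simp add: N0)
next
  case (Suc t)
  have "measure_pmf.expectation (traj n p q E0 (Suc t)) (\<lambda>G. exp (\<theta> * real (N (Suc t) G)))
    \<le> measure_pmf.expectation (traj n p q E0 t) (\<lambda>G. exp (\<theta> * real (N t G)) * exp ((exp \<theta> - 1) * r))"
    unfolding expectation_traj_Suc
  proof (rule expectation_mono_finite[OF finite_set_pmf_traj])
    fix G assume "G \<in> set_pmf (traj n p q E0 t)"
    have "measure_pmf.expectation (em_step n p q (G t)) (\<lambda>E. exp (\<theta> * real (N (Suc t) (G(Suc t := E)))))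
      \<le> measure_pmf.expectation (em_step n p q (G t))
          (\<lambda>E. exp (\<theta> * real (N t G)) * exp (\<theta> * real (card (R t G \<inter> edge_diff (G t) E))))"
    proof (rule expectation_mono_finite[OF finite_set_pmf_em_step])
      fix E
      have "real (N (Suc t) (G(Suc t := E))) \<le> real (N t G) + real (card (R t G \<inter> edge_diff (G t) E))"
        using NS[of t G E] by linarith
      from mult_left_mono[OF this \<theta>]
      show "exp (\<theta> * real (N (Suc t) (G(Suc t := E))))
        \<le> exp (\<theta> * real (N t G)) * exp (\<theta> * real (card (R t G \<inter> edge_diff (G t) E)))"
        by (simp add: exp_add[symmetric] distrib_left)
    qed
    also have "\<dots> \<le> exp (\<theta> * real (N t G)) * exp ((exp \<theta> - 1) * r)"
      using em_step_exp_moment_le[OF R \<theta> p q r] by simp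
    finally show "measure_pmf.expectation (em_step n p q (G t)) (\<lambda>E. exp (\<theta> * real (N (Suc t) (G(Suc t := E)))))
      \<le> exp (\<theta> * real (N t G)) * exp ((exp \<theta> - 1) * r)" .
  qed
  also have "\<dots> = measure_pmf.expectation (traj n p q E0 t) (\<lambda>G. exp (\<theta> * real (N t G))) * exp ((exp \<theta> - 1) * r)"
    by simp
  also have "\<dots> \<le> exp ((exp \<theta> - 1) * r * real t) * exp ((exp \<theta> - 1) * r)"
    using Suc.IH by (rule mult_right_mono) simp
  also have "\<dots> = exp ((exp \<theta> - 1) * r * real (Suc t))"
    by (simp add: exp_add[symmetric] algebra_simps)
  finally show ?case .
qed

lemma traj_count_tail:
  fixes N :: "nat \<Rightarrow> (nat \<Rightarrow> graph) \<Rightarrow> nat"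
  assumes E0: "E0 \<subseteq> vpairs n" and \<theta>: "0 \<le> \<theta>" and p: "0 \<le> p" "p \<le> 1" and q: "0 \<le> q" "q \<le> 1"
    and N0: "N 0 (\<lambda>_. E0) = 0"
    and NS: "\<And>t G E. N (Suc t) (G(Suc t := E)) \<le> N t G + card (R t G \<inter> edge_diff (G t) E)"
    and R: "\<And>t G. R t G \<subseteq> vpairs n"
    and r: "\<And>t G. q * real (card (R t G \<inter> G t)) + p * real (card (R t G - G t)) \<le> r"
  shows "measure_pmf.prob (traj n p q E0 t) {G. y \<le> real (N t G)}
    \<le> exp ((exp \<theta> - 1) * r * real t - \<theta> * y)"
proof -
  have "measure_pmf.prob (traj n p q E0 t) {G. y \<le> real (N t G)}
    \<le> measure_pmf.expectation (traj n p q E0 t) (\<lambda>G. exp (- \<theta> * y) * exp (\<theta> * real (N t G)))"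
  proof (rule prob_le_expectation[OF finite_set_pmf_traj])
    fix G assume "y \<le> real (N t G)"
    from mult_left_mono[OF this \<theta>] show "1 \<le> exp (- \<theta> * y) * exp (\<theta> * real (N t G))"
      by (simp add: exp_add[symmetric])
  qed simp
  also have "\<dots> = exp (- \<theta> * y) * measure_pmf.expectation (traj n p q E0 t) (\<lambda>G. exp (\<theta> * real (N t G)))"
    by simp
  also have "\<dots> \<le> exp (- \<theta> * y) * exp ((exp \<theta> - 1) * r * real t)"
    by (intro mult_left_mono traj_exp_moment[where R=R] assms) simp
  also have "\<dots> = exp ((exp \<theta> - 1) * r * real t - \<theta> * y)"
    by (simp add: exp_add[symmetric] algebra_simps)
  finally show ?thesis .
qed

text \<open>An edge is watched only until its first absence, so the watched set holds no pair absent
  at time \<open>t\<close>, and its mean number of changes is at most \<open>q * card D\<close>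
  whatever the births. A reborn edge stays counted as lost, which only overstates the
  damage.\<close>

lemma prob_edges_lost:
  assumes E0: "E0 \<subseteq> vpairs n" and \<theta>: "0 \<le> \<theta>" and p: "0 \<le> p" "p \<le> 1" and q: "0 \<le> q" "q \<le> 1"
    and D: "D \<subseteq> E0"
  shows "measure_pmf.prob (traj n p q E0 t) {G. y \<le> real (card {e\<in>D. \<exists>s\<le>t. e \<notin> G s})}
    \<le> exp ((exp \<theta> - 1) * (q * real (card D)) * real t - \<theta> * y)"
proof (rule traj_count_tail[where R="\<lambda>t G. {e\<in>D. \<forall>s\<le>t. e \<in> G s}", OF E0 \<theta> p q])
  have finD: "finite D" using D E0 finite_graph finite_subset by blast
  show "card {e\<in>D. \<exists>s\<le>0::nat. e \<notin> E0} = 0"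
  proof -
    have "{e\<in>D. \<exists>s\<le>0::nat. e \<notin> E0} = {}" using D by auto
    then show ?thesis by (simp only: card.empty)
  qed
  show "{e\<in>D. \<forall>s\<le>t. e \<in> G s} \<subseteq> vpairs n" for t and G :: "nat \<Rightarrow> graph" using D E0 by auto
  show "card {e\<in>D. \<exists>s\<le>Suc t. e \<notin> (G(Suc t := E)) s}
    \<le> card {e\<in>D. \<exists>s\<le>t. e \<notin> G s} + card ({e\<in>D. \<forall>s\<le>t. e \<in> G s} \<inter> edge_diff (G t) E)"
    for t and G :: "nat \<Rightarrow> graph" and E
  proof -
    have "{e\<in>D. \<exists>s\<le>Suc t. e \<notin> (G(Suc t := E)) s}
      \<subseteq> {e\<in>D. \<exists>s\<le>t. e \<notin> G s} \<union> ({e\<in>D. \<forall>s\<le>t. e \<in> G s} \<inter> edge_diff (G t) E)"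
      by (auto split: if_splits simp: le_Suc_eq)
    from order_trans[OF card_mono[OF _ this] card_Un_le] show ?thesis using finD by simp
  qed
  show "q * real (card ({e\<in>D. \<forall>s\<le>t. e \<in> G s} \<inter> G t)) + p * real (card ({e\<in>D. \<forall>s\<le>t. e \<in> G s} - G t))
    \<le> q * real (card D)" for t and G :: "nat \<Rightarrow> graph"
  proof -
    have "{e\<in>D. \<forall>s\<le>t. e \<in> G s} - G t = {}" by auto
    then have "card ({e\<in>D. \<forall>s\<le>t. e \<in> G s} - G t) = 0" by (simp only: card.empty)
    moreover have "card ({e\<in>D. \<forall>s\<le>t. e \<in> G s} \<inter> G t) \<le> card D" using finD by (intro card_mono) auto
    ultimately show ?thesis using q by (simp add: mult_left_mono)
  qed
qed

lemma prob_edges_gained: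
  assumes E0: "E0 \<subseteq> vpairs n" and \<theta>: "0 \<le> \<theta>" and p: "0 \<le> p" "p \<le> 1" and q: "0 \<le> q" "q \<le> 1"
    and D: "D \<subseteq> vpairs n - E0"
  shows "measure_pmf.prob (traj n p q E0 t) {G. y \<le> real (card {e\<in>D. \<exists>s\<le>t. e \<in> G s})}
    \<le> exp ((exp \<theta> - 1) * (p * real (card D)) * real t - \<theta> * y)"
proof (rule traj_count_tail[where R="\<lambda>t G. {e\<in>D. \<forall>s\<le>t. e \<notin> G s}", OF E0 \<theta> p q])
  have finD: "finite D" using D finite_vpairs finite_subset by blast
  show "card {e\<in>D. \<exists>s\<le>0::nat. e \<in> E0} = 0"
  proof -
    have "{e\<in>D. \<exists>s\<le>0::nat. e \<in> E0} = {}" using D by auto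
    then show ?thesis by (simp only: card.empty)
  qed
  show "{e\<in>D. \<forall>s\<le>t. e \<notin> G s} \<subseteq> vpairs n" for t and G :: "nat \<Rightarrow> graph" using D by auto
  show "card {e\<in>D. \<exists>s\<le>Suc t. e \<in> (G(Suc t := E)) s}
    \<le> card {e\<in>D. \<exists>s\<le>t. e \<in> G s} + card ({e\<in>D. \<forall>s\<le>t. e \<notin> G s} \<inter> edge_diff (G t) E)"
    for t and G :: "nat \<Rightarrow> graph" and E
  proof -
    have "{e\<in>D. \<exists>s\<le>Suc t. e \<in> (G(Suc t := E)) s}
      \<subseteq> {e\<in>D. \<exists>s\<le>t. e \<in> G s} \<union> ({e\<in>D. \<forall>s\<le>t. e \<notin> G s} \<inter> edge_diff (G t) E)"
      by (auto split: if_splits simp: le_Suc_eq)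
    from order_trans[OF card_mono[OF _ this] card_Un_le] show ?thesis using finD by simp
  qed
  show "q * real (card ({e\<in>D. \<forall>s\<le>t. e \<notin> G s} \<inter> G t)) + p * real (card ({e\<in>D. \<forall>s\<le>t. e \<notin> G s} - G t))
    \<le> p * real (card D)" for t and G :: "nat \<Rightarrow> graph"
  proof -
    have "{e\<in>D. \<forall>s\<le>t. e \<notin> G s} \<inter> G t = {}" by auto
    then have "card ({e\<in>D. \<forall>s\<le>t. e \<notin> G s} \<inter> G t) = 0" by (simp only: card.empty)
    moreover have "card ({e\<in>D. \<forall>s\<le>t. e \<notin> G s} - G t) \<le> card D" using finD by (intro card_mono) auto
    ultimately show ?thesis using p by (simp add: mult_left_mono)
  qed
qed

text \<open>The mean number of changes in a step is controlled only while the current graph has few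
  edges. \<open>Q\<close> records this; it concerns time \<open>t\<close>, so its indicator is
  constant during the step. The rest is the exponential Markov inequality with parameter 1 and e - 1
  <= 2.\<close>

lemma prob_many_changes:
  assumes E0: "E0 \<subseteq> vpairs n" and p: "0 \<le> p" "p \<le> 1" and q: "0 \<le> q" "q \<le> 1"
    and Q: "\<And>E. Q E \<Longrightarrow> E \<subseteq> vpairs n \<Longrightarrow> q * real (card E) + p * real (card (vpairs n)) \<le> r"
  shows "measure_pmf.prob (traj n p q E0 (Suc t)) {G. Q (G t) \<and> L \<le> real (card (edge_diff (G t) (G (Suc t))))}
    \<le> exp (2 * r - L)"
proof -
  have r0: "0 \<le> r" if "Q E" "E \<subseteq> vpairs n" for E
  proof -
    have "0 \<le> q * real (card E) + p * real (card (vpairs n))" using p q by simp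
    then show ?thesis using Q[OF that] by linarith
  qed
  let ?f = "\<lambda>G. of_bool (Q (G t)) * exp (- L) * exp (1 * real (card (vpairs n \<inter> edge_diff (G t) (G (Suc t)))))"
  have "measure_pmf.prob (traj n p q E0 (Suc t)) {G. Q (G t) \<and> L \<le> real (card (edge_diff (G t) (G (Suc t))))}
    \<le> measure_pmf.expectation (traj n p q E0 (Suc t)) ?f"
  proof (rule prob_le_expectation[OF finite_set_pmf_traj])
    fix G assume G: "G \<in> set_pmf (traj n p q E0 (Suc t))"
      and L: "Q (G t) \<and> L \<le> real (card (edge_diff (G t) (G (Suc t))))"
    have "vpairs n \<inter> edge_diff (G t) (G (Suc t)) = edge_diff (G t) (G (Suc t))"
      using set_pmf_traj(2)[OF E0 G, of t] set_pmf_traj(2)[OF E0 G, of "Suc t"] by blast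
    then show "1 \<le> ?f G" using L by (simp add: exp_add[symmetric])
  qed simp
  also have "\<dots> \<le> measure_pmf.expectation (traj n p q E0 t) (\<lambda>G. exp (2 * r - L))"
    unfolding expectation_traj_Suc
  proof (rule expectation_mono_finite[OF finite_set_pmf_traj])
    fix G assume G: "G \<in> set_pmf (traj n p q E0 t)"
    show "measure_pmf.expectation (em_step n p q (G t)) (\<lambda>E. ?f (G(Suc t := E))) \<le> exp (2 * r - L)"
    proof (cases "Q (G t)")
      case True
      have Gt: "G t \<subseteq> vpairs n" by (rule set_pmf_traj(2)[OF E0 G])
      have card: "card (vpairs n \<inter> G t) = card (G t)" "card (vpairs n - G t) \<le> card (vpairs n)"
        using Gt finite_vpairs by (auto simp: Int_absorb1 intro!: card_mono)
      have rr: "q * real (card (vpairs n \<inter> G t)) + p * real (card (vpairs n - G t)) \<le> r"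
        using Q[OF True Gt] card mult_left_mono[of "real (card (vpairs n - G t))" "real (card (vpairs n))" p] p
        by simp
      have "measure_pmf.expectation (em_step n p q (G t)) (\<lambda>E. ?f (G(Suc t := E)))
        = exp (- L) * measure_pmf.expectation (em_step n p q (G t))
            (\<lambda>E. exp (1 * real (card (vpairs n \<inter> edge_diff (G t) E))))"
        using True by simp
      also have "\<dots> \<le> exp (- L) * exp ((exp 1 - 1) * r)"
        by (intro mult_left_mono em_step_exp_moment_le p q rr) auto
      also have "\<dots> \<le> exp (- L) * exp (2 * r)"
        using r0[OF True Gt] exp_le by (intro mult_left_mono) (auto intro!: mult_right_mono)
      also have "\<dots> = exp (2 * r - L)" by (simp add: exp_add[symmetric])
      finally show ?thesis .
    qed simp
  qed
  also have "\<dots> = exp (2 * r - L)" by simp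
  finally show ?thesis .
qed


section \<open>High moments of the chi-square distance\<close>

text \<open>Jensen for a convex power on the half-line, with unnormalised weights, so that total
  weight 0 is a case of its own. It moves a high power inside a sum over vertices, where each term
  is an exponential with a bounded mean.\<close>

lemma weighted_power_mean:
  fixes w r :: "'a \<Rightarrow> real"
  assumes fin: "finite I" and w: "\<And>i. i \<in> I \<Longrightarrow> 0 \<le> w i" and r: "\<And>i. i \<in> I \<Longrightarrow> 0 \<le> r i"
  shows "(\<Sum>i\<in>I. w i * r i) ^ Suc k \<le> (\<Sum>i\<in>I. w i) ^ k * (\<Sum>i\<in>I. w i * r i ^ Suc k)"
proof (cases "(\<Sum>i\<in>I. w i) = 0")
  case True
  then have "w i = 0" if "i \<in> I" for i
    using sum_nonneg_eq_0_iff[OF fin w] that by auto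
  then have "(\<Sum>i\<in>I. w i * r i) = 0" "(\<Sum>i\<in>I. w i * r i ^ Suc k) = 0" by (auto intro: sum.neutral)
  then show ?thesis by simp
next
  case False
  define W where "W = (\<Sum>i\<in>I. w i)"
  have W: "0 < W" using False sum_nonneg[OF w] by (simp add: W_def less_le)
  have conv: "convex_on {0::real..} (\<lambda>x. x ^ Suc k)"
  proof (cases "even (Suc k)")
    case True
    then show ?thesis using convex_on_subset[OF convex_power_even] by blast
  next
    case False
    then show ?thesis by (rule convex_power_odd)
  qed
  have "(\<Sum>i\<in>I. (w i / W) *\<^sub>R r i) ^ Suc k \<le> (\<Sum>i\<in>I. (w i / W) * r i ^ Suc k)"
  proof (rule convex_on_sum[OF fin _ conv])
    show "I \<noteq> {}" using W by (auto simp: W_def)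
    show "(\<Sum>i\<in>I. w i / W) = 1" using W by (simp add: sum_divide_distrib[symmetric] W_def[symmetric])
  qed (use w r W in auto)
  then have "((\<Sum>i\<in>I. w i * r i) / W) ^ Suc k \<le> (\<Sum>i\<in>I. w i * r i ^ Suc k) / W"
    by (simp add: sum_divide_distrib)
  then have "(\<Sum>i\<in>I. w i * r i) ^ Suc k / W ^ Suc k \<le> (\<Sum>i\<in>I. w i * r i ^ Suc k) / W"
    by (simp only: power_divide)
  then have "(\<Sum>i\<in>I. w i * r i) ^ Suc k \<le> (\<Sum>i\<in>I. w i * r i ^ Suc k) / W * W ^ Suc k"
    using W by (simp only: pos_divide_le_eq zero_less_power)
  also have "\<dots> = W ^ k * (\<Sum>i\<in>I. w i * r i ^ Suc k)" using W by simp
  finally show ?thesis by (simp only: W_def)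
qed

text \<open>Minkowski's inequality \<open>\<parallel>X + c\<parallel>\<^sub>k \<le> b + c\<close> for \<open>\<parallel>X\<parallel>\<^sub>k \<le> b\<close>, in a form that is linear in \<open>X\<^sup>k\<close>.\<close>

lemma power_add_le:
  fixes x b c :: real
  assumes "0 \<le> x" "0 < b" "0 < c"
  shows "(x + c) ^ Suc k \<le> (b + c) ^ k * (x ^ Suc k / b ^ k + c)"
proof -
  have "(b * (x / b) + c * 1) ^ Suc k \<le> (b + c) ^ k * (b * (x / b) ^ Suc k + c * 1 ^ Suc k)"
    using weighted_power_mean[of "{True, False}" "\<lambda>i. if i then b else c" "\<lambda>i. if i then x / b else 1" k]
      assms by simp
  moreover have "b * (x / b) ^ Suc k = x ^ Suc k / b ^ k"
    using assms by (simp add: power_divide)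
  ultimately show ?thesis using assms by simp
qed

section \<open>Conservation of mass and elementary exponential estimates\<close>

lemma sum_lazy_walk:
  assumes E: "E \<subseteq> vpairs n" and u: "u \<in> {1..n}"
  shows "(\<Sum>v\<in>{1..n}. lazy_walk E u v) = 1"
proof (cases "deg E u = 0")
  case True
  then have "(\<Sum>v\<in>{1..n}. adj E u v) = 0" using deg_eq_sum_adj[OF E, of u] by simp
  then have "adj E u v = 0" if "v \<in> {1..n}" for v
    using that by (subst (asm) sum_nonneg_eq_0_iff) (auto simp: adj_nonneg)
  then have "lazy_walk E u v = (if v = u then 1 else 0)" if "v \<in> {1..n}" for v
    using True that by (auto simp: lazy_walk_def adj_def)
  then have "(\<Sum>v\<in>{1..n}. lazy_walk E u v) = (\<Sum>v\<in>{1..n}. if v = u then 1 else 0)"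
    by (intro sum.cong refl)
  also have "\<dots> = 1" using u by simp
  finally show ?thesis .
next
  case False
  have "adj E u u = 0"
    using subsetD[OF E, of "{u, u}"] vpairs_iff[of u u n] unfolding adj_def by fastforce
  then have "lazy_walk E u v = (if v = u then 1 / 2 else 0) + adj E u v / (2 * real (deg E u))" for v
    using False by (auto simp: lazy_walk_def adj_def)
  then have "(\<Sum>v\<in>{1..n}. lazy_walk E u v)
    = (\<Sum>v\<in>{1..n}. if v = u then 1 / 2 else 0) + (\<Sum>v\<in>{1..n}. adj E u v) / (2 * real (deg E u))"
    by (simp only: sum.distrib sum_divide_distrib)
  also have "\<dots> = 1" unfolding deg_eq_sum_adj[OF E, symmetric] using u False by simp
  finally show ?thesis .
qed

lemma sum_walk_dist:
  assumes "\<And>s. G s \<subseteq> vpairs n" "x \<in> {1..n}"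
  shows "(\<Sum>y\<in>{1..n}. walk_dist n G x t y) = 1"
proof (induction t)
  case 0
  show ?case using assms(2) by simp
next
  case (Suc t)
  have "(\<Sum>y\<in>{1..n}. walk_dist n G x (Suc t) y)
    = (\<Sum>z\<in>{1..n}. \<Sum>y\<in>{1..n}. walk_dist n G x t z * lazy_walk (G (Suc t)) z y)"
    unfolding walk_dist.simps by (rule sum.swap)
  also have "\<dots> = (\<Sum>z\<in>{1..n}. walk_dist n G x t z * 1)"
    by (intro sum.cong refl) (simp only: sum_distrib_left[symmetric] sum_lazy_walk[OF assms(1)])
  finally show ?case using Suc by simp
qed

lemma walk_dist_cong:
  "(\<And>s. s \<le> t \<Longrightarrow> G s = G' s) \<Longrightarrow> walk_dist n G x t = walk_dist n G' x t"
proof (induction t)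
  case (Suc t)
  then have "walk_dist n G x t = walk_dist n G' x t" "G (Suc t) = G' (Suc t)" by auto
  then show ?case by simp
qed simp

lemma one_minus_exp_ge:
  fixes x :: real
  assumes "0 \<le> x" "x \<le> 1"
  shows "x / 2 \<le> 1 - exp (- x)"
proof -
  have "exp (- x) \<le> 1 / (1 + x)"
    using exp_ge_add_one_self[of x] assms by (simp add: exp_minus divide_simps)
  also have "\<dots> \<le> 1 - x / 2"
  proof -
    have "x * x \<le> x * 1" using assms by (intro mult_left_mono) auto
    then have "1 \<le> (1 - x / 2) * (1 + x)" by (simp add: field_simps)
    then show ?thesis using assms by (simp add: pos_divide_le_eq)
  qed
  finally show ?thesis by simp
qed

lemma exp_minus_one_le:
  fixes x :: real
  shows "exp x - 1 \<le> x * exp x"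
proof -
  have "1 - x \<le> exp (- x)" using exp_ge_add_one_self[of "- x"] by simp
  from mult_right_mono[OF this, of "exp x"] show ?thesis
    by (simp add: exp_minus algebra_simps)
qed

text \<open>Truncation to histories on which the contraction and the change-of-graph estimate apply.
  It is determined by the graphs up to \<open>t\<close> and shrinks as \<open>t\<close> grows, so
  the indicator at \<open>Suc t\<close> is at most the one at \<open>t\<close>, which can be pulled
  out of the expectation over the next step.\<close>

definition good :: "nat \<Rightarrow> real \<Rightarrow> real \<Rightarrow> real \<Rightarrow> real \<Rightarrow> nat \<Rightarrow> (nat \<Rightarrow> graph) \<Rightarrow> bool" where
  "good n \<kappa> \<Delta> h L t G \<longleftrightarrow> (\<forall>s\<le>t. nice_graph n \<kappa> \<Delta> h (G s)) \<and>
     (\<forall>s<t. real (card (edge_diff (G s) (G (Suc s)))) \<le> L)"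

text \<open>\<open>\<kappa>\<close>, \<open>\<Delta>\<close>, \<open>h\<close> are the parameters of
  \<open>nice_graph\<close>, \<open>L\<close> caps the pairs changed in one step,
  \<open>\<rho>\<close> bounds the mean number of changes at one vertex, and \<open>Suc k\<close> is
  the moment order. By \<open>noise\<close> the two multiplicative effects of a changing graph
  together consume at most half of the contraction; the inner exponential is the price of the moment
  order.\<close>

locale em_bounds =
  fixes n k :: nat and p q \<kappa> \<Delta> h L M \<rho> :: real and E0 :: graph
  assumes n: "1 \<le> n" and E0: "E0 \<subseteq> vpairs n"
    and p: "0 \<le> p" "p \<le> 1" and q: "0 \<le> q" "q \<le> 1"
    and \<kappa>: "0 < \<kappa>" and h: "0 < h" and \<Delta>: "0 < \<Delta>"
    and L: "0 < L" "L \<le> M * \<kappa>"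
    and \<rho>: "q * \<Delta> + p * real n \<le> \<rho>"
    and gap: "h\<^sup>2 / (4 * \<Delta>\<^sup>2) \<le> 1"
    and noise: "2 * L / (real n * \<kappa>) + 2 / \<kappa> * exp (2 / \<kappa> * real (Suc k)) * \<rho> \<le> h\<^sup>2 / (4 * \<Delta>\<^sup>2) / 2"
begin

definition lam :: real where "lam = h\<^sup>2 / (4 * \<Delta>\<^sup>2)"
definition eta :: real where "eta = 2 * L / (real n * \<kappa>)"
definition eta' :: real where "eta' = 2 / \<kappa> * exp (2 / \<kappa> * real (Suc k)) * \<rho>"
text \<open>A majorant for the recursion of the moment norm of chi-square. The first term starts
  from a point mass and decays at the rate left when \<open>noise\<close> takes half of
  \<open>lam\<close>; the second is the floor sustained by the additive error of each step, with the
  factor 4 coming from 1 - exp (- lam / 2) >= lam / 4.\<close>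

definition level :: "nat \<Rightarrow> real" where
  "level t = exp (- lam * real t / 2) * (real n * \<Delta> / \<kappa>) + 4 * (M + 1) * eta / lam"

lemma const_bounds: "0 < lam" "lam \<le> 1" "0 < eta" "0 \<le> \<rho>" "0 \<le> eta'" "eta + eta' \<le> lam / 2" "0 < M"
proof -
  show "0 < lam" "lam \<le> 1" using h \<Delta> gap by (auto simp: lam_def)
  show "0 < eta" using L n \<kappa> by (simp add: eta_def)
  have "0 \<le> q * \<Delta> + p * real n" using p q \<Delta> by simp
  then show "0 \<le> \<rho>" using \<rho> by linarith
  then show "0 \<le> eta'" using \<kappa> by (simp add: eta'_def)
  show "eta + eta' \<le> lam / 2" using noise by (simp add: eta_def eta'_def lam_def)
  have "0 < M * \<kappa>" using L by linarith
  then show "0 < M" using \<kappa> by (simp add: zero_less_mult_iff)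
qed

lemma level_pos: "0 < level t"
proof -
  have "0 < 4 * (M + 1) * eta / lam" using const_bounds by simp
  moreover have "0 \<le> exp (- lam * real t / 2) * (real n * \<Delta> / \<kappa>)" using \<Delta> \<kappa> by simp
  ultimately show ?thesis by (simp add: level_def)
qed

lemma level_mono: "s \<le> t \<Longrightarrow> level t \<le> level s"
  unfolding level_def
proof (intro add_right_mono mult_right_mono)
  assume "s \<le> t"
  then have "lam * real s \<le> lam * real t" using const_bounds by (intro mult_left_mono) auto
  then show "exp (- lam * real t / 2) \<le> exp (- lam * real s / 2)" by simp
qed (use \<Delta> \<kappa> in simp)

lemma level_Suc: "(1 - lam) * exp eta * (exp eta' * level t + (M + 1) * eta) \<le> level (Suc t)"
proof -
  have a: "(1 - lam) * exp eta * exp eta' \<le> exp (- lam / 2)"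
  proof -
    have "(1 - lam) * exp eta * exp eta' \<le> exp (- lam) * exp eta * exp eta'"
      using exp_ge_add_one_self[of "- lam"] by (intro mult_right_mono) auto
    also have "\<dots> = exp (- lam + eta + eta')" by (simp only: exp_add)
    also have "\<dots> \<le> exp (- lam / 2)" using const_bounds by simp
    finally show ?thesis .
  qed
  have b: "(1 - lam) * exp eta \<le> 1"
  proof -
    have "(1 - lam) * exp eta \<le> exp (- lam) * exp eta"
      using exp_ge_add_one_self[of "- lam"] by (intro mult_right_mono) auto
    also have "\<dots> = exp (- lam + eta)" by (simp only: exp_add)
    also have "\<dots> \<le> 1" using const_bounds by simp
    finally show ?thesis .
  qed
  define c where "c = (M + 1) * eta"
  have c: "0 < c" using const_bounds by (simp add: c_def)
  have "(1 - lam) * exp eta * (exp eta' * level t + c)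
    = ((1 - lam) * exp eta * exp eta') * level t + (1 - lam) * exp eta * c"
    by (simp add: algebra_simps)
  also have "\<dots> \<le> exp (- lam / 2) * level t + 1 * c"
    using a b c level_pos[of t] by (intro add_mono mult_right_mono) auto
  also have "\<dots> = exp (- lam * real (Suc t) / 2) * (real n * \<Delta> / \<kappa>) + exp (- lam / 2) * (4 * c / lam) + c"
  proof -
    have "exp (- lam * real (Suc t) / 2) = exp (- lam / 2) * exp (- lam * real t / 2)"
      unfolding exp_add[symmetric] by (simp add: field_simps)
    then show ?thesis by (simp add: level_def c_def algebra_simps)
  qed
  also have "\<dots> \<le> level (Suc t)"
  proof -
    have "lam / 4 \<le> 1 - exp (- lam / 2)" using one_minus_exp_ge[of "lam / 2"] const_bounds by simp
    then have "(4 * c / lam) * (lam / 4) \<le> (4 * c / lam) * (1 - exp (- lam / 2))"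
      using c const_bounds by (intro mult_left_mono) auto
    then have "exp (- lam / 2) * (4 * c / lam) + c \<le> 4 * c / lam"
      using const_bounds by (simp add: algebra_simps)
    moreover have "4 * (M + 1) * eta / lam = 4 * c / lam" by (simp add: c_def mult.assoc)
    ultimately show ?thesis unfolding level_def by linarith
  qed
  finally show ?thesis by (simp add: c_def)
qed

definition chi_dist :: "nat \<Rightarrow> nat \<Rightarrow> (nat \<Rightarrow> graph) \<Rightarrow> real" where
  "chi_dist x t G = chi_sq n (walk_dist n G x t) (G t)"

definition wgt :: "nat \<Rightarrow> nat \<Rightarrow> (nat \<Rightarrow> graph) \<Rightarrow> nat \<Rightarrow> real" where
  "wgt x t G y = (walk_dist n G x t y - stationary (G t) y)\<^sup>2 / stationary (G t) y"

definition distort :: "nat \<Rightarrow> nat \<Rightarrow> (nat \<Rightarrow> graph) \<Rightarrow> graph \<Rightarrow> real" where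
  "distort x t G E = (\<Sum>y\<in>{1..n}. wgt x t G y * exp (2 / \<kappa> * real (deg (edge_diff (G t) E) y)))"

lemma wgt_nonneg: "0 \<le> wgt x t G y"
  unfolding wgt_def by (intro divide_nonneg_nonneg stationary_nonneg) simp

lemma distort_nonneg: "0 \<le> distort x t G E"
  unfolding distort_def by (intro sum_nonneg mult_nonneg_nonneg wgt_nonneg) simp

lemma sum_wgt: "(\<Sum>y\<in>{1..n}. wgt x t G y) = chi_dist x t G"
  by (simp add: chi_dist_def chi_sq_def wgt_def)

lemma chi_dist_nonneg: "0 \<le> chi_dist x t G"
  by (simp add: chi_dist_def chi_sq_nonneg)

text \<open>The step to time \<open>Suc t\<close> is taken on the graph of that time. Hence the
  reference law changes first, with the distribution of the walk held fixed, and the lazy step then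
  contracts towards the new stationary law.\<close>

lemma chi_dist_Suc_le:
  assumes G: "\<And>s. G s \<subseteq> vpairs n" and x: "x \<in> {1..n}"
    and good: "good n \<kappa> \<Delta> h L (Suc t) (G(Suc t := E))"
  shows "chi_dist x (Suc t) (G(Suc t := E)) \<le> (1 - lam) * exp eta * (distort x t G E + (M + 1) * eta)"
proof -
  have nE: "nice_graph n \<kappa> \<Delta> h E" and nG: "nice_graph n \<kappa> \<Delta> h (G t)"
    and change: "real (card (edge_diff (G t) E)) \<le> L"
    using good by (auto simp: good_def dest: spec[of _ t] spec[of _ "Suc t"])
  have sum1: "(\<Sum>y\<in>{1..n}. walk_dist n G x t y) = 1" by (rule sum_walk_dist[OF G x])
  have "walk_dist n (G(Suc t := E)) x t = walk_dist n G x t" by (rule walk_dist_cong) simp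
  then have "chi_dist x (Suc t) (G(Suc t := E))
    = chi_sq n (\<lambda>y. \<Sum>z\<in>{1..n}. walk_dist n G x t z * lazy_walk E z y) E"
    by (simp add: chi_dist_def)
  also have "\<dots> \<le> (1 - lam) * chi_sq n (walk_dist n G x t) E"
    unfolding lam_def using h by (intro chi_sq_lazy_step[OF nE \<kappa> n sum1]) simp
  also have "\<dots> \<le> (1 - lam) * (exp eta * (distort x t G E + (M + 1) * eta))"
    using chi_sq_change_graph[OF nG nE \<kappa> n sum1 change L(2)] const_bounds
    by (intro mult_left_mono) (simp_all add: distort_def wgt_def eta_def)
  finally show ?thesis by simp
qed

text \<open>The weights \<open>wgt\<close> are functions of the past, so only the exponentials are
  random in this step, and Jensen reduces the power of their sum to one exponential moment per
  vertex, with parameter proportional to \<open>Suc k / \<kappa>\<close>. Averaging replaces the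
  worst number of changes at a vertex by its mean bound \<open>\<rho>\<close>, and
  \<open>exp \<theta> - 1 \<le> \<theta> * exp \<theta>\<close> turns this into a factor
  \<open>exp eta'\<close> for the norm.\<close>

lemma expectation_distort_le:
  assumes G: "\<And>s. G s \<subseteq> vpairs n" and nice: "nice_graph n \<kappa> \<Delta> h (G t)"
  shows "measure_pmf.expectation (em_step n p q (G t)) (\<lambda>E. distort x t G E ^ Suc k)
    \<le> (exp eta' * chi_dist x t G) ^ Suc k"
proof -
  define \<theta> where "\<theta> = 2 / \<kappa> * real (Suc k)"
  define A where "A = (\<lambda>y. {e \<in> vpairs n. y \<in> e})"
  have \<theta>: "0 \<le> \<theta>" using \<kappa> by (simp add: \<theta>_def)
  have one: "measure_pmf.expectation (em_step n p q (G t)) (\<lambda>E. exp (\<theta> * real (card (A y \<inter> edge_diff (G t) E))))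
    \<le> exp eta' ^ Suc k" if y: "y \<in> {1..n}" for y
  proof -
    have "A y \<inter> G t = {e \<in> G t. y \<in> e}" using G[of t] by (auto simp: A_def)
    then have 1: "real (card (A y \<inter> G t)) \<le> \<Delta>"
      using nice_deg(2)[OF nice \<kappa> n y] by (simp add: deg_def)
    have "card (A y - G t) \<le> deg (vpairs n) y"
      unfolding deg_def A_def using finite_vpairs by (intro card_mono) auto
    moreover have "real (deg (vpairs n) y) \<le> (\<Sum>v\<in>{1..n}. 1)"
      unfolding deg_eq_sum_adj[OF subset_refl] by (intro sum_mono) (simp add: adj_def)
    ultimately have 2: "real (card (A y - G t)) \<le> real n" by simp
    have "q * real (card (A y \<inter> G t)) + p * real (card (A y - G t)) \<le> q * \<Delta> + p * real n"
      using 1 2 p q by (intro add_mono mult_left_mono) auto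
    then have "q * real (card (A y \<inter> G t)) + p * real (card (A y - G t)) \<le> \<rho>" using \<rho> by linarith
    then have "measure_pmf.expectation (em_step n p q (G t)) (\<lambda>E. exp (\<theta> * real (card (A y \<inter> edge_diff (G t) E))))
      \<le> exp ((exp \<theta> - 1) * \<rho>)"
      by (intro em_step_exp_moment_le \<theta> p q) (auto simp: A_def)
    also have "\<dots> \<le> exp (\<theta> * exp \<theta> * \<rho>)"
      using mult_right_mono[OF exp_minus_one_le const_bounds(4)] by simp
    also have "\<theta> * exp \<theta> * \<rho> = real (Suc k) * eta'" by (simp only: \<theta>_def eta'_def mult_ac)
    also have "exp \<dots> = exp eta' ^ Suc k" by (rule exp_of_nat_mult)
    finally show ?thesis .
  qed
  have "measure_pmf.expectation (em_step n p q (G t)) (\<lambda>E. distort x t G E ^ Suc k)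
    \<le> measure_pmf.expectation (em_step n p q (G t)) (\<lambda>E. chi_dist x t G ^ k *
        (\<Sum>y\<in>{1..n}. wgt x t G y * exp (\<theta> * real (card (A y \<inter> edge_diff (G t) E)))))"
  proof (rule expectation_mono_finite[OF finite_set_pmf_em_step])
    fix E assume "E \<in> set_pmf (em_step n p q (G t))"
    then have E: "E \<subseteq> vpairs n" using set_pmf_em_step by blast
    have "distort x t G E ^ Suc k \<le> (\<Sum>y\<in>{1..n}. wgt x t G y) ^ k *
      (\<Sum>y\<in>{1..n}. wgt x t G y * exp (2 / \<kappa> * real (deg (edge_diff (G t) E) y)) ^ Suc k)"
      unfolding distort_def by (rule weighted_power_mean) (auto simp: wgt_nonneg)
    also have "(\<Sum>y\<in>{1..n}. wgt x t G y * exp (2 / \<kappa> * real (deg (edge_diff (G t) E) y)) ^ Suc k)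
      = (\<Sum>y\<in>{1..n}. wgt x t G y * exp (\<theta> * real (card (A y \<inter> edge_diff (G t) E))))"
    proof (intro sum.cong refl arg_cong2[where f="(*)"])
      fix y
      have "{e \<in> edge_diff (G t) E. y \<in> e} = A y \<inter> edge_diff (G t) E"
        using E G[of t] by (auto simp: A_def)
      then have "deg (edge_diff (G t) E) y = card (A y \<inter> edge_diff (G t) E)" by (simp only: deg_def)
      then show "exp (2 / \<kappa> * real (deg (edge_diff (G t) E) y)) ^ Suc k
        = exp (\<theta> * real (card (A y \<inter> edge_diff (G t) E)))"
        by (simp only: exp_of_nat_mult[symmetric] \<theta>_def mult_ac)
    qed
    finally show "distort x t G E ^ Suc k \<le> chi_dist x t G ^ k *
        (\<Sum>y\<in>{1..n}. wgt x t G y * exp (\<theta> * real (card (A y \<inter> edge_diff (G t) E))))"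
      by (simp only: sum_wgt)
  qed
  also have "\<dots> = chi_dist x t G ^ k * (\<Sum>y\<in>{1..n}. wgt x t G y *
      measure_pmf.expectation (em_step n p q (G t)) (\<lambda>E. exp (\<theta> * real (card (A y \<inter> edge_diff (G t) E)))))"
    by (simp add: integrable_measure_pmf_finite[OF finite_set_pmf_em_step])
  also have "\<dots> \<le> chi_dist x t G ^ k * (\<Sum>y\<in>{1..n}. wgt x t G y * exp eta' ^ Suc k)"
    using one by (intro mult_left_mono sum_mono wgt_nonneg zero_le_power chi_dist_nonneg)
  also have "\<dots> = chi_dist x t G ^ k * (chi_dist x t G * exp eta' ^ Suc k)"
    by (simp only: sum_distrib_right[symmetric] sum_wgt)
  also have "\<dots> = (exp eta' * chi_dist x t G) ^ Suc k"
    by (simp add: power_mult_distrib)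
  finally show ?thesis .
qed

lemma expectation_chi_dist_le:
  assumes x: "x \<in> {1..n}"
  shows "measure_pmf.expectation (traj n p q E0 t)
    (\<lambda>G. of_bool (good n \<kappa> \<Delta> h L t G) * chi_dist x t G ^ Suc k) \<le> level t ^ Suc k"
proof (induction t)
  case 0
  show ?case
  proof (cases "good n \<kappa> \<Delta> h L 0 (\<lambda>_. E0)")
    case True
    then have "nice_graph n \<kappa> \<Delta> h E0" by (simp add: good_def)
    from chi_sq_point_mass[OF this \<kappa> n x] have "chi_dist x 0 (\<lambda>_. E0) \<le> real n * \<Delta> / \<kappa>"
      by (simp add: chi_dist_def)
    also have "\<dots> \<le> level 0" using const_bounds by (simp add: level_def)
    finally show ?thesis
      using True chi_dist_nonneg by (simp del: power_Suc add: power_mono)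
  next
    case False
    then show ?thesis using level_pos[of 0] by (simp del: power_Suc add: less_imp_le)
  qed
next
  case (Suc t)
  \<comment> \<open>\<open>b\<close> and \<open>c\<close> bound the norms of the distorted distance
    and of the additive error. With \<open>b\<close> tuned to the induction hypothesis, the linear
    form of Minkowski in \<open>power_add_le\<close> closes up: after taking expectations its first
    summand is at most \<open>b\<close>, and the whole bound is
    \<open>(a * (b + c)) ^ Suc k\<close>.\<close>
  define b where "b = exp eta' * level t"
  define c where "c = (M + 1) * eta"
  define a where "a = (1 - lam) * exp eta"
  have bc: "0 < b" "0 < c" using level_pos const_bounds by (simp_all add: b_def c_def)
  have a: "0 \<le> a" using const_bounds by (simp add: a_def)
  let ?g = "\<lambda>G. of_bool (good n \<kappa> \<Delta> h L t G) :: real"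
  have "measure_pmf.expectation (traj n p q E0 (Suc t))
      (\<lambda>G. of_bool (good n \<kappa> \<Delta> h L (Suc t) G) * chi_dist x (Suc t) G ^ Suc k)
    \<le> measure_pmf.expectation (traj n p q E0 t) (\<lambda>G. a ^ Suc k * (b + c) ^ k *
        (exp eta' ^ Suc k / b ^ k * (?g G * chi_dist x t G ^ Suc k) + c))"
    unfolding expectation_traj_Suc
  proof (rule expectation_mono_finite[OF finite_set_pmf_traj])
    fix G assume "G \<in> set_pmf (traj n p q E0 t)"
    then have G: "G s \<subseteq> vpairs n" for s using set_pmf_traj(2)[OF E0] by blast
    have "measure_pmf.expectation (em_step n p q (G t)) (\<lambda>E.
        of_bool (good n \<kappa> \<Delta> h L (Suc t) (G(Suc t := E))) * chi_dist x (Suc t) (G(Suc t := E)) ^ Suc k)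
      \<le> measure_pmf.expectation (em_step n p q (G t)) (\<lambda>E.
          ?g G * (a ^ Suc k * (b + c) ^ k * (distort x t G E ^ Suc k / b ^ k + c)))"
    proof (rule expectation_mono_finite[OF finite_set_pmf_em_step])
      fix E
      show "of_bool (good n \<kappa> \<Delta> h L (Suc t) (G(Suc t := E))) * chi_dist x (Suc t) (G(Suc t := E)) ^ Suc k
        \<le> ?g G * (a ^ Suc k * (b + c) ^ k * (distort x t G E ^ Suc k / b ^ k + c))"
      proof (cases "good n \<kappa> \<Delta> h L (Suc t) (G(Suc t := E))")
        case True
        then have g: "good n \<kappa> \<Delta> h L t G"
          unfolding good_def by (auto split: if_splits dest: spec) (metis Suc_n_not_le_n le_SucI less_SucI less_Suc_eq_le nat_neq_iff)+
        have "chi_dist x (Suc t) (G(Suc t := E)) ^ Suc k \<le> (a * (distort x t G E + c)) ^ Suc k"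
          using chi_dist_Suc_le[OF G x True] chi_dist_nonneg by (intro power_mono) (simp_all add: a_def c_def)
        also have "\<dots> = a ^ Suc k * (distort x t G E + c) ^ Suc k" by (rule power_mult_distrib)
        also have "\<dots> \<le> a ^ Suc k * ((b + c) ^ k * (distort x t G E ^ Suc k / b ^ k + c))"
          using a by (intro mult_left_mono power_add_le distort_nonneg bc zero_le_power)
        finally show ?thesis using True g by (simp only: of_bool_eq mult_1 mult.assoc)
      next
        case False
        have "0 \<le> ?g G * (a ^ Suc k * (b + c) ^ k * (distort x t G E ^ Suc k / b ^ k + c))"
          using a bc distort_nonneg[of x t G E]
          by (intro mult_nonneg_nonneg add_nonneg_nonneg divide_nonneg_nonneg zero_le_power) auto
        then show ?thesis using False by (simp only: of_bool_eq mult_zero_left)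
      qed
    qed
    also have "\<dots> = ?g G * (a ^ Suc k * (b + c) ^ k *
        (measure_pmf.expectation (em_step n p q (G t)) (\<lambda>E. distort x t G E ^ Suc k) / b ^ k + c))"
      by (simp add: integrable_measure_pmf_finite[OF finite_set_pmf_em_step] del: power_Suc)
    also have "\<dots> \<le> a ^ Suc k * (b + c) ^ k * (exp eta' ^ Suc k / b ^ k * (?g G * chi_dist x t G ^ Suc k) + c)"
    proof (cases "good n \<kappa> \<Delta> h L t G")
      case True
      then have nice: "nice_graph n \<kappa> \<Delta> h (G t)" by (simp add: good_def)
      have "measure_pmf.expectation (em_step n p q (G t)) (\<lambda>E. distort x t G E ^ Suc k) / b ^ k
        \<le> (exp eta' * chi_dist x t G) ^ Suc k / b ^ k"
        using expectation_distort_le[where G=G and t=t and x=x, OF G nice] bc by (intro divide_right_mono zero_le_power) auto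
      also have "\<dots> = exp eta' ^ Suc k / b ^ k * chi_dist x t G ^ Suc k"
        by (simp add: power_mult_distrib del: power_Suc)
      finally have "a ^ Suc k * (b + c) ^ k *
          (measure_pmf.expectation (em_step n p q (G t)) (\<lambda>E. distort x t G E ^ Suc k) / b ^ k + c)
        \<le> a ^ Suc k * (b + c) ^ k * (exp eta' ^ Suc k / b ^ k * chi_dist x t G ^ Suc k + c)"
        using a bc by (intro mult_left_mono add_right_mono mult_nonneg_nonneg zero_le_power) auto
      then show ?thesis using True by (simp only: of_bool_eq mult_1)
    next
      case False
      then show ?thesis using a bc by (simp del: power_Suc)
    qed
    finally show "measure_pmf.expectation (em_step n p q (G t)) (\<lambda>E.
        of_bool (good n \<kappa> \<Delta> h L (Suc t) (G(Suc t := E))) * chi_dist x (Suc t) (G(Suc t := E)) ^ Suc k)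
      \<le> a ^ Suc k * (b + c) ^ k * (exp eta' ^ Suc k / b ^ k * (?g G * chi_dist x t G ^ Suc k) + c)" .
  qed
  also have "\<dots> = a ^ Suc k * (b + c) ^ k * (exp eta' ^ Suc k / b ^ k *
      measure_pmf.expectation (traj n p q E0 t) (\<lambda>G. ?g G * chi_dist x t G ^ Suc k) + c)"
    by (simp add: integrable_measure_pmf_finite[OF finite_set_pmf_traj] del: power_Suc)
  also have "\<dots> \<le> a ^ Suc k * (b + c) ^ k * (exp eta' ^ Suc k / b ^ k * level t ^ Suc k + c)"
    using a bc by (intro mult_left_mono add_right_mono Suc.IH divide_nonneg_nonneg mult_nonneg_nonneg zero_le_power) auto
  also have "exp eta' ^ Suc k / b ^ k * level t ^ Suc k = b"
    using bc by (simp add: b_def power_mult_distrib)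
  also have "a ^ Suc k * (b + c) ^ k * (b + c) = (a * (b + c)) ^ Suc k"
    by (simp add: power_mult_distrib)
  also have "\<dots> \<le> level (Suc t) ^ Suc k"
    using level_Suc[of t] a bc by (intro power_mono) (simp_all add: a_def b_def c_def)
  finally show ?case .
qed

lemma prob_chi_dist_ge:
  assumes x: "x \<in> {1..n}" and y: "0 < y"
  shows "measure_pmf.prob (traj n p q E0 t) {G. good n \<kappa> \<Delta> h L t G \<and> y \<le> chi_dist x t G}
    \<le> (level t / y) ^ Suc k"
proof -
  have "measure_pmf.prob (traj n p q E0 t) {G. good n \<kappa> \<Delta> h L t G \<and> y \<le> chi_dist x t G}
    \<le> measure_pmf.expectation (traj n p q E0 t)
        (\<lambda>G. of_bool (good n \<kappa> \<Delta> h L t G) * chi_dist x t G ^ Suc k / y ^ Suc k)"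
  proof (rule prob_le_expectation[OF finite_set_pmf_traj])
    fix G assume "good n \<kappa> \<Delta> h L t G \<and> y \<le> chi_dist x t G"
    then show "1 \<le> of_bool (good n \<kappa> \<Delta> h L t G) * chi_dist x t G ^ Suc k / y ^ Suc k"
      using y power_mono[of y "chi_dist x t G" "Suc k"] by (simp del: power_Suc)
  qed (use y chi_dist_nonneg in \<open>auto simp del: power_Suc\<close>)
  also have "\<dots> \<le> level t ^ Suc k / y ^ Suc k"
    using expectation_chi_dist_le[OF x, of t] y by (simp del: power_Suc add: divide_right_mono)
  finally show ?thesis by (simp only: power_divide)
qed

end


section \<open>The mixing time for fixed parameters\<close>

text \<open>Used to sum failure bounds that are geometric in the size of the cut set over all sets
  at once.\<close>

lemma sum_power_card_Pow:
  fixes \<delta> :: real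
  assumes "finite A"
  shows "(\<Sum>S\<in>Pow A. \<delta> ^ card S) = (1 + \<delta>) ^ card A"
  using assms
proof (induction A)
  case (insert a A)
  have "inj_on (insert a) (Pow A)" using insert.hyps by (auto simp: inj_on_def)
  then have "(\<Sum>S\<in>insert a ` Pow A. \<delta> ^ card S) = (\<Sum>S\<in>Pow A. \<delta> ^ card (insert a S))"
    by (simp add: sum.reindex)
  also have "\<dots> = (\<Sum>S\<in>Pow A. \<delta> * \<delta> ^ card S)"
  proof (rule sum.cong[OF refl])
    fix S assume "S \<in> Pow A"
    then have "finite S" "a \<notin> S" using insert.hyps finite_subset by auto
    then show "\<delta> ^ card (insert a S) = \<delta> * \<delta> ^ card S" by simp
  qed
  finally have "(\<Sum>S\<in>insert a ` Pow A. \<delta> ^ card S) = \<delta> * (1 + \<delta>) ^ card A"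
    by (simp add: sum_distrib_left[symmetric] insert.IH)
  moreover have "Pow A \<inter> insert a ` Pow A = {}" using insert.hyps by auto
  ultimately show ?case
    using insert.hyps by (simp add: Pow_insert sum.union_disjoint insert.IH algebra_simps)
qed simp

text \<open>Through this the survival of cuts includes the survival of degrees, and the lower degree
  bound needs no union bound of its own.\<close>

lemma card_edge_cut_singleton:
  assumes E: "E \<subseteq> vpairs n" and x: "x \<in> {1..n}"
  shows "card (edge_cut n E {x}) = deg E x"
proof -
  have "edge_cut n E {x} = {e \<in> E. x \<in> e}"
  proof (intro equalityI subsetI)
    fix e assume e: "e \<in> {e \<in> E. x \<in> e}"
    then obtain u v where uv: "e = {u, v}" "u \<in> {1..n}" "v \<in> {1..n}" "u \<noteq> v"
      using E by (auto simp: vpairs_def)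
    then obtain w where "e = {x, w}" "w \<in> {1..n} - {x}"
      using e by (cases "x = u") blast+
    then show "e \<in> edge_cut n E {x}" using e by (auto simp: edge_cut_def)
  qed (auto simp: edge_cut_def)
  then show ?thesis by (simp add: deg_def)
qed

lemma card_vpairs_le: "real (card (vpairs n)) \<le> real n * real n"
proof -
  have "vpairs n \<subseteq> (\<lambda>(u, v). {u, v}) ` ({1..n} \<times> {1..n})" by (auto simp: vpairs_def)
  then have "card (vpairs n) \<le> card ((\<lambda>(u, v). {u, v}) ` ({1..n} \<times> {1..n}))"
    by (intro card_mono) auto
  also have "\<dots> \<le> n * n"
    using card_image_le[of "{1..n} \<times> {1..n}" "\<lambda>(u, v). {u, v}"] by simp
  finally show ?thesis by (metis of_nat_le_iff of_nat_mult)
qed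

lemma Inf_enat_image_le_iff: "Inf (enat ` A) \<le> enat T \<longleftrightarrow> (\<exists>t\<in>A. t \<le> T)"
proof
  assume le: "Inf (enat ` A) \<le> enat T"
  then have "A \<noteq> {}" by (auto simp: Inf_enat_def)
  then have "Inf (enat ` A) \<in> enat ` A"
    unfolding Inf_enat_def by (auto intro: LeastI)
  then show "\<exists>t\<in>A. t \<le> T" using le by auto
next
  assume "\<exists>t\<in>A. t \<le> T"
  then show "Inf (enat ` A) \<le> enat T" by (meson Inf_lower2 enat_ord_simps(1) imageI)
qed

definition mixed :: "nat \<Rightarrow> real \<Rightarrow> (nat \<Rightarrow> graph) \<Rightarrow> nat \<Rightarrow> bool" where
  "mixed n \<epsilon> G s \<longleftrightarrow> (\<forall>x\<in>{1..n}. G s \<noteq> {} \<and> tv_dist n (walk_dist n G x s) (stationary (G s)) \<le> \<epsilon>)"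

lemma mixing_time_le_iff:
  "mixing_time n G \<epsilon> \<le> enat T \<longleftrightarrow>
    (\<exists>t\<le>T. \<forall>s. t \<le> s \<and> real s \<le> real t + sqrt (real n) \<longrightarrow> mixed n \<epsilon> G s)"
  unfolding mixing_time_def Inf_enat_image_le_iff mixed_def by blast

lemma mixed_cong: "(\<And>r. r \<le> s \<Longrightarrow> G r = G' r) \<Longrightarrow> mixed n \<epsilon> G s = mixed n \<epsilon> G' s"
  using walk_dist_cong[of s G G' n] by (simp add: mixed_def)

section \<open>Union bounds for the failure events\<close>

context em_bounds
begin

abbreviation EM :: "(nat \<Rightarrow> graph) measure" where "EM \<equiv> edge_markovian n p q E0"

text \<open>The initial graph has twice the required expansion and lower degree. Unless some cut
  loses half of its edges or some vertex gains \<open>g\<close> of them, every graph up to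
  \<open>T\<close> is nice. The sum over cuts stays small because the bound
  \<open>\<delta> ^ card S\<close> improves with the size of \<open>S\<close>, against the growing
  number of sets of that size.\<close>

lemma prob_not_nice:
  assumes n2: "2 \<le> n" and \<theta>: "0 \<le> \<theta>" and \<delta>: "0 \<le> \<delta>"
    and deg0: "\<And>x. x \<in> {1..n} \<Longrightarrow> 2 * \<kappa> \<le> real (deg E0 x)"
      "\<And>x. x \<in> {1..n} \<Longrightarrow> real (deg E0 x) + g \<le> \<Delta>"
    and cut0: "\<And>S. S \<subseteq> {1..n} \<Longrightarrow> S \<noteq> {} \<Longrightarrow> 2 * card S \<le> n \<Longrightarrow>
      2 * h * real (card S) \<le> real (card (edge_cut n E0 S))"
    and lost: "\<And>S. S \<subseteq> {1..n} \<Longrightarrow> S \<noteq> {} \<Longrightarrow> 2 * card S \<le> n \<Longrightarrow>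
      exp ((exp \<theta> - 1) * (q * real (card (edge_cut n E0 S))) * real T
        - \<theta> * (real (card (edge_cut n E0 S)) / 2)) \<le> \<delta> ^ card S"
  shows "measure EM {G \<in> space EM. \<not> (\<forall>s\<le>T. nice_graph n \<kappa> \<Delta> h (G s))}
    \<le> (1 + \<delta>) ^ n - 1 + real n * exp (2 * p * real n * real T - g)"
proof -
  interpret M: prob_space EM by (rule prob_space_edge_markovian[OF E0])
  have sp: "space EM = {G. \<forall>t. G t \<subseteq> vpairs n}" by (rule space_edge_markovian[OF E0])
  define \<S> where "\<S> = {S. S \<subseteq> {1..n} \<and> S \<noteq> {} \<and> 2 * card S \<le> n}"
  define C where "C = edge_cut n E0"
  define lostN where "lostN = (\<lambda>S (G :: nat \<Rightarrow> graph). card {e\<in>C S. \<exists>s\<le>T. e \<notin> G s})"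
  define X where "X = (\<lambda>x. {e \<in> vpairs n - E0. x \<in> e})"
  define gainN where "gainN = (\<lambda>x (G :: nat \<Rightarrow> graph). card {e\<in>X x. \<exists>s\<le>T. e \<in> G s})"
  define A where "A = (\<lambda>S. {G \<in> space EM. real (card (C S)) / 2 \<le> real (lostN S G)})"
  define B where "B = (\<lambda>x. {G \<in> space EM. g \<le> real (gainN x G)})"
  have fin\<S>: "finite \<S>" unfolding \<S>_def by (rule finite_subset[of _ "Pow {1..n}"]) auto
  have CE: "C S \<subseteq> E0" for S by (auto simp: C_def edge_cut_def)
  have A: "A S \<in> sets EM" "measure EM (A S) \<le> \<delta> ^ card S" if S: "S \<in> \<S>" for S
  proof -
    have dep: "(real (card (C S)) / 2 \<le> real (lostN S G)) = (real (card (C S)) / 2 \<le> real (lostN S G'))"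
      if "\<And>s. s \<le> T \<Longrightarrow> G s = G' s" for G G'
    proof -
      have "{e\<in>C S. \<exists>s\<le>T. e \<notin> G s} = {e\<in>C S. \<exists>s\<le>T. e \<notin> G' s}" using that by auto
      then show ?thesis by (simp add: lostN_def)
    qed
    show "A S \<in> sets EM" unfolding A_def by (rule edge_markovian_eq_traj(1)[OF E0 dep])
    have "measure EM (A S) = measure_pmf.prob (traj n p q E0 T) {G. real (card (C S)) / 2 \<le> real (lostN S G)}"
      unfolding A_def by (rule edge_markovian_eq_traj(2)[OF E0 dep])
    also have "\<dots> \<le> exp ((exp \<theta> - 1) * (q * real (card (C S))) * real T - \<theta> * (real (card (C S)) / 2))"
      unfolding lostN_def by (rule prob_edges_lost[OF E0 \<theta> p q CE])
    also have "\<dots> \<le> \<delta> ^ card S" using lost[of S] S by (simp add: \<S>_def C_def)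
    finally show "measure EM (A S) \<le> \<delta> ^ card S" .
  qed
  have B: "B x \<in> sets EM" "measure EM (B x) \<le> exp (2 * p * real n * real T - g)" if x: "x \<in> {1..n}" for x
  proof -
    have dep: "(g \<le> real (gainN x G)) = (g \<le> real (gainN x G'))"
      if "\<And>s. s \<le> T \<Longrightarrow> G s = G' s" for G G'
    proof -
      have "{e\<in>X x. \<exists>s\<le>T. e \<in> G s} = {e\<in>X x. \<exists>s\<le>T. e \<in> G' s}" using that by auto
      then show ?thesis by (simp add: gainN_def)
    qed
    show "B x \<in> sets EM" unfolding B_def by (rule edge_markovian_eq_traj(1)[OF E0 dep])
    have "card (X x) \<le> deg (vpairs n) x"
      unfolding deg_def X_def using finite_vpairs by (intro card_mono) auto
    moreover have "real (deg (vpairs n) x) \<le> (\<Sum>v\<in>{1..n}. 1)"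
      unfolding deg_eq_sum_adj[OF subset_refl] by (intro sum_mono) (simp add: adj_def)
    ultimately have cX: "real (card (X x)) \<le> real n" by simp
    have "measure EM (B x) = measure_pmf.prob (traj n p q E0 T) {G. g \<le> real (gainN x G)}"
      unfolding B_def by (rule edge_markovian_eq_traj(2)[OF E0 dep])
    also have "\<dots> \<le> exp ((exp 1 - 1) * (p * real (card (X x))) * real T - 1 * g)"
      unfolding gainN_def by (rule prob_edges_gained[OF E0 _ p q]) (auto simp: X_def)
    also have "\<dots> \<le> exp (2 * p * real n * real T - g)"
    proof -
      have "(exp 1 - 1) * (p * real (card (X x))) * real T \<le> 2 * (p * real n) * real T"
        using exp_le p cX by (intro mult_right_mono mult_mono mult_left_mono) auto
      then show ?thesis by simp
    qed
    finally show "measure EM (B x) \<le> exp (2 * p * real n * real T - g)" .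
  qed
  have sub: "{G \<in> space EM. \<not> (\<forall>s\<le>T. nice_graph n \<kappa> \<Delta> h (G s))} \<subseteq> (\<Union>S\<in>\<S>. A S) \<union> (\<Union>x\<in>{1..n}. B x)"
  proof (rule subsetI, rule ccontr)
    fix G assume G: "G \<in> {G \<in> space EM. \<not> (\<forall>s\<le>T. nice_graph n \<kappa> \<Delta> h (G s))}"
      and notin: "G \<notin> (\<Union>S\<in>\<S>. A S) \<union> (\<Union>x\<in>{1..n}. B x)"
    have Gs: "G s \<subseteq> vpairs n" for s using G by (simp add: sp)
    have cut: "real (card (edge_cut n E0 S)) / 2 \<le> real (card (edge_cut n (G s) S))"
      if S: "S \<in> \<S>" and s: "s \<le> T" for S s
    proof -
      have "G \<notin> A S" using notin S by blast
      then have l: "real (lostN S G) < real (card (C S)) / 2" using G by (simp add: A_def not_le)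
      have "C S \<subseteq> edge_cut n (G s) S \<union> {e\<in>C S. \<exists>s\<le>T. e \<notin> G s}"
        using s by (auto simp: C_def edge_cut_def)
      moreover have "finite (C S)" "finite (edge_cut n (G s) S)"
        using finite_subset[OF CE finite_graph[OF E0]] finite_graph[OF Gs] by (auto simp: edge_cut_def)
      ultimately have "card (C S) \<le> card (edge_cut n (G s) S) + lostN S G"
        unfolding lostN_def by (intro order_trans[OF card_mono card_Un_le]) auto
      then show ?thesis using l by (simp add: C_def)
    qed
    have "nice_graph n \<kappa> \<Delta> h (G s)" if s: "s \<le> T" for s
      unfolding nice_graph_def
    proof (intro conjI ballI allI impI Gs)
      fix x assume x: "x \<in> {1..n}"
      \<comment> \<open>This is where 2 <= n matters: a singleton must have at most half of the
        vertices.\<close>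
      have "{x} \<in> \<S>" using x n2 by (auto simp: \<S>_def)
      from cut[OF this s] deg0(1)[OF x] show "\<kappa> \<le> real (deg (G s) x)"
        by (simp add: card_edge_cut_singleton[OF E0 x] card_edge_cut_singleton[OF Gs x])
      have "G \<notin> B x" using notin x by blast
      then have gx: "real (gainN x G) < g" using G by (simp add: B_def not_le)
      have "{e\<in>G s. x \<in> e} \<subseteq> {e\<in>E0. x \<in> e} \<union> {e\<in>X x. \<exists>s\<le>T. e \<in> G s}"
        using s Gs[of s] by (auto simp: X_def)
      moreover have "finite {e\<in>E0. x \<in> e}" "finite (X x)"
        using finite_graph[OF E0] finite_vpairs by (auto simp: X_def)
      ultimately have "deg (G s) x \<le> deg E0 x + gainN x G"
        unfolding deg_def gainN_def by (intro order_trans[OF card_mono card_Un_le]) auto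
      then show "real (deg (G s) x) \<le> \<Delta>" using gx deg0(2)[OF x] by linarith
    next
      fix S assume "S \<subseteq> {1..n}" "S \<noteq> {}" "2 * card S \<le> n"
      then show "h * real (card S) \<le> real (card (edge_cut n (G s) S))"
        using cut[of S s] cut0[of S] s by (simp add: \<S>_def)
    qed
    then show False using G by blast
  qed
  have "measure EM {G \<in> space EM. \<not> (\<forall>s\<le>T. nice_graph n \<kappa> \<Delta> h (G s))}
    \<le> measure EM ((\<Union>S\<in>\<S>. A S) \<union> (\<Union>x\<in>{1..n}. B x))"
    using fin\<S> A(1) B(1) by (intro M.finite_measure_mono[OF sub] sets.Un sets.finite_UN) auto
  also have "\<dots> \<le> measure EM (\<Union>S\<in>\<S>. A S) + measure EM (\<Union>x\<in>{1..n}. B x)"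
    using fin\<S> A(1) B(1) by (intro measure_Un_le sets.finite_UN) auto
  also have "\<dots> \<le> (\<Sum>S\<in>\<S>. measure EM (A S)) + (\<Sum>x\<in>{1..n}. measure EM (B x))"
    using fin\<S> A(1) B(1) by (intro add_mono M.finite_measure_subadditive_finite) auto
  also have "\<dots> \<le> (\<Sum>S\<in>\<S>. \<delta> ^ card S) + (\<Sum>x\<in>{1..n}. exp (2 * p * real n * real T - g))"
    by (intro add_mono sum_mono A(2) B(2))
  also have "(\<Sum>S\<in>\<S>. \<delta> ^ card S) \<le> (\<Sum>S\<in>Pow {1..n} - {{}}. \<delta> ^ card S)"
    using \<delta> by (intro sum_mono2) (auto simp: \<S>_def)
  also have "\<dots> = (1 + \<delta>) ^ n - 1"
    using sum_power_card_Pow[of "{1..n}" \<delta>] by (simp add: sum_diff1)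
  finally show ?thesis by simp
qed

text \<open>Failure has three sources: a graph that is not nice, a step with too many changes out of
  a nice graph, or a large chi-square on a history that is still good. The first costs
  \<open>\<xi>\<close> for all times together, the second a union over steps, the third a union over
  starting vertices and window times.\<close>

lemma prob_not_mixed:
  assumes \<epsilon>: "0 < \<epsilon>" and TT': "T \<le> T'"
    and nn: "measure EM {G \<in> space EM. \<not> (\<forall>s\<le>T'. nice_graph n \<kappa> \<Delta> h (G s))} \<le> \<xi>"
  shows "measure EM {G \<in> space EM. \<not> (\<forall>s\<in>{T..T'}. mixed n \<epsilon> G s)}
    \<le> \<xi> + real T' * exp (2 * (real n * \<rho>) - L)
      + real n * (real (card {T..T'}) * (level T / \<epsilon>\<^sup>2) ^ Suc k)"
proof -
  interpret M: prob_space EM by (rule prob_space_edge_markovian[OF E0])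
  have sp: "space EM = {G. \<forall>t. G t \<subseteq> vpairs n}" by (rule space_edge_markovian[OF E0])
  define N where "N = {G \<in> space EM. \<not> (\<forall>s\<le>T'. nice_graph n \<kappa> \<Delta> h (G s))}"
  define B where "B = (\<lambda>s. {G \<in> space EM. nice_graph n \<kappa> \<Delta> h (G s) \<and>
      L \<le> real (card (edge_diff (G s) (G (Suc s))))})"
  define C where "C = (\<lambda>x s. {G \<in> space EM. good n \<kappa> \<Delta> h L s G \<and> \<epsilon>\<^sup>2 \<le> chi_dist x s G})"
  have Nsets: "N \<in> sets EM" unfolding N_def by (rule edge_markovian_eq_traj(1)[OF E0, of T']) auto
  have B: "B s \<in> sets EM" "measure EM (B s) \<le> exp (2 * (real n * \<rho>) - L)" for s
  proof -
    show "B s \<in> sets EM" unfolding B_def by (rule edge_markovian_eq_traj(1)[OF E0, of "Suc s"]) auto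
    have "measure EM (B s) = measure_pmf.prob (traj n p q E0 (Suc s)) {G. nice_graph n \<kappa> \<Delta> h (G s) \<and>
      L \<le> real (card (edge_diff (G s) (G (Suc s))))}"
      unfolding B_def by (rule edge_markovian_eq_traj(2)[OF E0]) auto
    also have "\<dots> \<le> exp (2 * (real n * \<rho>) - L)"
    proof (rule prob_many_changes[OF E0 p q])
      fix E assume nE: "nice_graph n \<kappa> \<Delta> h E"
      have "q * real (card E) \<le> q * (real n * \<Delta>)"
        using nice_card(2)[OF nE \<kappa> n] q by (intro mult_left_mono) auto
      moreover have "p * real (card (vpairs n)) \<le> p * (real n * real n)"
        using card_vpairs_le p by (intro mult_left_mono)
      moreover have "real n * (q * \<Delta> + p * real n) \<le> real n * \<rho>"
        using \<rho> by (intro mult_left_mono) auto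
      ultimately show "q * real (card E) + p * real (card (vpairs n)) \<le> real n * \<rho>"
        by (simp add: algebra_simps)
    qed
    finally show "measure EM (B s) \<le> exp (2 * (real n * \<rho>) - L)" .
  qed
  have C: "C x s \<in> sets EM" "measure EM (C x s) \<le> (level T / \<epsilon>\<^sup>2) ^ Suc k"
    if x: "x \<in> {1..n}" and s: "s \<in> {T..T'}" for x s
  proof -
    have dep: "(good n \<kappa> \<Delta> h L s G \<and> \<epsilon>\<^sup>2 \<le> chi_dist x s G) = (good n \<kappa> \<Delta> h L s G' \<and> \<epsilon>\<^sup>2 \<le> chi_dist x s G')"
      if "\<And>r. r \<le> s \<Longrightarrow> G r = G' r" for G G'
    proof -
      have "good n \<kappa> \<Delta> h L s G = good n \<kappa> \<Delta> h L s G'" using that by (simp add: good_def Suc_le_eq)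
      moreover have "chi_dist x s G = chi_dist x s G'"
        using that walk_dist_cong[of s G G' n x] by (simp add: chi_dist_def)
      ultimately show ?thesis by simp
    qed
    show "C x s \<in> sets EM" unfolding C_def by (rule edge_markovian_eq_traj(1)[OF E0 dep])
    have "measure EM (C x s)
      = measure_pmf.prob (traj n p q E0 s) {G. good n \<kappa> \<Delta> h L s G \<and> \<epsilon>\<^sup>2 \<le> chi_dist x s G}"
      unfolding C_def by (rule edge_markovian_eq_traj(2)[OF E0 dep])
    also have "\<dots> \<le> (level s / \<epsilon>\<^sup>2) ^ Suc k" using \<epsilon> by (intro prob_chi_dist_ge[OF x]) simp
    also have "\<dots> \<le> (level T / \<epsilon>\<^sup>2) ^ Suc k"
      using level_pos[of s] level_mono[of T s] s \<epsilon> by (intro power_mono divide_right_mono) auto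
    finally show "measure EM (C x s) \<le> (level T / \<epsilon>\<^sup>2) ^ Suc k" .
  qed
  have sub: "{G \<in> space EM. \<not> (\<forall>s\<in>{T..T'}. mixed n \<epsilon> G s)}
    \<subseteq> N \<union> ((\<Union>s\<in>{..<T'}. B s) \<union> (\<Union>x\<in>{1..n}. \<Union>s\<in>{T..T'}. C x s))"
  proof (rule subsetI, rule ccontr)
    fix G assume G: "G \<in> {G \<in> space EM. \<not> (\<forall>s\<in>{T..T'}. mixed n \<epsilon> G s)}"
      and notin: "G \<notin> N \<union> ((\<Union>s\<in>{..<T'}. B s) \<union> (\<Union>x\<in>{1..n}. \<Union>s\<in>{T..T'}. C x s))"
    have "G \<notin> N" using notin by blast
    then have nice: "nice_graph n \<kappa> \<Delta> h (G s)" if "s \<le> T'" for s using that G by (simp add: N_def)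
    have change: "real (card (edge_diff (G s) (G (Suc s)))) \<le> L" if "s < T'" for s
    proof -
      have "G \<notin> B s" using notin that by blast
      then show ?thesis using nice[of s] that G by (simp add: B_def)
    qed
    have "mixed n \<epsilon> G s" if s: "s \<in> {T..T'}" for s
      unfolding mixed_def
    proof (intro ballI conjI)
      fix x assume x: "x \<in> {1..n}"
      have nG: "nice_graph n \<kappa> \<Delta> h (G s)" using s by (intro nice) simp
      show "G s \<noteq> {}" using nice_card_pos[OF nG \<kappa> n] by auto
      have "good n \<kappa> \<Delta> h L s G" using nice change s by (auto simp: good_def)
      moreover have "G \<notin> C x s" using notin x s by blast
      ultimately have "chi_dist x s G < \<epsilon>\<^sup>2" using G by (simp add: C_def not_le)
      then have "sqrt (chi_dist x s G) \<le> \<epsilon>" using \<epsilon> by (intro real_le_lsqrt) auto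
      then show "tv_dist n (walk_dist n G x s) (stationary (G s)) \<le> \<epsilon>"
        using tv_dist_le_chi_sq[OF nG \<kappa> n, of "walk_dist n G x s"] by (simp add: chi_dist_def)
    qed
    then show False using G by blast
  qed
  have sB: "(\<Union>s\<in>{..<T'}. B s) \<in> sets EM" using B(1) by (intro sets.finite_UN) auto
  have sC': "(\<Union>s\<in>{T..T'}. C x s) \<in> sets EM" if "x \<in> {1..n}" for x
    using C(1)[OF that] by (intro sets.finite_UN) auto
  have sC: "(\<Union>x\<in>{1..n}. \<Union>s\<in>{T..T'}. C x s) \<in> sets EM"
    by (intro sets.finite_UN[OF _ sC']) simp_all
  have "measure EM {G \<in> space EM. \<not> (\<forall>s\<in>{T..T'}. mixed n \<epsilon> G s)}
    \<le> measure EM (N \<union> ((\<Union>s\<in>{..<T'}. B s) \<union> (\<Union>x\<in>{1..n}. \<Union>s\<in>{T..T'}. C x s)))"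
    by (intro M.finite_measure_mono[OF sub] sets.Un Nsets sB sC)
  also have "\<dots> \<le> measure EM N + (measure EM (\<Union>s\<in>{..<T'}. B s)
      + measure EM (\<Union>x\<in>{1..n}. \<Union>s\<in>{T..T'}. C x s))"
    by (rule order_trans[OF measure_Un_le[OF Nsets sets.Un[OF sB sC]]
        add_left_mono[OF measure_Un_le[OF sB sC]]])
  also have "measure EM (\<Union>s\<in>{..<T'}. B s) \<le> (\<Sum>s\<in>{..<T'}. exp (2 * (real n * \<rho>) - L))"
    using B by (intro order_trans[OF M.finite_measure_subadditive_finite] sum_mono) auto
  also have "measure EM (\<Union>x\<in>{1..n}. \<Union>s\<in>{T..T'}. C x s)
    \<le> (\<Sum>x\<in>{1..n}. \<Sum>s\<in>{T..T'}. (level T / \<epsilon>\<^sup>2) ^ Suc k)"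
  proof -
    have "measure EM (\<Union>x\<in>{1..n}. \<Union>s\<in>{T..T'}. C x s) \<le> (\<Sum>x\<in>{1..n}. measure EM (\<Union>s\<in>{T..T'}. C x s))"
      using sC' by (intro M.finite_measure_subadditive_finite) auto
    also have "\<dots> \<le> (\<Sum>x\<in>{1..n}. \<Sum>s\<in>{T..T'}. measure EM (C x s))"
      by (intro sum_mono M.finite_measure_subadditive_finite image_subsetI C(1)) simp_all
    also have "\<dots> \<le> (\<Sum>x\<in>{1..n}. \<Sum>s\<in>{T..T'}. (level T / \<epsilon>\<^sup>2) ^ Suc k)"
      by (intro sum_mono C(2))
    finally show ?thesis .
  qed
  finally show ?thesis using nn by (simp add: N_def del: power_Suc)
qed

text \<open>\<open>T\<close> itself is a witness for the minimum once its whole window is mixed;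
  \<open>T'\<close> is the last integer of that window, and no window starting at or before
  \<open>T\<close> reaches beyond it.\<close>

lemma prob_mixing_time:
  assumes \<epsilon>: "0 < \<epsilon>" and T': "T' = T + nat \<lfloor>sqrt (real n)\<rfloor>"
    and nn: "measure EM {G \<in> space EM. \<not> (\<forall>s\<le>T'. nice_graph n \<kappa> \<Delta> h (G s))} \<le> \<xi>"
  shows "1 - (\<xi> + real T' * exp (2 * (real n * \<rho>) - L)
      + real n * (real (card {T..T'}) * (level T / \<epsilon>\<^sup>2) ^ Suc k))
    \<le> measure EM {G \<in> space EM. mixing_time n G \<epsilon> \<le> enat T}"
proof -
  interpret M: prob_space EM by (rule prob_space_edge_markovian[OF E0])
  have iff: "real s \<le> real t + sqrt (real n) \<longleftrightarrow> s \<le> t + nat \<lfloor>sqrt (real n)\<rfloor>" for s t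
  proof -
    have "real s \<le> real t + sqrt (real n) \<longleftrightarrow> of_int (int s - int t) \<le> sqrt (real n)" by auto
    also have "\<dots> \<longleftrightarrow> int s - int t \<le> \<lfloor>sqrt (real n)\<rfloor>" by (rule le_floor_iff[symmetric])
    also have "\<dots> \<longleftrightarrow> s \<le> t + nat \<lfloor>sqrt (real n)\<rfloor>"
    proof -
      have "0 \<le> \<lfloor>sqrt (real n)\<rfloor>" by simp
      then show ?thesis by linarith
    qed
    finally show ?thesis .
  qed
  let ?P = "\<lambda>G. \<exists>t\<le>T. \<forall>s. t \<le> s \<and> s \<le> t + nat \<lfloor>sqrt (real n)\<rfloor> \<longrightarrow> mixed n \<epsilon> G s"
  let ?Q = "\<lambda>G. \<forall>s\<in>{T..T'}. mixed n \<epsilon> G s"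
  have eq: "{G \<in> space EM. mixing_time n G \<epsilon> \<le> enat T} = {G \<in> space EM. ?P G}"
    by (simp add: mixing_time_le_iff iff)
  have P: "{G \<in> space EM. ?P G} \<in> sets EM"
  proof (rule edge_markovian_eq_traj(1)[OF E0, of T'])
    fix G G' :: "nat \<Rightarrow> graph" assume *: "\<And>s. s \<le> T' \<Longrightarrow> G s = G' s"
    have "mixed n \<epsilon> G s = mixed n \<epsilon> G' s" if "s \<le> T'" for s using * that by (intro mixed_cong) auto
    then show "?P G = ?P G'" unfolding T' by (meson add_le_mono1 order_trans)
  qed
  have Q: "{G \<in> space EM. ?Q G} \<in> sets EM"
  proof (rule edge_markovian_eq_traj(1)[OF E0, of T'])
    fix G G' :: "nat \<Rightarrow> graph" assume *: "\<And>s. s \<le> T' \<Longrightarrow> G s = G' s"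
    have "mixed n \<epsilon> G s = mixed n \<epsilon> G' s" if "s \<le> T'" for s using * that by (intro mixed_cong) auto
    then show "?Q G = ?Q G'" by auto
  qed
  have "measure EM {G \<in> space EM. \<not> ?Q G} = 1 - measure EM {G \<in> space EM. ?Q G}"
    by (rule M.prob_neg[OF Q])
  moreover have "measure EM {G \<in> space EM. ?Q G} \<le> measure EM {G \<in> space EM. ?P G}"
  proof (rule M.finite_measure_mono[OF _ P], rule subsetI)
    fix G assume "G \<in> {G \<in> space EM. ?Q G}"
    then have "G \<in> space EM" "\<forall>s. T \<le> s \<and> s \<le> T + nat \<lfloor>sqrt (real n)\<rfloor> \<longrightarrow> mixed n \<epsilon> G s"
      unfolding T' by auto
    then show "G \<in> {G \<in> space EM. ?P G}" by blast
  qed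
  moreover have "T \<le> T'" by (simp add: T')
  ultimately show ?thesis
    using prob_not_mixed[OF \<epsilon> _ nn, of T] unfolding eq by linarith
qed

end


section \<open>Asymptotics\<close>

lemma card_edge_cut_Diff:
  assumes S: "S \<subseteq> {1..n}"
  shows "card (edge_cut n E ({1..n} - S)) = card (edge_cut n E S)"
proof -
  have "{1..n} - ({1..n} - S) = S" using S by blast
  then have "real (card (edge_cut n E ({1..n} - S))) = (\<Sum>u\<in>{1..n}-S. \<Sum>v\<in>S. adj E u v)"
    using card_edge_cut_eq_sum_adj[of "{1..n} - S" n E] by simp
  also have "\<dots> = (\<Sum>v\<in>S. \<Sum>u\<in>{1..n}-S. adj E u v)" by (rule sum.swap)
  also have "\<dots> = real (card (edge_cut n E S))"
    by (simp only: card_edge_cut_eq_sum_adj[OF S] adj_commute[of E])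
  finally show ?thesis by simp
qed

lemma conductance_cut_le:
  assumes S: "S \<subseteq> {1..n}" and vol: "1 \<le> vol E S" "real (vol E S) \<le> real (vol E {1..n}) / 2"
  shows "conductance n E * real (vol E S) \<le> real (card (edge_cut n E S))"
proof -
  have "conductance n E \<le> real (card (edge_cut n E S)) / real (vol E S)"
    unfolding conductance_def
  proof (rule Min_le)
    have "finite {S. S \<subseteq> {1..n} \<and> 1 \<le> vol E S \<and> real (vol E S) \<le> real (vol E {1..n}) / 2}"
      by (rule finite_subset[of _ "Pow {1..n}"]) auto
    then show "finite ((\<lambda>S. real (card (edge_cut n E S)) / real (vol E S)) `
       {S. S \<subseteq> {1..n} \<and> 1 \<le> vol E S \<and> real (vol E S) \<le> real (vol E {1..n}) / 2})"
      by (rule finite_imageI)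
    show "real (card (edge_cut n E S)) / real (vol E S) \<in> (\<lambda>S. real (card (edge_cut n E S)) / real (vol E S)) `
       {S. S \<subseteq> {1..n} \<and> 1 \<le> vol E S \<and> real (vol E S) \<le> real (vol E {1..n}) / 2}"
      using S vol by blast
  qed
  then show ?thesis using vol by (simp add: pos_le_divide_eq)
qed

text \<open>Conductance speaks of sets with at most half of the volume, \<open>nice_graph\<close> of
  sets with at most half of the vertices. If \<open>S\<close> has too much volume, its complement
  qualifies: it has the same cut and at least as many vertices, so its bound implies the one for
  \<open>S\<close>.\<close>

lemma conductance_edge_cut_ge:
  assumes deg: "\<And>x. x \<in> {1..n} \<Longrightarrow> \<gamma> \<le> real (deg E x)" and \<gamma>: "0 < \<gamma>"
    and \<Phi>: "0 \<le> conductance n E"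
    and S: "S \<subseteq> {1..n}" "S \<noteq> {}" "2 * card S \<le> n"
  shows "conductance n E * \<gamma> * real (card S) \<le> real (card (edge_cut n E S))"
proof -
  have vol: "\<gamma> * real (card R) \<le> real (vol E R)" if "R \<subseteq> {1..n}" for R
  proof -
    have "(\<Sum>x\<in>R. \<gamma>) \<le> (\<Sum>x\<in>R. real (deg E x))" using that deg by (intro sum_mono) auto
    then show ?thesis by (simp add: vol_def mult.commute)
  qed
  have main: "conductance n E * \<gamma> * real (card R) \<le> real (card (edge_cut n E R))"
    if R: "R \<subseteq> {1..n}" "R \<noteq> {}" "real (vol E R) \<le> real (vol E {1..n}) / 2" for R
  proof -
    have "finite R" using R(1) finite_subset by blast
    then have "0 < \<gamma> * real (card R)" using R(2) \<gamma> by (simp add: card_gt_0_iff)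
    then have "0 < real (vol E R)" using vol[OF R(1)] by linarith
    then have "1 \<le> vol E R" by simp
    from conductance_cut_le[OF R(1) this R(3)] mult_left_mono[OF vol[OF R(1)] \<Phi>]
    show ?thesis by (simp add: mult.assoc)
  qed
  show ?thesis
  proof (cases "real (vol E S) \<le> real (vol E {1..n}) / 2")
    case True
    then show ?thesis using main S by blast
  next
    case False
    let ?R = "{1..n} - S"
    have finS: "finite S" using S(1) finite_subset by blast
    have card: "card ?R = n - card S" using S(1) finS by (simp add: card_Diff_subset)
    then have cR: "card S \<le> card ?R" using S(3) by simp
    moreover have "0 < card S" using S(2) finS by (simp add: card_gt_0_iff)
    ultimately have "card ?R \<noteq> 0" by linarith
    then have "?R \<noteq> {}" by (metis card.empty)
    moreover have "vol E {1..n} = vol E ?R + vol E S"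
      unfolding vol_def using S(1) by (intro sum.subset_diff) auto
    then have "real (vol E ?R) \<le> real (vol E {1..n}) / 2" using False by simp
    ultimately have "conductance n E * \<gamma> * real (card ?R) \<le> real (card (edge_cut n E ?R))"
      by (intro main) auto
    moreover have "conductance n E * \<gamma> * real (card S) \<le> conductance n E * \<gamma> * real (card ?R)"
      using cR \<Phi> \<gamma> by (intro mult_left_mono) auto
    ultimately show ?thesis by (simp only: card_edge_cut_Diff[OF S(1)])
  qed
qed

text \<open>All asymptotic hypotheses enter as inequalities at one \<open>n\<close>. The constants
  are sized so that the failure terms add up to 6 / n: 3 / n for cuts, and 1 / n each for gained
  edges, steps with many changes, and chi-square.\<close>

lemma mixing_time_fixed_n:
  fixes a B \<alpha> \<beta> c3 d p q K k0 K' M \<Phi> \<epsilon> \<theta>0 C6 \<l> :: real and n T :: nat and E0 :: graph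
  assumes const: "0 < a" "0 < B" "0 < \<alpha>" "0 < \<beta>"
    and K: "K = \<beta> + 2 + 3 / a" and k0: "k0 = \<alpha>\<^sup>2 / (16 * K\<^sup>2)"
    and K': "K' = 2 * (K + 1) * B + 4" and M: "M = 2 * K' / (\<alpha> * a)" and \<theta>0: "\<theta>0 = 12 / (\<alpha> * a)"
    and C6: "C6 = 2 * K / \<alpha> + 64 * (M + 1) * K' / \<alpha>"
    and c3: "48 / \<alpha> \<le> c3" "1 \<le> k0 * c3\<^sup>2" "40 * exp 4 * B \<le> k0 * c3\<^sup>2"
    and \<l>: "\<l> = ln (real n)" and N1: "16 \<le> \<l>"
    and N2: "B / (a * sqrt (real n)) \<le> exp (- 4) / 2"
    and N3: "\<l>\<^sup>2 / sqrt (real n) + B / (a * sqrt (real n)) \<le> exp (- (\<l> / 4))"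
    and N5: "(4 * K' + 4 * exp \<theta>0 * (K + 1) * B) / \<alpha> * (4 / \<l>) \<le> 1 / 2"
    and N6: "3 \<le> a * \<l>" and N7: "1 \<le> B * real n"
    and d: "a * \<l> \<le> d" "d \<le> real n"
    and p_le: "0 \<le> p" "p \<le> 1" "p * real n \<le> B * \<l> / real n"
    and q_le: "0 \<le> q" "q \<le> 1" "q \<le> B * \<l> / (d * real n)"
    and E0: "E0 \<subseteq> vpairs n"
    and deg: "\<And>x. x \<in> {1..n} \<Longrightarrow> \<alpha> * d \<le> real (deg E0 x)" "\<And>x. x \<in> {1..n} \<Longrightarrow> real (deg E0 x) \<le> \<beta> * d"
    and \<Phi>: "\<Phi> = conductance n E0" "c3 * (ln d / d) \<le> \<Phi>"
    and T: "T = nat \<lfloor>5 * \<l> / (k0 * \<Phi>\<^sup>2)\<rfloor>"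
    and \<epsilon>: "0 < \<epsilon>" "\<epsilon>\<^sup>2 = exp 3 * C6 / \<l>"
  shows "1 - 6 / real n \<le> measure (edge_markovian n p q E0)
      {G \<in> space (edge_markovian n p q E0). mixing_time n G \<epsilon> \<le> enat T}"
proof -
  have n3: "3 \<le> n"
  proof (rule ccontr)
    assume "\<not> 3 \<le> n"
    then have "n = 0 \<or> n = 1 \<or> n = 2" by linarith
    then have "\<l> \<le> 1" using ln_2_less_1 by (auto simp: \<l>)
    then show False using N1 by simp
  qed
  have n0: "0 < real n" using n3 by simp
  have expl: "exp \<l> = real n" using n0 by (simp add: \<l>)
  have d3: "3 \<le> d" using d N6 by linarith
  have d0: "0 < d" using d3 by simp
  have lnd: "1 \<le> ln d"
  proof -
    have "exp 1 \<le> d" using exp_le d3 by linarith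
    then show ?thesis using d0 by (simp add: ln_ge_iff)
  qed
  have lnd0: "0 < ln d" using lnd by linarith
  have K0: "0 < K" "2 \<le> K" using const by (simp_all add: K add_pos_pos)
  have k00: "0 < k0" using K0 const by (simp add: k0)
  have K'0: "0 < K'" using K0 const by (simp add: K' add_pos_pos)
  have M0: "0 < M" using K'0 const by (simp add: M)
  have C60: "0 < C6" using K0 K'0 M0 const by (simp add: C6 add_pos_pos)
  have c30: "0 < c3" using c3(1) const by (meson divide_pos_pos less_le_trans zero_less_numeral)
  have \<Phi>0: "0 < \<Phi>"
  proof -
    have "0 < c3 * (ln d / d)" using c30 lnd0 d0 by (intro mult_pos_pos divide_pos_pos)
    then show ?thesis using \<Phi>(2) by linarith
  qed
  \<comment> \<open>\<open>K\<close> is \<beta> for the initial degree plus 2 + 3 / a for gained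
    edges: 2 d outweighs the exponential moment of the gains, and the excess 3 d / a >= 3 ln n gives
    n^-3 per vertex.\<close>
  define \<Delta> where "\<Delta> = K * d"
  define \<kappa> where "\<kappa> = \<alpha> * d / 2"
  define h where "h = \<Phi> * \<alpha> * d / 2"
  \<comment> \<open>\<open>K'\<close> is chosen so that \<open>L\<close> exceeds
    \<open>2 * (real n * \<rho>)\<close> by \<open>4 * \<l>\<close>, which makes a step with too
    many changes have probability at most n^-4.\<close>
  define L where "L = K' * \<l>"
  define \<rho> where "\<rho> = (K + 1) * B * \<l> / real n"
  define k where "k = nat \<lceil>\<l>\<rceil>"
  define \<nu> where "\<nu> = k0 * \<Phi>\<^sup>2"
  define T' where "T' = T + nat \<lfloor>sqrt (real n)\<rfloor>"
  have lam: "h\<^sup>2 / (4 * \<Delta>\<^sup>2) = \<nu>"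
    using d0 K0 by (simp add: h_def \<Delta>_def \<nu>_def k0 power_mult_distrib power_divide field_simps)
  have \<nu>0: "0 < \<nu>" using k00 \<Phi>0 by (simp add: \<nu>_def)
  \<comment> \<open>Up to constants, a bound for the expected share of edges lost before mixing:
    rate \<open>\<l> / (d * real n)\<close> over \<open>\<l> / \<nu>\<close> steps, with
    \<open>\<nu>\<close> at least of order (ln d / d)^2. It is at most 4 for d >= sqrt n, since then
    \<l> <= 2 ln d, and decays polynomially up to logarithms below.\<close>
  define w where "w = d * \<l>\<^sup>2 / (real n * (ln d)\<^sup>2)"
  have w4: "w \<le> 4" if "sqrt (real n) \<le> d"
  proof -
    have "ln (sqrt (real n)) \<le> ln d" using that n0 d0 by (subst ln_le_cancel_iff) auto
    then have "\<l> \<le> 2 * ln d" using n0 by (simp add: ln_sqrt \<l>)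
    then have "\<l>\<^sup>2 \<le> (2 * ln d)\<^sup>2" using N1 by (intro power_mono) auto
    then have "d * \<l>\<^sup>2 \<le> real n * (4 * (ln d)\<^sup>2)"
      using d d0 by (intro mult_mono) (auto simp: power_mult_distrib)
    moreover have "0 < real n * (ln d)\<^sup>2" using n0 lnd lnd0 by simp
    ultimately show ?thesis unfolding w_def by (subst pos_divide_le_eq) auto
  qed
  have wsmall: "w \<le> \<l>\<^sup>2 / sqrt (real n)" if "d \<le> sqrt (real n)"
  proof -
    have "w \<le> sqrt (real n) * \<l>\<^sup>2 / (real n * 1)"
      unfolding w_def using that d0 n0 lnd lnd0 one_le_power[OF lnd, of 2]
      by (intro frac_le mult_mono mult_nonneg_nonneg) auto
    also have "\<dots> = \<l>\<^sup>2 / sqrt (real n)"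
      using n0 real_sqrt_mult_self[of "real n"] by (simp add: divide_simps)
    finally show ?thesis .
  qed
  have e14: "exp (- (\<l> / 4)) \<le> 1" using N1 by simp
  have Bs0: "0 \<le> B / (a * sqrt (real n))" using const n0 by simp
  have w4': "w \<le> 4"
    using w4 wsmall N3 e14 Bs0 by linarith
  have \<nu>low: "k0 * c3\<^sup>2 * ((ln d)\<^sup>2 / d\<^sup>2) \<le> \<nu>"
  proof -
    have "(c3 * (ln d / d))\<^sup>2 \<le> \<Phi>\<^sup>2" 
      by (rule power_mono[OF \<Phi>(2) less_imp_le[OF mult_pos_pos[OF c30 divide_pos_pos[OF lnd0 d0]]]])
    from mult_left_mono[OF this, of k0] show ?thesis
      using k00 by (simp add: \<nu>_def power_mult_distrib power_divide mult.assoc)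
  qed
  \<comment> \<open>The noise scale \<l> / (n d) is below the gap \<open>\<nu>\<close> by a factor
    of order \<l>, again because \<open>w\<close> is bounded. Both the condition
    \<open>noise\<close> and the final floor of \<open>level\<close> rest on this.\<close>
  have z: "\<l> / (real n * d) \<le> \<nu> * (4 / \<l>)"
  proof -
    have "\<l> / (real n * d) = w * ((ln d)\<^sup>2 / d\<^sup>2) / \<l>"
      using n0 d0 lnd lnd0 N1 by (simp add: w_def power2_eq_square divide_simps)
    also have "\<dots> \<le> 4 * ((ln d)\<^sup>2 / d\<^sup>2) / \<l>"
      using w4' N1 by (intro divide_right_mono mult_right_mono) auto
    also have "(ln d)\<^sup>2 / d\<^sup>2 \<le> \<nu>"
      using \<nu>low mult_right_mono[OF c3(2), of "(ln d)\<^sup>2 / d\<^sup>2"] by simp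
    finally show ?thesis using N1 by (simp add: mult.commute divide_right_mono)
  qed
  have cut0: "2 * h * real (card S) \<le> real (card (edge_cut n E0 S))"
    if "S \<subseteq> {1..n}" "S \<noteq> {}" "2 * card S \<le> n" for S
    using conductance_edge_cut_ge[OF deg(1) _ _ that] const d0 \<Phi>0
    by (simp add: \<Phi>(1)[symmetric] h_def mult.assoc)
  have h0: "0 < h" using \<Phi>0 const d0 by (simp add: h_def)
  have \<Delta>0: "0 < \<Delta>" using K0 d0 by (simp add: \<Delta>_def)
  have \<kappa>0: "0 < \<kappa>" using const d0 by (simp add: \<kappa>_def)
  \<comment> \<open>The cut of the vertex 1 has only \<open>deg E0 1\<close> edges; this caps
    \<open>h\<close>, and thereby \<open>\<nu>\<close> by 1.\<close>
  have h\<Delta>: "h \<le> \<Delta>"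
  proof -
    have "2 * h * real (card {1::nat}) \<le> real (card (edge_cut n E0 {1}))"
      using n3 by (intro cut0) auto
    also have "\<dots> = real (deg E0 1)" using n3 by (simp add: card_edge_cut_singleton[OF E0])
    also have "\<dots> \<le> \<beta> * d" using n3 by (intro deg) auto
    also have "\<dots> \<le> \<Delta>" using const d0 K by (auto simp: \<Delta>_def intro!: mult_right_mono)
    finally show ?thesis using h0 by simp
  qed
  have Lk: "L \<le> M * \<kappa>"
  proof -
    have "M * \<kappa> = K' * (d / a)" using const by (simp add: M \<kappa>_def)
    moreover have "\<l> \<le> d / a" using d const by (simp add: pos_le_divide_eq mult.commute)
    ultimately show ?thesis using mult_left_mono[of \<l> "d / a" K'] K'0 by (simp add: L_def)
  qed
  have Suck: "\<l> \<le> real (Suc k)" "real (Suc k) \<le> 3 * \<l>"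
  proof -
    have "real k = of_int \<lceil>\<l>\<rceil>" using N1 by (simp add: k_def)
    then have "\<l> \<le> real k" "real k \<le> \<l> + 1" by linarith+
    then show "\<l> \<le> real (Suc k)" "real (Suc k) \<le> 3 * \<l>" using N1 by auto
  qed
  \<comment> \<open>The exponential parameter stays bounded because the moment order is at most 3
    \<l>, while the degrees have order d >= a \<l>.\<close>
  have \<theta>k: "2 / \<kappa> * real (Suc k) \<le> \<theta>0"
  proof -
    have "2 / \<kappa> * real (Suc k) \<le> 2 / \<kappa> * (3 * (d / a))"
    proof (rule mult_left_mono)
      have "\<l> \<le> d / a" using d const by (simp add: pos_le_divide_eq mult.commute)
      then show "real (Suc k) \<le> 3 * (d / a)" using Suck by linarith
    qed (use \<kappa>0 in simp)
    also have "\<dots> = \<theta>0" using d0 const by (simp add: \<kappa>_def \<theta>0)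
    finally show ?thesis .
  qed
  have \<rho>: "q * \<Delta> + p * real n \<le> \<rho>"
  proof -
    have "q * \<Delta> \<le> B * \<l> / (d * real n) * \<Delta>" using q_le \<Delta>0 by (intro mult_right_mono) auto
    also have "\<dots> = K * (B * \<l> / real n)" using d0 by (simp add: \<Delta>_def)
    finally have "q * \<Delta> + p * real n \<le> K * (B * \<l> / real n) + B * \<l> / real n" using p_le by linarith
    also have "\<dots> = \<rho>" by (simp add: \<rho>_def distrib_right add_divide_distrib)
    finally show ?thesis .
  qed
  have \<eta>eq: "2 * L / (real n * \<kappa>) = 4 * K' / \<alpha> * (\<l> / (real n * d))"
    using d0 const n0 by (simp add: L_def \<kappa>_def mult_ac)
  have noise: "2 * L / (real n * \<kappa>) + 2 / \<kappa> * exp (2 / \<kappa> * real (Suc k)) * \<rho> \<le> \<nu> / 2"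
  proof -
    have "2 / \<kappa> * exp (2 / \<kappa> * real (Suc k)) * \<rho> \<le> 2 / \<kappa> * exp \<theta>0 * \<rho>"
      using \<theta>k \<kappa>0 K0 const N1 n0 by (intro mult_right_mono mult_left_mono) (auto simp: \<rho>_def)
    also have "\<dots> = 4 * exp \<theta>0 * (K + 1) * B / \<alpha> * (\<l> / (real n * d))"
      using d0 const n0 by (simp add: \<rho>_def \<kappa>_def mult_ac)
    finally have "2 * L / (real n * \<kappa>) + 2 / \<kappa> * exp (2 / \<kappa> * real (Suc k)) * \<rho>
      \<le> (4 * K' + 4 * exp \<theta>0 * (K + 1) * B) / \<alpha> * (\<l> / (real n * d))"
      unfolding \<eta>eq by (simp add: add_divide_distrib distrib_right)
    also have "\<dots> \<le> (4 * K' + 4 * exp \<theta>0 * (K + 1) * B) / \<alpha> * (\<nu> * (4 / \<l>))"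
      using z K'0 K0 const by (intro mult_left_mono) auto
    also have "\<dots> = \<nu> * ((4 * K' + 4 * exp \<theta>0 * (K + 1) * B) / \<alpha> * (4 / \<l>))" by (simp only: mult.left_commute)
    also have "\<dots> \<le> \<nu> * (1 / 2)" using N5 \<nu>0 by (intro mult_left_mono) auto
    finally show ?thesis by simp
  qed
  have \<nu>1: "\<nu> \<le> 1"
  proof -
    have "h\<^sup>2 \<le> \<Delta>\<^sup>2" using h\<Delta> h0 by (intro power_mono) auto
    then have "h\<^sup>2 \<le> 1 * (4 * \<Delta>\<^sup>2)" using zero_le_power2[of \<Delta>] by linarith
    moreover have "0 < 4 * \<Delta>\<^sup>2" using \<Delta>0 by simp
    ultimately show ?thesis unfolding lam[symmetric] by (simp only: pos_divide_le_eq)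
  qed
  interpret em_bounds n k p q \<kappa> \<Delta> h L M \<rho> E0
  proof
    show "1 \<le> n" using n3 by simp
    show "0 < L" using K'0 N1 by (simp add: L_def)
    show "h\<^sup>2 / (4 * \<Delta>\<^sup>2) \<le> 1" using \<nu>1 by (simp only: lam)
    show "2 * L / (real n * \<kappa>) + 2 / \<kappa> * exp (2 / \<kappa> * real (Suc k)) * \<rho> \<le> h\<^sup>2 / (4 * \<Delta>\<^sup>2) / 2"
      using noise by (simp only: lam)
  qed (rule E0 p_le(1) p_le(2) q_le(1) q_le(2) \<kappa>0 h0 \<Delta>0 Lk \<rho>)+
  have lam_eq: "lam = \<nu>" by (simp add: lam_def lam)
  have T1: "real T \<le> 5 * \<l> / \<nu>" "5 * \<l> / \<nu> - 1 \<le> real T"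
  proof -
    have "0 \<le> 5 * \<l> / \<nu>" using N1 \<nu>0 by simp
    then have "real T = of_int \<lfloor>5 * \<l> / \<nu>\<rfloor>" by (simp add: T \<nu>_def)
    then show "real T \<le> 5 * \<l> / \<nu>" "5 * \<l> / \<nu> - 1 \<le> real T" by linarith+
  qed
  have sqn: "real (nat \<lfloor>sqrt (real n)\<rfloor>) \<le> sqrt (real n)" by simp
  define r0 where "r0 = B * \<l> / (d * real n)"
  have r00: "0 < r0" using const N1 d0 n0 by (simp add: r0_def)
  \<comment> \<open>Bound for \<open>r0 * real T'\<close>, hence for the chance that a given edge
    dies by \<open>T'\<close>: the first term covers the \<open>T\<close> steps before mixing, the
    second the window of length sqrt n.\<close>
  define \<tau> where "\<tau> = 5 * B / (k0 * c3\<^sup>2) * w + B / (a * sqrt (real n))"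
  have rT: "r0 * real T' \<le> \<tau>"
  proof -
    have "r0 * real T' \<le> r0 * (5 * \<l> / \<nu> + sqrt (real n))"
      using T1 sqn r00 unfolding T'_def of_nat_add by (intro mult_left_mono add_mono) auto
    also have "\<dots> = r0 * (5 * \<l>) / \<nu> + r0 * sqrt (real n)" by (simp add: distrib_left)
    also have "r0 * (5 * \<l>) / \<nu> \<le> r0 * (5 * \<l>) / (k0 * c3\<^sup>2 * ((ln d)\<^sup>2 / d\<^sup>2))"
      using \<nu>low k00 c30 lnd lnd0 d0 r00 N1 by (intro divide_left_mono mult_pos_pos divide_pos_pos \<nu>0) auto
    also have "\<dots> = 5 * B / (k0 * c3\<^sup>2) * w"
      using d0 n0 by (simp add: r0_def w_def power2_eq_square mult_ac)
    also have "r0 * sqrt (real n) \<le> B / (a * sqrt (real n))"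
    proof -
      have "r0 * sqrt (real n) = (\<l> / d) * (B / sqrt (real n))"
        using n0 d0 real_sqrt_mult_self[of "real n"] by (simp add: r0_def divide_simps)
      also have "\<dots> \<le> (1 / a) * (B / sqrt (real n))"
        using d d0 const n0 by (intro mult_right_mono) (auto simp: divide_simps mult.commute)
      finally show ?thesis by simp
    qed
    finally show ?thesis by (simp add: \<tau>_def)
  qed
  have coef: "5 * B / (k0 * c3\<^sup>2) \<le> exp (- 4) / 8" "0 \<le> 5 * B / (k0 * c3\<^sup>2)"
  proof -
    have "5 * B \<le> exp (- 4) / 8 * (k0 * c3\<^sup>2)"
      using mult_left_mono[OF c3(3), of "exp (- 4) / 8"] by (simp add: exp_minus)
    then show "5 * B / (k0 * c3\<^sup>2) \<le> exp (- 4) / 8"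
      using k00 c30 by (subst pos_divide_le_eq) auto
    show "0 \<le> 5 * B / (k0 * c3\<^sup>2)" using const k00 by simp
  qed
  have \<tau>4: "\<tau> \<le> exp (- 4)"
  proof -
    have "5 * B / (k0 * c3\<^sup>2) * w \<le> 5 * B / (k0 * c3\<^sup>2) * 4"
      using w4' coef by (intro mult_left_mono)
    also have "\<dots> \<le> exp (- 4) / 8 * 4" using coef(1) by (rule mult_right_mono) simp
    finally show ?thesis using N2 unfolding \<tau>_def by linarith
  qed
  have \<tau>small: "\<tau> \<le> exp (- (\<l> / 4))" if "d \<le> sqrt (real n)"
  proof -
    have w0: "0 \<le> w" using d0 by (simp add: w_def)
    have "exp (- 4 :: real) / 8 \<le> 1"
    proof -
      have "exp (- 4 :: real) \<le> 1" by simp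
      then show ?thesis by linarith
    qed
    then have "5 * B / (k0 * c3\<^sup>2) \<le> 1" using coef by linarith
    then have "5 * B / (k0 * c3\<^sup>2) * w \<le> 1 * w" using w0 by (rule mult_right_mono)
    then show ?thesis using wsmall[OF that] N3 unfolding \<tau>_def by linarith
  qed
  have \<tau>1: "r0 * real T' \<le> 1"
  proof -
    have "exp (- 4 :: real) \<le> 1" by simp
    then show ?thesis using rT \<tau>4 by linarith
  qed
  have qT: "q * real T' \<le> \<tau>"
    using rT mult_right_mono[OF q_le(3), of "real T'"] by (simp add: r0_def)
  have cutln: "c3 * \<alpha> * ln d * real (card S) \<le> real (card (edge_cut n E0 S))"
    if S: "S \<subseteq> {1..n}" "S \<noteq> {}" "2 * card S \<le> n" for S
  proof -
    have "c3 * \<alpha> * ln d = c3 * (ln d / d) * (\<alpha> * d)" using d0 by simp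
    also have "\<dots> \<le> \<Phi> * (\<alpha> * d)" using \<Phi>(2) const d0 by (intro mult_right_mono) auto
    also have "\<dots> = 2 * h" by (simp add: h_def)
    finally have "c3 * \<alpha> * ln d * real (card S) \<le> 2 * h * real (card S)" by (rule mult_right_mono) simp
    then show ?thesis using cut0[OF S] by linarith
  qed
  have c3\<alpha>: "48 \<le> c3 * \<alpha>" using c3(1) const by (simp add: pos_divide_le_eq)
  obtain \<theta> where \<theta>: "0 \<le> \<theta>" and lost: "\<And>S. S \<subseteq> {1..n} \<Longrightarrow> S \<noteq> {} \<Longrightarrow> 2 * card S \<le> n \<Longrightarrow>
      exp ((exp \<theta> - 1) * (q * real (card (edge_cut n E0 S))) * real T'
        - \<theta> * (real (card (edge_cut n E0 S)) / 2)) \<le> exp (- 3 * \<l>) ^ card S"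
  proof -
    \<comment> \<open>Once \<open>exp \<theta> * \<tau> \<le> 1\<close>, the exponent is at most
      \<open>(1 - \<theta> / 2) * C\<close>. The smaller \<open>\<tau>\<close> is, the larger
      \<open>\<theta>\<close> may be, and the fewer cut edges \<open>C\<close> are needed for n^-3
      per vertex of the set.\<close>
    have red: "exp ((exp \<theta> - 1) * (q * C) * real T' - \<theta> * (C / 2)) \<le> exp (- 3 * \<l>) ^ s"
      if "exp \<theta> * \<tau> \<le> 1" "0 \<le> \<theta>" "(1 - \<theta> / 2) * C \<le> - 3 * \<l> * real s" "0 \<le> C" for \<theta> C :: real and s :: nat
    proof -
      have "(exp \<theta> - 1) * (q * real T') \<le> exp \<theta> * \<tau>"
        using qT q_le by (intro mult_mono) auto
      then have "(exp \<theta> - 1) * (q * real T') - \<theta> / 2 \<le> 1 - \<theta> / 2" using that by linarith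
      from mult_right_mono[OF this that(4)]
      have "(exp \<theta> - 1) * (q * C) * real T' - \<theta> * (C / 2) \<le> real s * (- 3 * \<l>)"
        using that(3) by (simp add: algebra_simps)
      then have "exp ((exp \<theta> - 1) * (q * C) * real T' - \<theta> * (C / 2)) \<le> exp (real s * (- 3 * \<l>))" by simp
      then show ?thesis by (simp only: exp_of_nat_mult)
    qed
    show thesis
    proof (cases "d \<le> sqrt (real n)")
      case True
      show thesis
      \<comment> \<open>Sparse regime: \<open>\<tau>\<close> is at most n^(-1/4), which admits \<l>
        / 4. Then 48 edges per vertex suffice, as 1 - \<l> / 8 <= - \<l> / 16 for \<l> >= 16 and 48
        / 16 = 3.\<close>
      proof (rule that[of "\<l> / 4"])
        fix S assume S: "S \<subseteq> {1..n}" "S \<noteq> {}" "2 * card S \<le> n"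
        let ?C = "real (card (edge_cut n E0 S))"
        have "48 * 1 * real (card S) \<le> c3 * \<alpha> * ln d * real (card S)"
          using c3\<alpha> lnd lnd0 by (intro mult_right_mono mult_mono) auto
        then have C: "48 * real (card S) \<le> ?C" using cutln[OF S] by linarith
        have "(1 - \<l> / 4 / 2) * ?C \<le> (- \<l> / 16) * ?C" using N1 by (intro mult_right_mono) auto
        also have "\<dots> \<le> (- \<l> / 16) * (48 * real (card S))" using C N1 by (intro mult_left_mono_neg) auto
        finally have "(1 - \<l> / 4 / 2) * ?C \<le> - 3 * \<l> * real (card S)" by simp
        moreover have "exp (\<l> / 4) * \<tau> \<le> exp (\<l> / 4) * exp (- (\<l> / 4))"
          using \<tau>small[OF True] by (intro mult_left_mono) auto
        then have "exp (\<l> / 4) * \<tau> \<le> 1" by (simp add: exp_minus)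
        ultimately show "exp ((exp (\<l> / 4) - 1) * (q * ?C) * real T' - \<l> / 4 * (?C / 2)) \<le> exp (- 3 * \<l>) ^ card S"
          using N1 by (intro red) auto
      qed (use N1 in simp)
    next
      case False
      have "ln (sqrt (real n)) \<le> ln d" using False n0 d0 by (subst ln_le_cancel_iff) auto
      then have ld: "\<l> / 2 \<le> ln d" using n0 by (simp add: ln_sqrt \<l>)
      show thesis
      \<comment> \<open>Dense regime: \<open>\<tau>\<close> is only known to be at most exp (-4),
        which admits 4; but \<open>ln d\<close> is at least \<l> / 2, so every cut has at least 24
        \<l> edges per vertex.\<close>
      proof (rule that[of 4])
        fix S assume S: "S \<subseteq> {1..n}" "S \<noteq> {}" "2 * card S \<le> n"
        let ?C = "real (card (edge_cut n E0 S))"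
        have "48 * (\<l> / 2) * real (card S) \<le> c3 * \<alpha> * ln d * real (card S)"
          using c3\<alpha> ld N1 by (intro mult_right_mono mult_mono) auto
        then have "48 * (\<l> / 2) * real (card S) \<le> ?C" using cutln[OF S] by linarith
        moreover have "0 \<le> \<l> * real (card S)" using N1 by simp
        ultimately have "(1 - 4 / 2) * ?C \<le> - 3 * \<l> * real (card S)" by simp
        moreover have "exp 4 * \<tau> \<le> exp 4 * exp (- 4)" using \<tau>4 by (intro mult_left_mono) auto
        then have "exp 4 * \<tau> \<le> 1" by (simp add: exp_minus)
        ultimately show "exp ((exp 4 - 1) * (q * ?C) * real T' - 4 * (?C / 2)) \<le> exp (- 3 * \<l>) ^ card S"
          by (intro red) auto
      qed simp
    qed
  qed
  define \<xi> where "\<xi> = (1 + exp (- 3 * \<l>)) ^ n - 1 + real n * exp (2 * p * real n * real T' - (2 + 3 / a) * d)"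
  have e3: "exp (- 3 * \<l>) = 1 / real n ^ 3"
    using expl exp_of_nat_mult[of 3 \<l>] by (simp add: exp_minus inverse_eq_divide)
  have e4: "exp (- 4 * \<l>) = 1 / real n ^ 4"
    using expl exp_of_nat_mult[of 4 \<l>] by (simp add: exp_minus inverse_eq_divide)
  have nn: "measure EM {G \<in> space EM. \<not> (\<forall>s\<le>T'. nice_graph n \<kappa> \<Delta> h (G s))} \<le> \<xi>"
    unfolding \<xi>_def
  proof (rule prob_not_nice[OF _ \<theta> _ _ _ cut0 lost])
    fix x assume x: "x \<in> {1..n}"
    show "2 * \<kappa> \<le> real (deg E0 x)" using deg(1)[OF x] by (simp add: \<kappa>_def)
    show "real (deg E0 x) + (2 + 3 / a) * d \<le> \<Delta>" using deg(2)[OF x] by (simp add: \<Delta>_def K algebra_simps)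
  qed (use n3 in auto)
  have b1: "(1 + exp (- 3 * \<l>)) ^ n - 1 \<le> 3 / real n"
  proof -
    define x where "x = real n * exp (- 3 * \<l>)"
    have x: "x = 1 / real n ^ 2" unfolding x_def e3 using n0 by (simp add: power2_eq_square power3_eq_cube)
    have "1 \<le> real n ^ 2" using n3 by (intro one_le_power) simp
    then have x1: "x \<le> 1" unfolding x using n0 by (subst pos_divide_le_eq) simp_all
    have xn: "x \<le> 1 / real n"
    proof -
      have "real n \<le> real n ^ 2" using n3 by (simp add: power2_eq_square)
      then show ?thesis unfolding x using n0 by (intro divide_left_mono) auto
    qed
    have x0: "0 \<le> x" by (simp add: x_def)
    have "(1 + exp (- 3 * \<l>)) ^ n \<le> exp (exp (- 3 * \<l>)) ^ n"
      by (intro power_mono exp_ge_add_one_self) (simp add: add_nonneg_nonneg)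
    also have "\<dots> = exp x" by (simp only: x_def exp_of_nat_mult)
    finally have "(1 + exp (- 3 * \<l>)) ^ n - 1 \<le> x * exp x" using exp_minus_one_le[of x] by linarith
    also have "\<dots> \<le> x * 3"
    proof -
      have "exp x \<le> exp 1" using x1 by simp
      then have "exp x \<le> 3" using exp_le by linarith
      then show ?thesis using x0 by (rule mult_left_mono)
    qed
    finally show ?thesis using xn by linarith
  qed
  have b2: "real n * exp (2 * p * real n * real T' - (2 + 3 / a) * d) \<le> 1 / real n"
  proof -
    have "p * real n * real T' \<le> B * \<l> / real n * real T'" using p_le by (intro mult_right_mono) auto
    also have "\<dots> = d * (r0 * real T')" using d0 by (simp add: r0_def)
    also have "\<dots> \<le> d * 1" using \<tau>1 d0 by (intro mult_left_mono) auto
    finally have "2 * p * real n * real T' - (2 + 3 / a) * d \<le> - (3 / a * d)" by (simp add: algebra_simps)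
    also have "\<dots> \<le> - 3 * \<l>" using d const by (simp add: divide_simps mult.commute)
    finally have "real n * exp (2 * p * real n * real T' - (2 + 3 / a) * d) \<le> real n * exp (- 3 * \<l>)"
      using n0 by simp
    also have "\<dots> = 1 / real n ^ 2" unfolding e3 using n0 by (simp add: power2_eq_square power3_eq_cube)
    also have "\<dots> \<le> 1 / real n"
    proof -
      have "real n \<le> real n ^ 2" using n3 by (simp add: power2_eq_square)
      then show ?thesis using n0 by (intro divide_left_mono) auto
    qed
    finally show ?thesis .
  qed
  have b3: "real T' * exp (2 * (real n * \<rho>) - L) \<le> 1 / real n"
  proof -
    have "real n * \<rho> = (K + 1) * B * \<l>" using n0 by (simp add: \<rho>_def)
    then have "2 * (real n * \<rho>) - L = - 4 * \<l>" by (simp add: L_def K' algebra_simps)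
    then have eq: "exp (2 * (real n * \<rho>) - L) = 1 / real n ^ 4" by (simp only: e4)
    \<comment> \<open>That at most a constant share of edges dies already forces a polynomial
      horizon, at most n^3, for which n^-4 per step is enough.\<close>
    have "real T' \<le> 1 / r0" using \<tau>1 r00 by (simp add: pos_le_divide_eq mult.commute)
    also have "\<dots> = d * real n / (B * \<l>)" by (simp add: r0_def)
    also have "\<dots> \<le> real n * real n / (1 / real n)"
    proof (rule frac_le)
      have "1 / real n \<le> B" using N7 n0 by (simp add: pos_divide_le_eq)
      also have "\<dots> \<le> B * \<l>" using N1 const by simp
      finally show "1 / real n \<le> B * \<l>" .
    qed (use d d0 n0 in \<open>auto intro!: mult_right_mono\<close>)
    finally have "real T' \<le> real n ^ 3" by (simp add: power3_eq_cube)
    then have "real T' * (1 / real n ^ 4) \<le> real n ^ 3 * (1 / real n ^ 4)" by (intro mult_right_mono) auto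
    also have "\<dots> = 1 / real n" using n0 by (simp add: power3_eq_cube power4_eq_xxxx)
    finally show ?thesis by (simp add: eq)
  qed
  have b4: "real n * (real (card {T..T'}) * (level T / \<epsilon>\<^sup>2) ^ Suc k) \<le> 1 / real n"
  proof -
    have lev: "level T \<le> C6 / \<l>"
    proof -
      \<comment> \<open>The factor 5 in \<open>T\<close> leaves
        \<open>lam * real T \<ge> 5 * \<l> - 1 \<ge> 4 * \<l>\<close> after rounding down; the
        resulting n^-2 beats the initial chi-square of order n.\<close>
      have "exp (- lam * real T / 2) \<le> exp (- 2 * \<l>)"
      proof -
        have "\<nu> * (5 * \<l> / \<nu> - 1) \<le> \<nu> * real T" using T1 \<nu>0 by (intro mult_left_mono) auto
        then have "5 * \<l> - \<nu> \<le> \<nu> * real T" using \<nu>0 by (simp add: right_diff_distrib)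
        then show ?thesis using \<nu>1 N1 by (simp add: lam_eq)
      qed
      also have "\<dots> = 1 / real n ^ 2"
        using expl exp_of_nat_mult[of 2 \<l>] by (simp add: exp_minus inverse_eq_divide)
      finally have "exp (- lam * real T / 2) * (real n * \<Delta> / \<kappa>) \<le> 1 / real n ^ 2 * (real n * \<Delta> / \<kappa>)"
        using \<Delta>0 \<kappa>0 by (intro mult_right_mono) auto
      also have "\<dots> = 2 * K / \<alpha> * (1 / real n)"
        using n0 d0 by (simp add: \<Delta>_def \<kappa>_def power2_eq_square mult_ac)
      also have "\<dots> \<le> 2 * K / \<alpha> * (1 / \<l>)"
      proof -
        have "\<l> \<le> real n" using exp_ge_add_one_self[of \<l>] expl by linarith
        then show ?thesis using K0 const N1 by (intro mult_left_mono divide_left_mono) auto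
      qed
      finally have 1: "exp (- lam * real T / 2) * (real n * \<Delta> / \<kappa>) \<le> 2 * K / \<alpha> * (1 / \<l>)" .
      have "eta / lam \<le> 4 * K' / \<alpha> * (4 / \<l>)"
      proof -
        have "eta \<le> 4 * K' / \<alpha> * (\<nu> * (4 / \<l>))"
          unfolding eta_def \<eta>eq using z K'0 const by (intro mult_left_mono) auto
        then show ?thesis using \<nu>0 by (simp add: lam_eq pos_divide_le_eq mult_ac)
      qed
      then have "4 * (M + 1) * (eta / lam) \<le> 4 * (M + 1) * (4 * K' / \<alpha> * (4 / \<l>))"
        using M0 by (intro mult_left_mono) auto
      then have 2: "4 * (M + 1) * eta / lam \<le> 64 * (M + 1) * K' / \<alpha> * (1 / \<l>)"
        by (simp add: mult_ac)
      have "C6 / \<l> = 2 * K / \<alpha> * (1 / \<l>) + 64 * (M + 1) * K' / \<alpha> * (1 / \<l>)"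
        by (simp add: C6 add_divide_distrib)
      then show ?thesis using 1 2 unfolding level_def by linarith
    qed
    have "level T / \<epsilon>\<^sup>2 \<le> C6 / \<l> / \<epsilon>\<^sup>2" using lev by (rule divide_right_mono) simp
    also have "\<dots> = exp (- 3)" using C60 N1 by (simp add: \<epsilon>(2) exp_minus field_simps)
    \<comment> \<open>Since \<open>Suc k\<close> is at least \<l>, a ratio of exp (-3) yields n^-3,
      against n starting vertices and at most n window times.\<close>
    finally have "(level T / \<epsilon>\<^sup>2) ^ Suc k \<le> exp (- 3) ^ Suc k"
      using level_pos[of T] by (intro power_mono) auto
    also have "\<dots> = exp (real (Suc k) * - 3)" by (rule exp_of_nat_mult[symmetric])
    also have "\<dots> \<le> exp (- 3 * \<l>)" using Suck by simp
    finally have p3: "(level T / \<epsilon>\<^sup>2) ^ Suc k \<le> 1 / real n ^ 3" by (simp only: e3)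
    have "sqrt (real n) \<le> real n - 1"
    proof (rule real_le_lsqrt)
      have "real n * 3 \<le> real n * real n" using n3 by (intro mult_left_mono) auto
      then show "real n \<le> (real n - 1)\<^sup>2" by (simp add: power2_eq_square algebra_simps)
    qed (use n3 in auto)
    then have "1 + of_int \<lfloor>sqrt (real n)\<rfloor> \<le> real n" using of_int_floor_le[of "sqrt (real n)"] by linarith
    then have c: "real (card {T..T'}) \<le> real n" by (simp add: T'_def)
    have "0 \<le> (level T / \<epsilon>\<^sup>2) ^ Suc k"
      by (rule zero_le_power[OF divide_nonneg_nonneg[OF less_imp_le[OF level_pos] zero_le_power2]])
    then have "real (card {T..T'}) * (level T / \<epsilon>\<^sup>2) ^ Suc k \<le> real n * (1 / real n ^ 3)"
      using mult_mono[OF c p3] by simp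
    then have "real n * (real (card {T..T'}) * (level T / \<epsilon>\<^sup>2) ^ Suc k) \<le> real n * (real n * (1 / real n ^ 3))"
      by (intro mult_left_mono) auto
    also have "\<dots> = 1 / real n" using n0 by (simp add: power3_eq_cube)
    finally show ?thesis .
  qed
  have "\<xi> \<le> 3 / real n + 1 / real n" using b1 b2 by (simp add: \<xi>_def)
  then have "1 - 6 / real n \<le> 1 - (\<xi> + real T' * exp (2 * (real n * \<rho>) - L)
      + real n * (real (card {T..T'}) * (level T / \<epsilon>\<^sup>2) ^ Suc k))"
    using b3 b4 by (simp add: add_divide_distrib[symmetric])
  also have "\<dots> \<le> measure EM {G \<in> space EM. mixing_time n G \<epsilon> \<le> enat T}"
    by (rule prob_mixing_time[OF \<epsilon>(1) T'_def nn])
  finally show ?thesis .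
qed

theorem theorem1p3:
  fixes a b b' \<alpha> \<beta> :: real
  assumes "a > 0" "b > 0" "b' > 0" "\<alpha> > 0" "\<beta> > 0"
  shows "\<exists>C\<^sub>0>0. \<forall>(p :: nat \<Rightarrow> real) (q :: nat \<Rightarrow> real) (E\<^sub>0 :: nat \<Rightarrow> graph)
      (d :: nat \<Rightarrow> real) (c\<^sub>1 :: real) (c\<^sub>2 :: real) (c\<^sub>3 :: real).
    (\<forall>n\<ge>1. 0 \<le> p n \<and> p n \<le> 1 \<and> 0 \<le> q n \<and> q n \<le> 1 \<and> p n + q n > 0) \<longrightarrow>
    d = (\<lambda>n. mean_degree n (p n) (q n)) \<longrightarrow>
    (\<forall>\<^sub>F n in sequentially. d n \<ge> a * ln (real n)) \<longrightarrow>
    (\<forall>\<^sub>F n in sequentially. p n \<le> b * (ln (real n) / real n ^ 2)) \<longrightarrow>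
    (\<forall>\<^sub>F n in sequentially. q n \<le> b' * (ln (real n) / (d n * real n))) \<longrightarrow>
    (\<forall>n\<ge>1. E\<^sub>0 n \<subseteq> vpairs n) \<longrightarrow>
    c\<^sub>1 \<ge> C\<^sub>0 \<longrightarrow> c\<^sub>2 \<ge> C\<^sub>0 \<longrightarrow> c\<^sub>3 \<ge> C\<^sub>0 \<longrightarrow>
    (\<forall>\<^sub>F n in sequentially. \<forall>x\<in>{1..n}.
        \<alpha> * d n \<le> real (deg (E\<^sub>0 n) x) \<and> real (deg (E\<^sub>0 n) x) \<le> \<beta> * d n) \<longrightarrow>
    (\<forall>\<^sub>F n in sequentially. \<forall>S\<subseteq>{1..n}. real (card S) \<le> c\<^sub>1 * ln (real n) \<longrightarrow>
        real (card (edge_cut n (E\<^sub>0 n) S)) \<ge> c\<^sub>2 * ln (real n) * real (card S)) \<longrightarrow>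
    (\<forall>\<^sub>F n in sequentially. conductance n (E\<^sub>0 n) \<ge> c\<^sub>3 * (ln (d n) / d n)) \<longrightarrow>
    (\<exists>(t :: nat \<Rightarrow> nat) (\<epsilon> :: nat \<Rightarrow> real) (\<delta> :: nat \<Rightarrow> real).
        (\<lambda>n. real (t n)) \<in> O(\<lambda>n. ln (real n) / conductance n (E\<^sub>0 n) ^ 2) \<and>
        (\<forall>n. \<epsilon> n > 0) \<and> \<epsilon> \<longlonglongrightarrow> 0 \<and> \<delta> \<longlonglongrightarrow> 0 \<and>
        (\<forall>\<^sub>F n in sequentially.
           measure (edge_markovian n (p n) (q n) (E\<^sub>0 n))
             {G \<in> space (edge_markovian n (p n) (q n) (E\<^sub>0 n)).
                mixing_time n G (\<epsilon> n) \<le> enat (t n)} \<ge> 1 - \<delta> n))"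
proof -
  define B where "B = b + b'"
  define K where "K = \<beta> + 2 + 3 / a"
  define k0 where "k0 = \<alpha>\<^sup>2 / (16 * K\<^sup>2)"
  define K' where "K' = 2 * (K + 1) * B + 4"
  define M where "M = 2 * K' / (\<alpha> * a)"
  define \<theta>0 where "\<theta>0 = 12 / (\<alpha> * a)"
  define C6 where "C6 = 2 * K / \<alpha> + 64 * (M + 1) * K' / \<alpha>"
  define C\<^sub>0 where "C\<^sub>0 = 48 / \<alpha> + (1 + 40 * exp 4 * B) / k0 + 1"
  have B: "0 < B" "b \<le> B" "b' \<le> B" using assms by (auto simp: B_def)
  have K: "0 < K" using assms by (simp add: K_def add_pos_pos)
  have k0: "0 < k0" using K assms by (simp add: k0_def)
  have K': "0 < K'" using K B by (simp add: K'_def add_pos_pos)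
  have M: "0 < M" using K' assms by (simp add: M_def)
  have C6: "0 < C6" using K K' M assms by (simp add: C6_def add_pos_pos)
  have C\<^sub>0: "0 < C\<^sub>0" "48 / \<alpha> \<le> C\<^sub>0" "(1 + 40 * exp 4 * B) / k0 \<le> C\<^sub>0" "1 \<le> C\<^sub>0"
    using B k0 assms by (simp_all add: C\<^sub>0_def add_pos_pos)
  have large: "\<forall>\<^sub>F n in sequentially. 16 \<le> ln (real n)"
    "\<forall>\<^sub>F n in sequentially. B / (a * sqrt (real n)) \<le> exp (- 4) / 2"
    "\<forall>\<^sub>F n in sequentially. (ln (real n))\<^sup>2 / sqrt (real n) + B / (a * sqrt (real n)) \<le> exp (- (ln (real n) / 4))"
    "\<forall>\<^sub>F n in sequentially. (4 * K' + 4 * exp \<theta>0 * (K + 1) * B) / \<alpha> * (4 / ln (real n)) \<le> 1 / 2"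
    "\<forall>\<^sub>F n in sequentially. 3 \<le> a * ln (real n)"
    "\<forall>\<^sub>F n in sequentially. 1 \<le> B * real n"
  proof -
    show "\<forall>\<^sub>F n in sequentially. 16 \<le> ln (real n)" by real_asymp
    have "(\<lambda>n. B / (a * sqrt (real n))) \<longlonglongrightarrow> 0" using \<open>a > 0\<close> by real_asymp
    then have "\<forall>\<^sub>F n in sequentially. B / (a * sqrt (real n)) < exp (- 4) / 2"
      by (rule order_tendstoD) simp
    then show "\<forall>\<^sub>F n in sequentially. B / (a * sqrt (real n)) \<le> exp (- 4) / 2"
      by (rule eventually_mono) simp
    show "\<forall>\<^sub>F n in sequentially. (ln (real n))\<^sup>2 / sqrt (real n) + B / (a * sqrt (real n)) \<le> exp (- (ln (real n) / 4))"
      using \<open>a > 0\<close> B(1) by real_asymp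
    have "(\<lambda>n. (4 * K' + 4 * exp \<theta>0 * (K + 1) * B) / \<alpha> * (4 / ln (real n))) \<longlonglongrightarrow> 0" by real_asymp
    then have "\<forall>\<^sub>F n in sequentially. (4 * K' + 4 * exp \<theta>0 * (K + 1) * B) / \<alpha> * (4 / ln (real n)) < 1 / 2"
      by (rule order_tendstoD) simp
    then show "\<forall>\<^sub>F n in sequentially. (4 * K' + 4 * exp \<theta>0 * (K + 1) * B) / \<alpha> * (4 / ln (real n)) \<le> 1 / 2"
      by (rule eventually_mono) simp
    show "\<forall>\<^sub>F n in sequentially. 3 \<le> a * ln (real n)" using \<open>a > 0\<close> by real_asymp
    show "\<forall>\<^sub>F n in sequentially. 1 \<le> B * real n" using B(1) by real_asymp
  qed
  show ?thesis
  proof (intro exI[of _ C\<^sub>0] conjI allI impI C\<^sub>0(1))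
    fix p q :: "nat \<Rightarrow> real" and E\<^sub>0 :: "nat \<Rightarrow> graph" and d :: "nat \<Rightarrow> real" and c\<^sub>1 c\<^sub>2 c\<^sub>3 :: real
    assume pq: "\<forall>n\<ge>1. 0 \<le> p n \<and> p n \<le> 1 \<and> 0 \<le> q n \<and> q n \<le> 1 \<and> p n + q n > 0"
      and d: "d = (\<lambda>n. mean_degree n (p n) (q n))"
      and E0: "\<forall>n\<ge>1. E\<^sub>0 n \<subseteq> vpairs n"
      and c3: "C\<^sub>0 \<le> c\<^sub>3"
      and hyps: "\<forall>\<^sub>F n in sequentially. d n \<ge> a * ln (real n)"
        "\<forall>\<^sub>F n in sequentially. p n \<le> b * (ln (real n) / real n ^ 2)"
        "\<forall>\<^sub>F n in sequentially. q n \<le> b' * (ln (real n) / (d n * real n))"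
        "\<forall>\<^sub>F n in sequentially. \<forall>x\<in>{1..n}.
          \<alpha> * d n \<le> real (deg (E\<^sub>0 n) x) \<and> real (deg (E\<^sub>0 n) x) \<le> \<beta> * d n"
        "\<forall>\<^sub>F n in sequentially. conductance n (E\<^sub>0 n) \<ge> c\<^sub>3 * (ln (d n) / d n)"
    define \<Phi> where "\<Phi> = (\<lambda>n. conductance n (E\<^sub>0 n))"
    define t where "t = (\<lambda>n. nat \<lfloor>5 * ln (real n) / (k0 * (\<Phi> n)\<^sup>2)\<rfloor>)"
    \<comment> \<open>The square root of a multiple of the chi-square floor, which is of order 1 /
      ln n. The value 1 only keeps the sequence positive at those n where the quotient is
      not.\<close>
    define \<epsilon> where "\<epsilon> = (\<lambda>n. if 0 < exp 3 * C6 / ln (real n) then sqrt (exp 3 * C6 / ln (real n)) else 1)"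
    \<comment> \<open>\<open>C\<^sub>0\<close> collects three demands: 48 / \<alpha> makes cuts
      large enough, the quotient by \<open>k0\<close> makes edge deaths rare and the gap at least
      (ln d / d)^2, and the final 1 allows passing from the constant to its square.\<close>
    have c3': "48 / \<alpha> \<le> c\<^sub>3" "1 \<le> k0 * c\<^sub>3\<^sup>2" "40 * exp 4 * B \<le> k0 * c\<^sub>3\<^sup>2"
    proof -
      show "48 / \<alpha> \<le> c\<^sub>3" using C\<^sub>0 c3 by linarith
      have "(1 + 40 * exp 4 * B) / k0 \<le> c\<^sub>3" using C\<^sub>0 c3 by linarith
      also have "\<dots> \<le> c\<^sub>3\<^sup>2" using C\<^sub>0 c3 by (intro self_le_power) auto
      finally have *: "1 + 40 * exp 4 * B \<le> k0 * c\<^sub>3\<^sup>2" using k0 by (simp add: pos_divide_le_eq mult.commute)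
      have "0 \<le> 40 * exp 4 * B" using B by simp
      then show "1 \<le> k0 * c\<^sub>3\<^sup>2" "40 * exp 4 * B \<le> k0 * c\<^sub>3\<^sup>2" using * by linarith+
    qed
    show "\<exists>(t :: nat \<Rightarrow> nat) (\<epsilon> :: nat \<Rightarrow> real) (\<delta> :: nat \<Rightarrow> real).
        (\<lambda>n. real (t n)) \<in> O(\<lambda>n. ln (real n) / conductance n (E\<^sub>0 n) ^ 2) \<and>
        (\<forall>n. \<epsilon> n > 0) \<and> \<epsilon> \<longlonglongrightarrow> 0 \<and> \<delta> \<longlonglongrightarrow> 0 \<and>
        (\<forall>\<^sub>F n in sequentially.
           measure (edge_markovian n (p n) (q n) (E\<^sub>0 n))
             {G \<in> space (edge_markovian n (p n) (q n) (E\<^sub>0 n)).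
                mixing_time n G (\<epsilon> n) \<le> enat (t n)} \<ge> 1 - \<delta> n)"
    proof (rule exI[of _ t], rule exI[of _ \<epsilon>], rule exI[of _ "\<lambda>n. 6 / real n"], intro conjI)
      show "(\<lambda>n. real (t n)) \<in> O(\<lambda>n. ln (real n) / conductance n (E\<^sub>0 n) ^ 2)"
      \<comment> \<open>The estimate holds for every n: where the conductance vanishes, division by
        zero makes both sides 0.\<close>
      proof (rule bigoI[of _ "5 / k0"], rule always_eventually, rule allI)
        fix n
        have "real (nat \<lfloor>x\<rfloor>) \<le> \<bar>x\<bar>" for x :: real by linarith
        then have "norm (real (t n)) \<le> \<bar>5 * ln (real n) / (k0 * (\<Phi> n)\<^sup>2)\<bar>"
          unfolding t_def real_norm_def abs_of_nat by blast
        also have "\<dots> = 5 / k0 * norm (ln (real n) / conductance n (E\<^sub>0 n) ^ 2)"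
          using k0 by (simp add: \<Phi>_def abs_mult)
        finally show "norm (real (t n)) \<le> 5 / k0 * norm (ln (real n) / conductance n (E\<^sub>0 n) ^ 2)" .
      qed
      show "\<forall>n. 0 < \<epsilon> n" by (simp add: \<epsilon>_def)
      have "(\<lambda>n. sqrt (exp 3 * C6 / ln (real n))) \<longlonglongrightarrow> 0" using C6 by real_asymp
      moreover have "\<forall>\<^sub>F n in sequentially. sqrt (exp 3 * C6 / ln (real n)) = \<epsilon> n"
        using large(1) by eventually_elim (use C6 in \<open>simp add: \<epsilon>_def\<close>)
      ultimately show "\<epsilon> \<longlonglongrightarrow> 0" by (rule Lim_transform_eventually)
      show "(\<lambda>n. 6 / real n) \<longlonglongrightarrow> 0" by real_asymp
      show "\<forall>\<^sub>F n in sequentially. 1 - 6 / real n \<le> measure (edge_markovian n (p n) (q n) (E\<^sub>0 n))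
             {G \<in> space (edge_markovian n (p n) (q n) (E\<^sub>0 n)). mixing_time n G (\<epsilon> n) \<le> enat (t n)}"
        using large hyps eventually_ge_at_top[of 1]
      proof eventually_elim
        case (elim n)
        have ln0: "0 < ln (real n)" using elim by linarith
        have n0: "0 < real n" using elim by simp
        have pqn: "0 \<le> p n" "p n \<le> 1" "0 \<le> q n" "q n \<le> 1" "0 < p n + q n" using pq elim by auto
        have dlow: "a * ln (real n) \<le> d n" using elim by blast
        have d0: "0 < d n" using elim by linarith
        have dn: "d n \<le> real n"
        proof -
          have "d n \<le> (real n - 1) * 1"
            unfolding d mean_degree_def using pqn elim by (intro mult_left_mono) auto
          then show ?thesis by simp
        qed
        have pn: "p n * real n \<le> B * ln (real n) / real n"
        proof -
          have "p n * real n \<le> b * (ln (real n) / real n ^ 2) * real n"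
            using elim by (intro mult_right_mono) auto
          also have "\<dots> = b * (ln (real n) / real n)" using n0 by (simp add: power2_eq_square)
          also have "\<dots> \<le> B * (ln (real n) / real n)" using B ln0 n0 by (intro mult_right_mono) auto
          finally show ?thesis by simp
        qed
        have qn: "q n \<le> B * ln (real n) / (d n * real n)"
        proof -
          have "q n \<le> b' * (ln (real n) / (d n * real n))" using elim by blast
          also have "\<dots> \<le> B * (ln (real n) / (d n * real n))" using B ln0 n0 d0 by (intro mult_right_mono) auto
          finally show ?thesis by simp
        qed
        have \<epsilon>n: "0 < \<epsilon> n" "(\<epsilon> n)\<^sup>2 = exp 3 * C6 / ln (real n)" using C6 ln0 by (simp_all add: \<epsilon>_def)
        show ?case
          by (rule mixing_time_fixed_n[OF \<open>a > 0\<close> B(1) \<open>\<alpha> > 0\<close> \<open>\<beta> > 0\<close> K_def k0_def K'_def M_def \<theta>0_def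
            C6_def c3' refl elim(1-6) dlow dn pqn(1,2) pn pqn(3,4) qn _ _ _ \<Phi>_def[THEN fun_cong] _
            t_def[THEN fun_cong] \<epsilon>n])
            (use elim E0 in \<open>auto simp: \<Phi>_def\<close>)
      qed
    qed
  qed
qed

end
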